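(* Let $S$ be a finite semigroup that is an ideal extension of a Clifford semigroup by a nilpotent semigroup. Then $\mathrm{SMP}(S)$ is in $\mathrm{P}$.
   Context: For a fixed finite semigroup $S$, the subpower membership problem $\mathrm{SMP}(S)$ is the following decision problem. Input: $n\in\mathbb{N}$ and tuples $\{a_1,\ldots,a_k\}\subseteq S^n$, $b\in S^n$. Problem: is $b$ in the subsemigroup $\langle a_1,\ldots,a_k\rangle$ of the direct power $S^n$ (componentwise multiplication) generated by $\{a_1,\ldots,a_k\}$, i.e. is $b$ a nonempty finite product of elements of $\{a_1,\dots,a_k\}$? The semigroup $S$ is not part of the input; the input size is essentially $n(k+1)$. A semigroup is completely regular if each of its elements is contained in a subsemigroup that is also a group. A semigroup is a Clifford semigroup if it is completely regular and its idempotents are central. A semigroup $N$ is $d$-nilpotent ($d\in\mathbb{N}$, $d\ge1$) if $x_1\cdots x_d=y_1\cdots y_d$ for all $x_1,\ldots,x_d,y_1,\ldots,y_d\in N$; it is nilpotent if it is $d$-nilpotent for some $d$. The common value $0:=x_1\cdots x_d$ is the zero element of $N$. An ideal extension of a semigroup $I$ by a semigroup $Q$ with zero is a semigroup $S$ such that $I$ is an ideal of $S$ and the Rees quotient semigroup $S/I$ is isomorphic to $Q$. *)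

theory Defs
  imports "HOL-Algebra.Group" "HOL-Computational_Algebra.Polynomial"
begin

section \<open>Semigroups\<close>

text \<open>
  HOL-Algebra starts at monoids, whose record carries a unit; here semigroups are records with
  a carrier and a multiplication only. As usual, semigroups and ideals are nonempty.
\<close>

record 'a sgrp = "'a partial_object" +
  sg_mult :: "'a \<Rightarrow> 'a \<Rightarrow> 'a" (infixl "\<cdot>\<index>" 70)

locale sgrp =
  fixes S :: "('a, 'm) sgrp_scheme" (structure)
  assumes nonempty: "carrier S \<noteq> {}"
    and mult_closed: "\<lbrakk>x \<in> carrier S; y \<in> carrier S\<rbrakk> \<Longrightarrow> x \<cdot> y \<in> carrier S"
    and mult_assoc: "\<lbrakk>x \<in> carrier S; y \<in> carrier S; z \<in> carrier S\<rbrakk>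
      \<Longrightarrow> (x \<cdot> y) \<cdot> z = x \<cdot> (y \<cdot> z)"

definition subsemigroup :: "'a set \<Rightarrow> 'a sgrp \<Rightarrow> bool" where
  "subsemigroup H S \<longleftrightarrow> H \<subseteq> carrier S \<and> sgrp (S\<lparr>carrier := H\<rparr>)"

definition completely_regular :: "'a sgrp \<Rightarrow> bool" where
  "completely_regular S \<longleftrightarrow> sgrp S \<and>
     (\<forall>x\<in>carrier S. \<exists>H e. subsemigroup H S \<and> x \<in> H \<and>
        group \<lparr>carrier = H, monoid.mult = sg_mult S, one = e\<rparr>)"

definition clifford :: "'a sgrp \<Rightarrow> bool" where
  "clifford S \<longleftrightarrow> completely_regular S \<and>
     (\<forall>e\<in>carrier S. e \<cdot>\<^bsub>S\<^esub> e = e \<longrightarrow> (\<forall>x\<in>carrier S. e \<cdot>\<^bsub>S\<^esub> x = x \<cdot>\<^bsub>S\<^esub> e))"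

text \<open>The product of a nonempty list; its value on the empty list is irrelevant.\<close>

definition sprod :: "'a sgrp \<Rightarrow> 'a list \<Rightarrow> 'a" where
  "sprod S xs = foldl (sg_mult S) (hd xs) (tl xs)"

definition d_nilpotent :: "nat \<Rightarrow> 'a sgrp \<Rightarrow> bool" where
  "d_nilpotent d N \<longleftrightarrow> sgrp N \<and> d \<ge> 1 \<and>
     (\<forall>xs ys. set xs \<subseteq> carrier N \<and> set ys \<subseteq> carrier N \<and> length xs = d \<and> length ys = d
        \<longrightarrow> sprod N xs = sprod N ys)"

definition nilpotent_sgrp :: "'a sgrp \<Rightarrow> bool" where
  "nilpotent_sgrp N \<longleftrightarrow> (\<exists>d. d_nilpotent d N)"

definition has_zero :: "'a sgrp \<Rightarrow> bool" where
  "has_zero S \<longleftrightarrow> (\<exists>z\<in>carrier S. \<forall>x\<in>carrier S. z \<cdot>\<^bsub>S\<^esub> x = z \<and> x \<cdot>\<^bsub>S\<^esub> z = z)"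

definition sgrp_ideal :: "'a set \<Rightarrow> 'a sgrp \<Rightarrow> bool" where
  "sgrp_ideal I S \<longleftrightarrow> I \<subseteq> carrier S \<and> I \<noteq> {} \<and>
     (\<forall>i\<in>I. \<forall>s\<in>carrier S. s \<cdot>\<^bsub>S\<^esub> i \<in> I \<and> i \<cdot>\<^bsub>S\<^esub> s \<in> I)"

definition rees_cong :: "'a sgrp \<Rightarrow> 'a set \<Rightarrow> ('a \<times> 'a) set" where
  "rees_cong S I = Id_on (carrier S) \<union> I \<times> I"

text \<open>
  For an ideal \<open>I\<close> all products of representatives of two classes are congruent, so the set
  on the right-hand side of the multiplication is the congruence class of any one of them.
\<close>

definition rees_quotient :: "'a sgrp \<Rightarrow> 'a set \<Rightarrow> 'a set sgrp" where
  "rees_quotient S I =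
     \<lparr>carrier = carrier S // rees_cong S I,
      sg_mult = (\<lambda>A B. rees_cong S I `` {x \<cdot>\<^bsub>S\<^esub> y | x y. x \<in> A \<and> y \<in> B})\<rparr>"

definition sgrp_isomorphic :: "'a sgrp \<Rightarrow> 'b sgrp \<Rightarrow> bool" where
  "sgrp_isomorphic S T \<longleftrightarrow>
     (\<exists>h. bij_betw h (carrier S) (carrier T) \<and>
        (\<forall>x\<in>carrier S. \<forall>y\<in>carrier S. h (x \<cdot>\<^bsub>S\<^esub> y) = h x \<cdot>\<^bsub>T\<^esub> h y))"

text \<open>\<open>ideal_extension S I Q\<close>: \<open>S\<close> is an ideal extension of its ideal \<open>I\<close> by \<open>Q\<close>.\<close>

definition ideal_extension :: "'a sgrp \<Rightarrow> 'a set \<Rightarrow> 'b sgrp \<Rightarrow> bool" where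
  "ideal_extension S I Q \<longleftrightarrow> sgrp S \<and> sgrp_ideal I S \<and> sgrp Q \<and> has_zero Q \<and>
     sgrp_isomorphic (rees_quotient S I) Q"

text \<open>In a direct power, an \<open>n\<close>-tuple is represented by a list of length \<open>n\<close>.\<close>

definition sgrp_power :: "'a sgrp \<Rightarrow> nat \<Rightarrow> 'a list sgrp" where
  "sgrp_power S n =
     \<lparr>carrier = {xs. length xs = n \<and> set xs \<subseteq> carrier S}, sg_mult = map2 (sg_mult S)\<rparr>"

inductive_set sgrp_gen :: "'a sgrp \<Rightarrow> 'a set \<Rightarrow> 'a set" for S A where
  incl: "a \<in> A \<Longrightarrow> a \<in> sgrp_gen S A"
| mult: "\<lbrakk>x \<in> sgrp_gen S A; y \<in> sgrp_gen S A\<rbrakk> \<Longrightarrow> x \<cdot>\<^bsub>S\<^esub> y \<in> sgrp_gen S A"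


section \<open>Polynomial time\<close>

text \<open>
  Deterministic multi-tape Turing machines with two-way infinite tapes. The input alphabet is a
  set of symbols of type \<open>'c\<close>; a machine may use finitely many further work symbols, and
  its states are natural numbers, both without loss of generality up to renaming.
\<close>

datatype 'c tape_symbol = Blank | Input 'c | Work nat

datatype head_move = MoveLeft | MoveStay | MoveRight

record 'c tm =
  num_tapes :: nat
  tape_alphabet :: "'c tape_symbol set"
  states :: "nat set"
  start_state :: nat
  accept_state :: nat
  reject_state :: nat
  delta :: "nat \<Rightarrow> 'c tape_symbol list \<Rightarrow> nat \<times> ('c tape_symbol \<times> head_move) list"

definition turing_machine :: "'c set \<Rightarrow> 'c tm \<Rightarrow> bool" where
  "turing_machine \<Sigma> M \<longleftrightarrow>
     num_tapes M \<ge> 1 \<and>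
     finite (tape_alphabet M) \<and> insert Blank (Input ` \<Sigma>) \<subseteq> tape_alphabet M \<and>
     finite (states M) \<and> {start_state M, accept_state M, reject_state M} \<subseteq> states M \<and>
     accept_state M \<noteq> reject_state M \<and>
     (\<forall>q \<in> states M - {accept_state M, reject_state M}. \<forall>gs.
        length gs = num_tapes M \<and> set gs \<subseteq> tape_alphabet M \<longrightarrow>
        (case delta M q gs of (q', acts) \<Rightarrow>
           q' \<in> states M \<and> length acts = num_tapes M \<and> fst ` set acts \<subseteq> tape_alphabet M))"

text \<open>Contents and head position.\<close>

type_synonym 'c tape = "(int \<Rightarrow> 'c tape_symbol) \<times> int"

type_synonym 'c tm_config = "nat \<times> 'c tape list"

definition tape_read :: "'c tape \<Rightarrow> 'c tape_symbol" where
  "tape_read t = fst t (snd t)"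

fun head_offset :: "head_move \<Rightarrow> int" where
  "head_offset MoveLeft = -1"
| "head_offset MoveStay = 0"
| "head_offset MoveRight = 1"

definition tape_act :: "'c tape_symbol \<times> head_move \<Rightarrow> 'c tape \<Rightarrow> 'c tape" where
  "tape_act a t = ((fst t)(snd t := fst a), snd t + head_offset (snd a))"

definition tm_step :: "'c tm \<Rightarrow> 'c tm_config \<Rightarrow> 'c tm_config" where
  "tm_step M c =
     (if fst c = accept_state M \<or> fst c = reject_state M then c
      else (case delta M (fst c) (map tape_read (snd c)) of
              (q', acts) \<Rightarrow> (q', map2 tape_act acts (snd c))))"

definition input_tape :: "'c list \<Rightarrow> 'c tape" where
  "input_tape w =
     ((\<lambda>i. if 0 \<le> i \<and> i < int (length w) then Input (w ! nat i) else Blank), 0)"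

definition tm_init :: "'c tm \<Rightarrow> 'c list \<Rightarrow> 'c tm_config" where
  "tm_init M w = (start_state M, input_tape w # replicate (num_tapes M - 1) (\<lambda>_. Blank, 0))"

definition decides_in_time ::
  "'c set \<Rightarrow> 'c tm \<Rightarrow> 'c list set \<Rightarrow> (nat \<Rightarrow> nat) \<Rightarrow> bool" where
  "decides_in_time \<Sigma> M L T \<longleftrightarrow>
     (\<forall>w \<in> lists \<Sigma>. \<exists>t \<le> T (length w).
        fst ((tm_step M ^^ t) (tm_init M w)) =
          (if w \<in> L then accept_state M else reject_state M))"

definition class_P :: "'c set \<Rightarrow> 'c list set set" where
  "class_P \<Sigma> = {L. finite \<Sigma> \<and> L \<subseteq> lists \<Sigma> \<and>
     (\<exists>M (p :: nat poly). turing_machine \<Sigma> M \<and> decides_in_time \<Sigma> M L (poly p))}"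


section \<open>The subpower membership problem\<close>

datatype 'a smp_symbol = Elem 'a | Sep

definition smp_alphabet :: "'a sgrp \<Rightarrow> 'a smp_symbol set" where
  "smp_alphabet S = insert Sep (Elem ` carrier S)"

text \<open>
  The instance \<open>a\<^sub>1, \<dots>, a\<^sub>k, b\<close> is written as \<open>a\<^sub>1 Sep \<dots> Sep a\<^sub>k Sep b\<close>, one symbol per
  component. This word determines the instance, including \<open>n\<close>, and has length
  \<open>n (k + 1) + k\<close>.
\<close>

definition smp_encode :: "'a list list \<Rightarrow> 'a list \<Rightarrow> 'a smp_symbol list" where
  "smp_encode as b = concat (map (\<lambda>a. map Elem a @ [Sep]) as) @ map Elem b"

lemma smp_encode_inject: "smp_encode as b = smp_encode as' b' \<longleftrightarrow> as = as' \<and> b = b'"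
proof -
  have sep: "map Elem x @ Sep # u = map Elem y @ Sep # v \<longleftrightarrow> x = y \<and> u = v"
    for x y :: "'a list" and u v
  proof (induction x arbitrary: y)
    case Nil then show ?case by (cases y) auto
  next
    case (Cons _ _) then show ?case by (cases y) auto
  qed
  have nosep: "map Elem x \<noteq> map Elem y @ Sep # v" for x y :: "'a list" and v
  proof
    assume "map Elem x = map Elem y @ Sep # v"
    then have "Sep \<in> set (map Elem x)" by simp
    then show False by auto
  qed
  have inj: "map Elem x = map Elem y \<longleftrightarrow> x = y" for x y :: "'a list"
    by (auto simp: inj_map_eq_map inj_def)
  show ?thesis
  proof (induction as arbitrary: as')
    case Nil then show ?case
      by (cases as') (auto simp: smp_encode_def inj nosep)
  next
    case (Cons a as) then show ?case
      by (cases as') (auto simp: smp_encode_def sep nosep[symmetric])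
  qed
qed

lemma length_smp_encode:
  "\<lbrakk>\<forall>a\<in>set as. length a = n; length b = n\<rbrakk>
     \<Longrightarrow> length (smp_encode as b) = n * (length as + 1) + length as"
  by (induction as) (auto simp: smp_encode_def)

text \<open>
  As a language: words that do not encode an instance are no-instances. The semigroup \<open>S\<close>
  is a parameter and not part of the input.
\<close>

definition SMP :: "'a sgrp \<Rightarrow> 'a smp_symbol list set" where
  "SMP S = {smp_encode as b | n as b.
     set as \<subseteq> carrier (sgrp_power S n) \<and> b \<in> carrier (sgrp_power S n) \<and>
     b \<in> sgrp_gen (sgrp_power S n) (set as)}"

end

theory Submission
  imports Defs "HOL-Algebra.Multiplicative_Group"
begin

text \<open>
  A product of at least \<open>d\<close> factors from a set of tuples over \<open>S\<close> is a product of blocks of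
  \<open>d\<close> to \<open>2 d - 1\<close> factors, which are tuples over the ideal \<open>I\<close> when all products of \<open>d\<close>
  elements of \<open>S\<close> lie in \<open>I\<close>. There are only polynomially many blocks, so it remains to decide
  membership for tuples over the Clifford semigroup \<open>I\<close>. There, only the generators above the
  idempotent of \<open>b\<close> matter; their product must have the same idempotent as \<open>b\<close>, and after
  multiplication by this idempotent the question is about a subgroup of a direct product of \<open>n\<close>
  groups of bounded order, which is settled by sifting as in the Schreier--Sims algorithm.

  The algorithm is written in a small language of stack programs, which is compiled to Turing
  machines. All operations on tuples are instances of one transducer that scans two tuples.
\<close>

section \<open>Stack programs\<close>

text \<open>A generated subsemigroup of a power can be exponentially large, so nothing may enumerate
  it. Two counts keep the lists polynomial. Since d belongs to the fixed semigroup, all products of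
  up to 2^r factors, with 2^r at least 2 d, are obtained by squaring the list of generators r times,
  which costs a polynomial of degree 2^r. In the group case, a member is added only if its first
  nontrivial coordinate together with the entry there is new, so at most n |I| members are added;
  sifting decides membership as soon as all products of two members sift to the identity. Inverses
  are powers with a fixed exponent, so the subsemigroups that occur there are subgroups and division
  does not leave them. Stack programs have no arithmetic. A loop that must run n times uses up a
  copy of b, which has n symbols, and repetition by a constant is unrolled in the program text.
  Hence all loops obey one height bound B, a polynomial in the length of the input.\<close>

definition peek :: "'c tape_symbol list \<Rightarrow> 'c tape_symbol" where
  "peek xs = (case xs of [] \<Rightarrow> Blank | x # _ \<Rightarrow> x)"

lemma peek_simps [simp]: "peek [] = Blank" "peek (x # xs) = x"
  by (simp_all add: peek_def)

type_synonym 'c stacks = "nat \<Rightarrow> 'c tape_symbol list"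

abbreviation tops :: "'c stacks \<Rightarrow> nat \<Rightarrow> 'c tape_symbol" where
  "tops s \<equiv> \<lambda>i. peek (s i)"

datatype 'c prog =
    Skip
  | Pop nat
  | Push nat "'c tape_symbol"
  | Seq "'c prog" "'c prog"  (infixr "\<Zsemi>" 60)
  | Cond "(nat \<Rightarrow> 'c tape_symbol) \<Rightarrow> bool" "'c prog" "'c prog"
  | Loop "(nat \<Rightarrow> 'c tape_symbol) \<Rightarrow> bool" nat "'c prog"

text \<open>
  \<open>runs B P s s' t\<close>: from \<open>s\<close>, program \<open>P\<close> ends in \<open>s'\<close> after \<open>t\<close> machine steps. A loop
  names a stack that must shrink in every iteration and whose height is at most \<open>B\<close>, so \<open>B\<close>
  bounds the number of iterations of every loop and the running time is a polynomial in \<open>B\<close>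
  determined by the program text.
\<close>

inductive runs :: "nat \<Rightarrow> 'c prog \<Rightarrow> 'c stacks \<Rightarrow> 'c stacks \<Rightarrow> nat \<Rightarrow> bool" for B where
  runs_Skip: "runs B Skip s s 0"
| runs_Pop: "runs B (Pop v) s (s(v := tl (s v))) 1"
| runs_Push: "runs B (Push v a) s (s(v := a # s v)) 2"
| runs_Seq: "\<lbrakk>runs B P s s1 t1; runs B Q s1 s2 t2\<rbrakk> \<Longrightarrow> runs B (P \<Zsemi> Q) s s2 (t1 + t2)"
| runs_CondT: "\<lbrakk>c (tops s); runs B P s s' t\<rbrakk> \<Longrightarrow> runs B (Cond c P Q) s s' (t + 2)"
| runs_CondF: "\<lbrakk>\<not> c (tops s); runs B Q s s' t\<rbrakk> \<Longrightarrow> runs B (Cond c P Q) s s' (t + 1)"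
| runs_LoopF: "\<not> c (tops s) \<Longrightarrow> runs B (Loop c v P) s s 1"
| runs_LoopT: "\<lbrakk>c (tops s); length (s v) \<le> B; runs B P s s1 t1; length (s1 v) < length (s v);
     runs B (Loop c v P) s1 s2 t2\<rbrakk> \<Longrightarrow> runs B (Loop c v P) s s2 (t1 + t2 + 2)"

primrec time_poly :: "'c prog \<Rightarrow> nat poly" where
  "time_poly Skip = 0"
| "time_poly (Pop v) = 1"
| "time_poly (Push v a) = [:2:]"
| "time_poly (P \<Zsemi> Q) = time_poly P + time_poly Q"
| "time_poly (Cond c P Q) = time_poly P + time_poly Q + [:2:]"
| "time_poly (Loop c v P) = [:1, 1:] * (time_poly P + [:2:])"

text \<open>The second conjunct carries the induction: for a loop the bound must be linear in the
  current height of the named stack, which drops in every iteration. The uniform bound follows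
  because this height is at most \<open>B\<close>.\<close>

lemma runs_time:
  assumes "runs B P s s' t"
  shows "t \<le> poly (time_poly P) B \<and>
    (\<forall>c v Q. P = Loop c v Q \<longrightarrow> t \<le> (length (s v) + 1) * (poly (time_poly Q) B + 2))"
  using assms
proof induction
  case (runs_LoopT c s v P s1 t1 s2 t2)
  let ?T = "poly (time_poly P) B + 2"
  have "t2 \<le> (length (s1 v) + 1) * ?T" using runs_LoopT.IH(2) by simp
  also have "\<dots> \<le> length (s v) * ?T"
    using runs_LoopT.hyps by (intro mult_right_mono) auto
  finally have a: "t1 + t2 + 2 \<le> (length (s v) + 1) * ?T"
    using runs_LoopT.IH(1) by (simp add: algebra_simps)
  also have "\<dots> \<le> (B + 1) * ?T"
    using runs_LoopT.hyps by (intro mult_right_mono) auto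
  finally show ?case using a by (simp add: algebra_simps)
qed auto

primrec prog_wf :: "nat \<Rightarrow> 'c prog \<Rightarrow> bool" where
  "prog_wf K Skip = True"
| "prog_wf K (Pop v) = (v < K)"
| "prog_wf K (Push v a) = (v < K)"
| "prog_wf K (P \<Zsemi> Q) = (prog_wf K P \<and> prog_wf K Q)"
| "prog_wf K (Cond c P Q) = (prog_wf K P \<and> prog_wf K Q)"
| "prog_wf K (Loop c v P) = prog_wf K P"

primrec prog_syms :: "'c prog \<Rightarrow> 'c tape_symbol set" where
  "prog_syms Skip = {}"
| "prog_syms (Pop v) = {}"
| "prog_syms (Push v a) = {a}"
| "prog_syms (P \<Zsemi> Q) = prog_syms P \<union> prog_syms Q"
| "prog_syms (Cond c P Q) = prog_syms P \<union> prog_syms Q"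
| "prog_syms (Loop c v P) = prog_syms P"

lemma finite_prog_syms: "finite (prog_syms P)"
  by (induction P) auto


section \<open>Compilation to Turing machines\<close>

text \<open>
  An instruction maps the scanned symbols to the next state, and to a tape on which a symbol is
  written and the head is moved; the other tapes stay as they are. The position of an instruction
  in the code is the state in which it is executed.
\<close>

type_synonym 'c instr =
  "(nat \<Rightarrow> 'c tape_symbol) \<Rightarrow> nat \<times> nat \<times> 'c tape_symbol \<times> head_move"

definition jump :: "((nat \<Rightarrow> 'c tape_symbol) \<Rightarrow> nat) \<Rightarrow> 'c instr" where
  "jump q = (\<lambda>g. (q g, 0, g 0, MoveStay))"

primrec code_len :: "'c prog \<Rightarrow> nat" where
  "code_len Skip = 0"
| "code_len (Pop v) = 1"
| "code_len (Push v a) = 2"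
| "code_len (P \<Zsemi> Q) = code_len P + code_len Q"
| "code_len (Cond c P Q) = code_len P + code_len Q + 2"
| "code_len (Loop c v P) = code_len P + 2"

primrec compile :: "nat \<Rightarrow> 'c prog \<Rightarrow> 'c instr list" where
  "compile n Skip = []"
| "compile n (Pop v) = [\<lambda>g. (n + 1, v, Blank, MoveRight)]"
| "compile n (Push v a) =
     [\<lambda>g. (n + 1, v, g v, MoveLeft), \<lambda>g. (n + 2, v, a, MoveStay)]"
| "compile n (P \<Zsemi> Q) = compile n P @ compile (n + code_len P) Q"
| "compile n (Cond c P Q) =
     jump (\<lambda>g. if c g then n + 1 else n + code_len P + 2) # compile (n + 1) P @
     jump (\<lambda>_. n + code_len P + code_len Q + 2) # compile (n + code_len P + 2) Q"
| "compile n (Loop c v P) =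
     jump (\<lambda>g. if c g then n + 1 else n + code_len P + 2) # compile (n + 1) P @ [jump (\<lambda>_. n)]"

lemma length_compile [simp]: "length (compile n P) = code_len P"
  by (induction P arbitrary: n) auto

definition instr_ok :: "nat \<Rightarrow> 'c tape_symbol set \<Rightarrow> nat \<Rightarrow> 'c instr \<Rightarrow> bool" where
  "instr_ok K \<Gamma> m i \<longleftrightarrow> (\<forall>g. range g \<subseteq> \<Gamma> \<longrightarrow>
     (case i g of (q, v, a, mv) \<Rightarrow> q \<le> m \<and> v < K \<and> a \<in> \<Gamma>))"

lemma instr_okD:
  assumes "instr_ok K \<Gamma> m i" "range g \<subseteq> \<Gamma>" "i g = (q, v, a, mv)"
  shows "q \<le> m \<and> v < K \<and> a \<in> \<Gamma>"
  using assms(1)[unfolded instr_ok_def, THEN spec, THEN mp, OF assms(2)] by (simp add: assms(3))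

lemma compile_ok:
  assumes "prog_wf K P" "K \<ge> 1" "insert Blank (prog_syms P) \<subseteq> \<Gamma>" "n + code_len P \<le> m"
  shows "\<forall>i \<in> set (compile n P). instr_ok K \<Gamma> m i"
  using assms
proof (induction P arbitrary: n)
  case (Push v a)
  then show ?case by (auto simp: instr_ok_def)
next
  case (Seq P Q)
  then have "\<forall>i \<in> set (compile n P). instr_ok K \<Gamma> m i"
    "\<forall>i \<in> set (compile (n + code_len P) Q). instr_ok K \<Gamma> m i"
    using Seq.IH(1)[of n] Seq.IH(2)[of "n + code_len P"] by simp_all
  then show ?case by (simp add: ball_Un)
next
  case (Cond c P Q)
  then have "\<forall>i \<in> set (compile (n + 1) P). instr_ok K \<Gamma> m i"
    "\<forall>i \<in> set (compile (n + code_len P + 2) Q). instr_ok K \<Gamma> m i"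
    using Cond.IH(1)[of "n + 1"] Cond.IH(2)[of "n + code_len P + 2"] by simp_all
  moreover have "instr_ok K \<Gamma> m (jump q)" if "\<And>g. q g \<le> m" for q
    using that Cond.prems by (auto simp: instr_ok_def jump_def)
  ultimately show ?case using Cond.prems by (simp add: ball_Un)
next
  case (Loop c v P)
  then have "\<forall>i \<in> set (compile (n + 1) P). instr_ok K \<Gamma> m i"
    using Loop.IH[of "n + 1"] by simp
  moreover have "instr_ok K \<Gamma> m (jump q)" if "\<And>g. q g \<le> m" for q
    using that Loop.prems by (auto simp: instr_ok_def jump_def)
  ultimately show ?case using Loop.prems by (simp add: ball_Un)
qed (auto simp: instr_ok_def)

text \<open>One instruction behind the compiled program tests the top of stack \<open>out\<close>
  and enters the accepting or the rejecting state. Conditions of a program may look at every stack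
  number, so tapes from \<open>K\<close> on are presented as blank; \<open>represents\<close> keeps
  the corresponding stacks empty.\<close>

definition prog_tm :: "nat \<Rightarrow> 'c tape_symbol set \<Rightarrow> nat \<Rightarrow> 'c prog \<Rightarrow> 'c tm" where
  "prog_tm K \<Gamma> out P =
     (let l = code_len P;
          code = compile 0 P @ [jump (\<lambda>g. if g out \<noteq> Blank then l + 1 else l + 2)]
      in \<lparr>num_tapes = K, tape_alphabet = \<Gamma>, states = {..l + 2}, start_state = 0,
          accept_state = l + 1, reject_state = l + 2,
          delta = (\<lambda>q gs. case (code ! q) (\<lambda>i. if i < K then gs ! i else Blank) of
            (q', v, a, mv) \<Rightarrow>
              (q', map (\<lambda>i. if i = v then (a, mv) else (gs ! i, MoveStay)) [0..<K]))\<rparr>)"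

lemma turing_machine_prog_tm:
  assumes "prog_wf K P" "K \<ge> 1" "finite \<Gamma>" "insert Blank (prog_syms P \<union> Input ` \<Sigma>) \<subseteq> \<Gamma>"
  shows "turing_machine \<Sigma> (prog_tm K \<Gamma> out P)"
proof -
  define m where "m = code_len P + 2"
  define code where "code = compile 0 P @
    [jump (\<lambda>g. if g out \<noteq> Blank then code_len P + 1 else code_len P + 2)]"
  have ok: "\<forall>i \<in> set code. instr_ok K \<Gamma> m i"
    using compile_ok[OF assms(1,2), of \<Gamma> 0 m] assms
    by (auto simp: code_def m_def instr_ok_def jump_def)
  have len: "length code = code_len P + 1" by (simp add: code_def)
  have delta: "case delta (prog_tm K \<Gamma> out P) q gs of (q', acts) \<Rightarrow>
      q' \<in> {..m} \<and> length acts = K \<and> fst ` set acts \<subseteq> \<Gamma>"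
    if q: "q \<in> {..m} - {code_len P + 1, code_len P + 2}" and gs: "length gs = K" "set gs \<subseteq> \<Gamma>"
    for q gs
  proof -
    let ?g = "\<lambda>i. if i < K then gs ! i else Blank"
    have "q < length code" using q by (auto simp: len m_def)
    then have "instr_ok K \<Gamma> m (code ! q)" using ok by simp
    moreover have "?g i \<in> \<Gamma>" for i
      using nth_mem[of i gs] gs assms(4) by (cases "i < K") (simp_all add: subset_iff)
    then have "range ?g \<subseteq> \<Gamma>" by blast
    moreover obtain q' v a mv where e: "(code ! q) ?g = (q', v, a, mv)" by (rule prod_cases4)
    ultimately have e': "q' \<le> m \<and> v < K \<and> a \<in> \<Gamma>" by (rule instr_okD)
    have "delta (prog_tm K \<Gamma> out P) q gs =
        (q', map (\<lambda>i. if i = v then (a, mv) else (gs ! i, MoveStay)) [0..<K])"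
      using e(1) by (simp add: prog_tm_def Let_def code_def)
    then show ?thesis using e' gs by auto
  qed
  have "num_tapes (prog_tm K \<Gamma> out P) = K" "tape_alphabet (prog_tm K \<Gamma> out P) = \<Gamma>"
    "states (prog_tm K \<Gamma> out P) = {..m}" "start_state (prog_tm K \<Gamma> out P) = 0"
    "accept_state (prog_tm K \<Gamma> out P) = code_len P + 1"
    "reject_state (prog_tm K \<Gamma> out P) = code_len P + 2"
    by (simp_all add: prog_tm_def Let_def m_def)
  then show ?thesis
    unfolding turing_machine_def using assms delta by (auto simp: m_def)
qed

text \<open>The head scans the top of the stack, which extends to the right. Everything else is
  blank, also on the left, so a pop has to erase the symbol that it leaves behind.\<close>

definition stack_tape :: "'c tape_symbol list \<Rightarrow> 'c tape \<Rightarrow> bool" where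
  "stack_tape xs t \<longleftrightarrow>
     (\<forall>i. fst t (snd t + i) = (if 0 \<le> i \<and> i < int (length xs) then xs ! nat i else Blank))"

lemma stack_tape_read: "stack_tape xs t \<Longrightarrow> tape_read t = peek xs"
  unfolding stack_tape_def tape_read_def by (drule spec[of _ 0]) (cases xs; simp)

lemma tape_act_stay: "tape_act (tape_read t, MoveStay) t = t"
  by (simp add: tape_act_def tape_read_def)

lemma stack_tape_pop:
  assumes "stack_tape xs t"
  shows "stack_tape (tl xs) (tape_act (Blank, MoveRight) t)"
  unfolding stack_tape_def
proof
  fix i
  have "fst t (snd t + (i + 1)) =
      (if 0 \<le> i + 1 \<and> i + 1 < int (length xs) then xs ! nat (i + 1) else Blank)"
    using assms unfolding stack_tape_def by blast
  then show "fst (tape_act (Blank, MoveRight) t) (snd (tape_act (Blank, MoveRight) t) + i) =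
      (if 0 \<le> i \<and> i < int (length (tl xs)) then tl xs ! nat i else Blank)"
    by (cases xs) (auto simp: tape_act_def nth_Cons' nat_add_distrib add.commute add.left_commute)
qed

text \<open>A push first moves the head to the left, which amounts to pushing a blank.\<close>

lemma stack_tape_left:
  assumes "stack_tape xs t"
  shows "stack_tape (Blank # xs) (tape_act (tape_read t, MoveLeft) t)"
  unfolding stack_tape_def
proof
  fix i
  have "fst t (snd t + (i - 1)) =
      (if 0 \<le> i - 1 \<and> i - 1 < int (length xs) then xs ! nat (i - 1) else Blank)"
    using assms unfolding stack_tape_def by blast
  then show "fst (tape_act (tape_read t, MoveLeft) t) (snd (tape_act (tape_read t, MoveLeft) t) + i) =
      (if 0 \<le> i \<and> i < int (length (Blank # xs)) then (Blank # xs) ! nat i else Blank)"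
    by (auto simp: tape_act_def tape_read_def nth_Cons' nat_diff_distrib algebra_simps)
qed

lemma stack_tape_write:
  assumes "stack_tape (b # xs) t"
  shows "stack_tape (a # xs) (tape_act (a, MoveStay) t)"
  unfolding stack_tape_def
proof
  fix i
  have "fst t (snd t + i) =
      (if 0 \<le> i \<and> i < int (length (b # xs)) then (b # xs) ! nat i else Blank)"
    using assms unfolding stack_tape_def by blast
  then show "fst (tape_act (a, MoveStay) t) (snd (tape_act (a, MoveStay) t) + i) =
      (if 0 \<le> i \<and> i < int (length (a # xs)) then (a # xs) ! nat i else Blank)"
    by (auto simp: tape_act_def nth_Cons')
qed

definition represents :: "nat \<Rightarrow> 'c stacks \<Rightarrow> nat \<Rightarrow> 'c tm_config \<Rightarrow> bool" where
  "represents K s q c \<longleftrightarrow> fst c = q \<and> length (snd c) = K \<and>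
     (\<forall>i<K. stack_tape (s i) (snd c ! i)) \<and> (\<forall>i\<ge>K. s i = [])"

locale prog_machine =
  fixes K :: nat and \<Gamma> :: "'c tape_symbol set" and out :: nat and P0 :: "'c prog"
    and code :: "'c instr list"
  assumes code_eq: "code = compile 0 P0 @
    [jump (\<lambda>g. if g out \<noteq> Blank then code_len P0 + 1 else code_len P0 + 2)]"
    and K: "K \<ge> 1"
begin

abbreviation "M \<equiv> prog_tm K \<Gamma> out P0"

lemma step:
  assumes rep: "represents K s q c" and q: "q < length code"
    and i: "(code ! q) (tops s) = (q', v, a, mv)" and v: "v < K"
    and st: "stack_tape xs (tape_act (a, mv) (snd c ! v))"
  shows "represents K (s(v := xs)) q' (tm_step M c)"
proof -
  have len: "length (snd c) = K" using rep by (simp add: represents_def)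
  have rd_nth: "tape_read (snd c ! i) = tops s i" if "i < K" for i
    by (rule stack_tape_read) (use rep that in \<open>simp add: represents_def\<close>)
  have rd: "map tape_read (snd c) = map (tops s) [0..<K]"
    by (rule nth_equalityI) (simp_all add: len rd_nth)
  have g: "(\<lambda>i. if i < K then map (tops s) [0..<K] ! i else Blank) = tops s"
    using rep unfolding represents_def by auto
  have "delta M q (map (tops s) [0..<K]) =
      (q', map (\<lambda>i. if i = v then (a, mv) else (map (tops s) [0..<K] ! i, MoveStay)) [0..<K])"
    using i unfolding prog_tm_def Let_def code_eq[symmetric] by (simp add: g)
  moreover have "q \<noteq> accept_state M" "q \<noteq> reject_state M"
    using q by (auto simp: code_eq prog_tm_def Let_def)
  ultimately have eq: "tm_step M c = (q', map2 tape_act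
      (map (\<lambda>i. if i = v then (a, mv) else (map (tops s) [0..<K] ! i, MoveStay)) [0..<K]) (snd c))"
    using rep by (simp add: tm_step_def rd represents_def)
  have "stack_tape (s j) (tape_act (peek (s j), MoveStay) (snd c ! j))" if "j < K" for j
    using that rep tape_act_stay[of "snd c ! j"] stack_tape_read[of "s j" "snd c ! j"]
    unfolding represents_def by simp
  then show ?thesis using rep st v unfolding represents_def eq by auto
qed

lemma step_jump:
  assumes rep: "represents K s q c" and q: "q < length code" and i: "code ! q = jump f"
  shows "represents K s (f (tops s)) (tm_step M c)"
proof -
  have "stack_tape (s 0) (tape_act (tops s 0, MoveStay) (snd c ! 0))"
    using rep K stack_tape_read[of "s 0" "snd c ! 0"] tape_act_stay[of "snd c ! 0"]
    unfolding represents_def by force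
  from step[OF rep q _ _ this] i K show ?thesis by (simp add: jump_def)
qed

lemma steps_add: "(tm_step M ^^ (m + n)) c = (tm_step M ^^ n) ((tm_step M ^^ m) c)"
  by (induction n) auto

lemma steps_Suc: "(tm_step M ^^ (m + 1)) c = (tm_step M ^^ m) (tm_step M c)"
  using steps_add[of 1 m c] by simp

text \<open>Jump addresses are absolute, so the statement is about a block at an arbitrary position
  in the code; the induction can then enter the subprograms with a longer
  \<open>pre\<close>.\<close>

lemma compile_correct:
  assumes "runs B P s s' t" "prog_wf K P"
    and "code = pre @ compile (length pre) P @ post" "post \<noteq> []"
    and "represents K s (length pre) c"
  shows "represents K s' (length pre + code_len P) ((tm_step M ^^ t) c)"
  using assms
proof (induction arbitrary: pre post c)
  case (runs_Skip s)
  then show ?case by simp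
next
  case (runs_Pop v s)
  have "stack_tape (tl (s v)) (tape_act (Blank, MoveRight) (snd c ! v))"
    using runs_Pop.prems by (intro stack_tape_pop) (auto simp: represents_def)
  from step[OF runs_Pop.prems(4) _ _ _ this, of "length pre + 1"] runs_Pop.prems
  show ?case by (simp add: nth_append fun_upd_def)
next
  case (runs_Push v a s)
  let ?c = "tm_step M c"
  have rd: "tape_read (snd c ! v) = peek (s v)"
    using runs_Push.prems by (intro stack_tape_read) (auto simp: represents_def)
  have "stack_tape (Blank # s v) (tape_act (peek (s v), MoveLeft) (snd c ! v))"
    using runs_Push.prems unfolding rd[symmetric]
    by (intro stack_tape_left) (auto simp: represents_def)
  from step[OF runs_Push.prems(4) _ _ _ this, of "length pre + 1"] runs_Push.prems
  have r1: "represents K (s(v := Blank # s v)) (length pre + 1) ?c"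
    by (simp add: nth_append)
  then have "stack_tape (Blank # s v) (snd ?c ! v)"
    using runs_Push.prems unfolding represents_def by auto
  from stack_tape_write[OF this, of a]
  have "stack_tape (a # s v) (tape_act (a, MoveStay) (snd ?c ! v))" .
  from step[OF r1 _ _ _ this, of "length pre + 2"] runs_Push.prems
  show ?case by (simp add: nth_append numeral_2_eq_2) (simp add: fun_upd_def)
next
  case (runs_Seq P s s1 t1 Q s2 t2)
  have "represents K s1 (length pre + code_len P) ((tm_step M ^^ t1) c)"
    using runs_Seq.prems by (intro runs_Seq.IH(1)[of _ "compile (length pre + code_len P) Q @ post"]) auto
  then have "represents K s2 (length (pre @ compile (length pre) P) + code_len Q)
      ((tm_step M ^^ t2) ((tm_step M ^^ t1) c))"
    using runs_Seq.prems by (intro runs_Seq.IH(2)[of _ post]) auto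
  then show ?case by (simp only: steps_add code_len.simps length_append length_compile add.assoc)
next
  case (runs_CondT cc s P s' t Q)
  let ?q = "\<lambda>g. if cc g then length pre + 1 else length pre + code_len P + 2"
  let ?j = "jump ?q"
  let ?k = "jump (\<lambda>_. length pre + code_len P + code_len Q + 2)"
  have "represents K s (length (pre @ [?j])) (tm_step M c)"
    using step_jump[OF runs_CondT.prems(4), of ?q]
      runs_CondT.prems runs_CondT.hyps by (simp add: nth_append)
  then have "represents K s' (length (pre @ [?j]) + code_len P) ((tm_step M ^^ t) (tm_step M c))"
    using runs_CondT.prems
    by (intro runs_CondT.IH[of _ "?k # compile (length pre + code_len P + 2) Q @ post"]) auto
  from step_jump[OF this, of "\<lambda>_. length pre + code_len P + code_len Q + 2"] runs_CondT.prems
  have "represents K s' (length pre + code_len P + code_len Q + 2)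
      (tm_step M ((tm_step M ^^ t) (tm_step M c)))"
    by (simp add: nth_append)
  moreover have "t + 2 = (1 + t) + 1" by simp
  ultimately show ?case by (simp only: steps_add) (simp add: add.assoc)
next
  case (runs_CondF cc s Q s' t P)
  let ?q = "\<lambda>g. if cc g then length pre + 1 else length pre + code_len P + 2"
  let ?j = "jump ?q"
  let ?k = "jump (\<lambda>_. length pre + code_len P + code_len Q + 2)"
  have "represents K s (length (pre @ [?j] @ compile (length pre + 1) P @ [?k])) (tm_step M c)"
    using step_jump[OF runs_CondF.prems(4), of ?q]
      runs_CondF.prems runs_CondF.hyps by (simp add: nth_append)
  then have "represents K s' (length (pre @ [?j] @ compile (length pre + 1) P @ [?k]) + code_len Q)
      ((tm_step M ^^ t) (tm_step M c))"
    using runs_CondF.prems by (intro runs_CondF.IH[of _ post]) auto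
  then show ?case unfolding steps_Suc by (simp add: add.assoc)
next
  case (runs_LoopF cc s v P)
  let ?q = "\<lambda>g. if cc g then length pre + 1 else length pre + code_len P + 2"
  from step_jump[OF runs_LoopF.prems(4), of ?q]
    runs_LoopF.prems runs_LoopF.hyps
  show ?case by (simp add: nth_append)
next
  case (runs_LoopT cc s v P s1 t1 s2 t2)
  let ?q = "\<lambda>g. if cc g then length pre + 1 else length pre + code_len P + 2"
  let ?j = "jump ?q"
  have "represents K s (length (pre @ [?j])) (tm_step M c)"
    using step_jump[OF runs_LoopT.prems(4), of ?q]
      runs_LoopT.prems runs_LoopT.hyps by (simp add: nth_append)
  then have "represents K s1 (length (pre @ [?j]) + code_len P) ((tm_step M ^^ t1) (tm_step M c))"
    using runs_LoopT.prems
    by (intro runs_LoopT.IH(1)[of _ "jump (\<lambda>_. length pre) # post"]) auto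
  from step_jump[OF this, of "\<lambda>_. length pre"] runs_LoopT.prems
  have "represents K s1 (length pre) (tm_step M ((tm_step M ^^ t1) (tm_step M c)))"
    by (simp add: nth_append)
  then have "represents K s2 (length pre + code_len (Loop cc v P))
      ((tm_step M ^^ t2) (tm_step M ((tm_step M ^^ t1) (tm_step M c))))"
    using runs_LoopT.prems by (intro runs_LoopT.IH(2)[of _ post]) auto
  moreover have "t1 + t2 + 2 = ((1 + t1) + 1) + t2" by simp
  ultimately show ?case by (simp only: steps_add) simp
qed

end

section \<open>Languages decided by stack programs\<close>

definition init_stacks :: "'c list \<Rightarrow> 'c stacks" where
  "init_stacks w = (\<lambda>i. if i = 0 then map Input w else [])"

lemma represents_init:
  assumes "num_tapes M = K" "start_state M = 0" "K \<ge> 1"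
  shows "represents K (init_stacks w) 0 (tm_init M w)"
  using assms
  by (auto simp: represents_def tm_init_def init_stacks_def stack_tape_def input_tape_def nth_Cons')

lemma prog_decides_in_P:
  fixes P :: "'c prog" and \<Sigma> :: "'c set"
  assumes fin: "finite \<Sigma>" and L: "L \<subseteq> lists \<Sigma>" and wf: "prog_wf K P" and K: "K \<ge> 1"
    and run: "\<And>w. w \<in> lists \<Sigma> \<Longrightarrow> \<exists>s' t. runs (poly b (length w)) P (init_stacks w) s' t \<and>
      (peek (s' out) \<noteq> Blank \<longleftrightarrow> w \<in> L)"
  shows "L \<in> class_P \<Sigma>"
proof -
  define \<Gamma> where "\<Gamma> = insert Blank (prog_syms P \<union> Input ` \<Sigma>)"
  have fin\<Gamma>: "finite \<Gamma>" using fin by (simp add: \<Gamma>_def finite_prog_syms)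
  define code where "code = compile 0 P @
    [jump (\<lambda>g. if g out \<noteq> Blank then code_len P + 1 else code_len P + 2)]"
  interpret prog_machine K \<Gamma> out P code
    using K by unfold_locales (simp_all add: code_def)
  \<comment> \<open>The additional step is the final test of stack \<open>out\<close>.\<close>
  define p where "p = pcompose (time_poly P) b + 1"
  have M: "num_tapes M = K" "start_state M = 0" "accept_state M = code_len P + 1"
      "reject_state M = code_len P + 2"
    by (simp_all add: prog_tm_def Let_def)
  have "decides_in_time \<Sigma> M L (poly p)"
    unfolding decides_in_time_def
  proof
    fix w assume "w \<in> lists \<Sigma>"
    from run[OF this] obtain s' t where
      r: "runs (poly b (length w)) P (init_stacks w) s' t" "peek (s' out) \<noteq> Blank \<longleftrightarrow> w \<in> L"
      by blast
    have r0: "represents K (init_stacks w) (length ([] :: 'c instr list)) (tm_init M w)"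
      using represents_init[OF M(1,2) K] by simp
    have "represents K s' (code_len P) ((tm_step M ^^ t) (tm_init M w))"
      using compile_correct[OF r(1) wf _ _ r0] by (simp add: code_def)
    from step_jump[OF this, of "\<lambda>g. if g out \<noteq> Blank then code_len P + 1 else code_len P + 2"] r(2)
    have "fst ((tm_step M ^^ Suc t) (tm_init M w)) = (if w \<in> L then accept_state M else reject_state M)"
      by (simp add: M represents_def code_def nth_append)
    moreover have "Suc t \<le> poly p (length w)"
      using runs_time[OF r(1)] by (simp add: p_def poly_pcompose)
    ultimately show "\<exists>t\<le>poly p (length w). fst ((tm_step M ^^ t) (tm_init M w)) =
        (if w \<in> L then accept_state M else reject_state M)" by blast
  qed
  then show ?thesis
    using turing_machine_prog_tm[OF wf K fin\<Gamma>, of \<Sigma> out] fin L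
    unfolding class_P_def \<Gamma>_def by blast
qed


section \<open>Generated subsemigroups\<close>

lemma sgrp_gen_mono: "A \<subseteq> B \<Longrightarrow> sgrp_gen T A \<subseteq> sgrp_gen T B"
proof
  fix x assume "A \<subseteq> B" "x \<in> sgrp_gen T A"
  from this(2,1) show "x \<in> sgrp_gen T B"
    by induction (auto intro: sgrp_gen.intros)
qed

lemma sgrp_gen_least:
  assumes "A \<subseteq> X" "\<And>x y. x \<in> X \<Longrightarrow> y \<in> X \<Longrightarrow> sg_mult T x y \<in> X"
  shows "sgrp_gen T A \<subseteq> X"
proof
  fix x assume "x \<in> sgrp_gen T A"
  then show "x \<in> X" by induction (use assms in auto)
qed

lemma sgrp_gen_subset: "A \<subseteq> sgrp_gen T B \<Longrightarrow> sgrp_gen T A \<subseteq> sgrp_gen T B"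
  by (rule sgrp_gen_least) (auto intro: sgrp_gen.intros)

lemma sgrp_gen_nonempty: "x \<in> sgrp_gen T A \<Longrightarrow> A \<noteq> {}"
  by (induction rule: sgrp_gen.induct) auto

text \<open>The power \<open>x\<^sup>k\<^sup>+\<^sup>1\<close>.\<close>

primrec spow :: "'a sgrp \<Rightarrow> 'a \<Rightarrow> nat \<Rightarrow> 'a" where
  "spow T x 0 = x"
| "spow T x (Suc k) = sg_mult T x (spow T x k)"

lemma spow_in_gen: "x \<in> sgrp_gen T A \<Longrightarrow> spow T x k \<in> sgrp_gen T A"
  by (induction k) (auto intro: sgrp_gen.intros)


section \<open>Membership in Clifford semigroups\<close>

text \<open>
  A Clifford semigroup with universe \<open>X\<close> in which \<open>x\<^sup>k\<^sup>+\<^sup>1\<close> is the idempotent of the maximal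
  subgroup of every \<open>x\<close>; then \<open>x\<^sup>k\<close> is the inverse of \<open>x\<close> in this subgroup.
\<close>

locale clifford_exp =
  fixes T :: "'x sgrp" (structure) and X :: "'x set" and k :: nat
  assumes closed: "\<lbrakk>x \<in> X; y \<in> X\<rbrakk> \<Longrightarrow> x \<cdot> y \<in> X"
    and assoc: "\<lbrakk>x \<in> X; y \<in> X; z \<in> X\<rbrakk> \<Longrightarrow> (x \<cdot> y) \<cdot> z = x \<cdot> (y \<cdot> z)"
    and k: "k \<ge> 1"
    and idp_mult: "x \<in> X \<Longrightarrow> spow T x k \<cdot> x = x"
    and idp_central: "\<lbrakk>x \<in> X; y \<in> X\<rbrakk> \<Longrightarrow> spow T x k \<cdot> y = y \<cdot> spow T x k"
    and idp_hom: "\<lbrakk>x \<in> X; y \<in> X\<rbrakk> \<Longrightarrow> spow T (x \<cdot> y) k = spow T x k \<cdot> spow T y k"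
    and idp_idp: "x \<in> X \<Longrightarrow> spow T (spow T x k) k = spow T x k"
begin

abbreviation idp :: "'x \<Rightarrow> 'x" where "idp x \<equiv> spow T x k"
abbreviation iv :: "'x \<Rightarrow> 'x" where "iv x \<equiv> spow T x (k - Suc 0)"

lemma spow_closed [simp]: "x \<in> X \<Longrightarrow> spow T x j \<in> X"
  by (induction j) (auto intro: closed)

lemma spow_comm: "x \<in> X \<Longrightarrow> spow T x j \<cdot> x = x \<cdot> spow T x j"
  by (induction j) (auto simp: assoc closed)

lemma iv_right: "x \<in> X \<Longrightarrow> x \<cdot> iv x = idp x"
proof -
  obtain j where j: "k = Suc j" using k by (cases k) auto
  show ?thesis unfolding j by simp
qed

lemma iv_left: "x \<in> X \<Longrightarrow> iv x \<cdot> x = idp x"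
  by (simp add: spow_comm iv_right)

lemma idp_idem: "x \<in> X \<Longrightarrow> idp x \<cdot> idp x = idp x"
  using idp_mult[of "idp x"] by (simp add: idp_idp)

lemma idp_mult_right: "x \<in> X \<Longrightarrow> x \<cdot> idp x = x"
  using idp_central[of x x] idp_mult by simp

lemma idp_spow: "x \<in> X \<Longrightarrow> idp (spow T x j) = idp x"
  by (induction j) (auto simp: idp_hom idp_idem)

lemma gen_closed: "A \<subseteq> X \<Longrightarrow> sgrp_gen T A \<subseteq> X"
  by (rule sgrp_gen_least) (auto intro: closed)

text \<open>The semilattice order on idempotents, e \<le> f iff e f = e, applied to the idempotents
  of \<open>b\<close> and \<open>c\<close>.\<close>

definition below :: "'x \<Rightarrow> 'x \<Rightarrow> bool" where
  "below b c \<longleftrightarrow> idp b \<cdot> idp c = idp b"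

lemma below_multD:
  assumes "b \<in> X" "x \<in> X" "y \<in> X" "below b (x \<cdot> y)"
  shows "below b x" "below b y"
proof -
  have e: "idp b \<cdot> (idp x \<cdot> idp y) = idp b"
    using assms by (simp add: below_def idp_hom)
  have "idp b \<cdot> idp y = (idp b \<cdot> (idp x \<cdot> idp y)) \<cdot> idp y" by (simp add: e)
  also have "\<dots> = idp b \<cdot> (idp x \<cdot> idp y)" using assms by (simp add: assoc closed idp_idem)
  finally show "below b y" using e by (simp add: below_def)
  have "idp b \<cdot> idp x = (idp b \<cdot> (idp y \<cdot> idp x)) \<cdot> idp x"
    using e assms idp_central[of x "idp y"] by simp
  also have "\<dots> = idp b \<cdot> (idp y \<cdot> idp x)" using assms by (simp add: assoc closed idp_idem)
  also have "\<dots> = idp b" using e assms idp_central[of x "idp y"] by simp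
  finally show "below b x" by (simp add: below_def)
qed

lemma below_multI:
  assumes "b \<in> X" "x \<in> X" "y \<in> X" "below b x" "below b y"
  shows "below b (x \<cdot> y)"
  using assms assoc[of "idp b" "idp x" "idp y"] by (simp add: below_def idp_hom)

lemma gen_below:
  assumes A: "A \<subseteq> X" and b: "b \<in> X" and x: "x \<in> sgrp_gen T A" and "below b x"
  shows "x \<in> sgrp_gen T {c \<in> A. below b c}"
  using x assms(4)
proof induction
  case (incl a)
  then show ?case by (auto intro: sgrp_gen.incl)
next
  case (mult x y)
  then have "x \<in> X" "y \<in> X" using gen_closed[OF A] by auto
  then show ?case using mult below_multD[OF b] by (auto intro: sgrp_gen.mult)
qed

lemma gen_above:
  assumes A: "A \<subseteq> X" and p: "p \<in> X" "\<forall>c \<in> A. below p c" and x: "x \<in> sgrp_gen T A"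
  shows "below p x"
  using x
proof induction
  case (mult x y)
  then show ?case using gen_closed[OF A] by (intro below_multI p) auto
qed (use p in auto)

lemma below_antisym:
  assumes "x \<in> X" "y \<in> X" "below x y" "below y x"
  shows "idp x = idp y"
  using assms idp_central[of x "idp y"] by (simp add: below_def)

text \<open>A central idempotent f satisfies f x y = (f x) (f y), so multiplication by it is a
  homomorphism.\<close>

lemma gen_idp_mult:
  assumes A: "A \<subseteq> X" and b: "b \<in> X" and x: "x \<in> sgrp_gen T A"
  shows "idp b \<cdot> x \<in> sgrp_gen T ((\<lambda>c. idp b \<cdot> c) ` A)"
  using x
proof induction
  case (mult x y)
  then have X: "x \<in> X" "y \<in> X" using gen_closed[OF A] by auto
  have "idp b \<cdot> (x \<cdot> y) = (idp b \<cdot> idp b) \<cdot> (x \<cdot> y)"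
    using b by (simp add: idp_idem)
  also have "\<dots> = idp b \<cdot> (idp b \<cdot> x) \<cdot> y"
    using X b by (simp add: assoc closed)
  also have "\<dots> = (idp b \<cdot> x) \<cdot> (idp b \<cdot> y)"
    using X b idp_central[of b "idp b \<cdot> x"] by (simp add: assoc closed)
  finally show ?case using mult by (auto intro: sgrp_gen.mult)
qed (auto intro: sgrp_gen.incl)

text \<open>The idempotent of a product is the meet of the idempotents of its factors. So the
  product of all generators has the least idempotent that a generated element can have, and it shows
  that this idempotent is attained.\<close>

lemma fold_mult:
  assumes "set cs \<subseteq> X" "c \<in> X" "A = insert c (set cs)"
  defines "p \<equiv> fold (\<lambda>x y. y \<cdot> x) cs c"
  shows "p \<in> sgrp_gen T A" "\<forall>a \<in> A. below p a"
proof -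
  have "p \<in> sgrp_gen T A \<and> p \<in> X \<and> (\<forall>a \<in> A. below p a)"
    using assms(1-3) unfolding p_def
  proof (induction cs arbitrary: A rule: rev_induct)
    case Nil
    then show ?case by (auto intro: sgrp_gen.incl simp: below_def idp_idem)
  next
    case (snoc y cs)
    let ?p = "fold (\<lambda>x y. y \<cdot> x) cs c"
    have IH: "?p \<in> sgrp_gen T (insert c (set cs))" "?p \<in> X" "\<forall>a \<in> insert c (set cs). below ?p a"
      using snoc.IH[OF _ _ refl] snoc.prems by auto
    have y: "y \<in> X" using snoc.prems by simp
    have p: "?p \<cdot> y \<in> X" using IH y closed by simp
    have "below (?p \<cdot> y) (?p \<cdot> y)" using p by (simp add: below_def idp_idem)
    then have b: "below (?p \<cdot> y) ?p" "below (?p \<cdot> y) y"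
      using below_multD[OF p IH(2) y] by auto
    have tr: "below (?p \<cdot> y) a" if "below ?p a" "a \<in> X" for a
    proof -
      have "idp (?p \<cdot> y) \<cdot> idp a = (idp (?p \<cdot> y) \<cdot> idp ?p) \<cdot> idp a"
        using b by (simp add: below_def)
      also have "\<dots> = idp (?p \<cdot> y) \<cdot> (idp ?p \<cdot> idp a)" using that p IH by (simp add: assoc)
      finally show ?thesis using that b by (simp add: below_def)
    qed
    have "?p \<cdot> y \<in> sgrp_gen T A"
      using IH(1) sgrp_gen_mono[of "insert c (set cs)" A] snoc.prems
      by (auto intro!: sgrp_gen.mult intro: sgrp_gen.incl)
    then show ?case using p b tr IH snoc.prems by auto
  qed
  then show "p \<in> sgrp_gen T A" "\<forall>a \<in> A. below p a" by auto
qed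

text \<open>
  Only generators above the idempotent of \<open>b\<close> can occur in a product that equals \<open>b\<close>, and the
  remaining question is membership in a subgroup of the maximal subgroup of \<open>b\<close>.
\<close>

lemma mem_gen_iff:
  assumes A: "A \<subseteq> X" and b: "b \<in> X" and gs: "set gs = {c \<in> A. below b c}"
  shows "b \<in> sgrp_gen T A \<longleftrightarrow> gs \<noteq> [] \<and> idp (fold (\<lambda>x y. y \<cdot> x) (tl gs) (hd gs)) = idp b \<and>
    b \<in> sgrp_gen T ((\<lambda>c. idp b \<cdot> c) ` set gs)"
proof (cases "gs = []")
  case True
  have "below b b" using b by (simp add: below_def idp_idem)
  then show ?thesis using True gen_below[OF A b] sgrp_gen_nonempty gs by fastforce
next
  case False
  define p where "p = fold (\<lambda>x y. y \<cdot> x) (tl gs) (hd gs)"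
  have gsX: "set gs \<subseteq> X" using A gs by auto
  have hd: "set (tl gs) \<subseteq> X" "hd gs \<in> X" "set gs = insert (hd gs) (set (tl gs))"
    using gsX False by (cases gs; auto)+
  note p = fold_mult[OF hd, folded p_def]
  have pX: "p \<in> X" using p gen_closed[OF gsX] by auto
  have bb: "below b b" using b by (simp add: below_def idp_idem)
  show ?thesis
  proof
    assume "b \<in> sgrp_gen T A"
    then have bg: "b \<in> sgrp_gen T (set gs)" using gen_below[OF A b _ bb] gs by simp
    \<comment> \<open>As a product of the listed elements, \<open>b\<close> is above
      \<open>p\<close>; as such a product, \<open>p\<close> is above \<open>b\<close>, since all
      listed elements are.\<close>
    have "below p b" using gen_above[OF gsX pX p(2) bg] .
    moreover have "below b p" using gen_above[OF gsX b _ p(1)] gs by auto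
    ultimately have "idp p = idp b" using below_antisym pX b by blast
    moreover have "b \<in> sgrp_gen T ((\<lambda>c. idp b \<cdot> c) ` set gs)"
      using gen_idp_mult[OF gsX b bg] idp_mult[OF b] by simp
    ultimately show "gs \<noteq> [] \<and> idp (fold (\<lambda>x y. y \<cdot> x) (tl gs) (hd gs)) = idp b \<and>
      b \<in> sgrp_gen T ((\<lambda>c. idp b \<cdot> c) ` set gs)" using False by (simp add: p_def)
  next
    assume R: "gs \<noteq> [] \<and> idp (fold (\<lambda>x y. y \<cdot> x) (tl gs) (hd gs)) = idp b \<and>
      b \<in> sgrp_gen T ((\<lambda>c. idp b \<cdot> c) ` set gs)"
    \<comment> \<open>The idempotent of \<open>b\<close> is a power of \<open>p\<close>, hence
      itself a product of generators, and multiplying by it stays inside.\<close>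
    have "idp b \<in> sgrp_gen T (set gs)" using R spow_in_gen[OF p(1), of k] by (simp flip: p_def)
    then have "(\<lambda>c. idp b \<cdot> c) ` set gs \<subseteq> sgrp_gen T (set gs)"
      by (auto intro: sgrp_gen.intros)
    then have "b \<in> sgrp_gen T (set gs)" using R sgrp_gen_subset by blast
    then show "b \<in> sgrp_gen T A" using gs sgrp_gen_mono[of "set gs" A] by auto
  qed
qed

end

text \<open>
  The elements of a finite Clifford semigroup have a common exponent, because the orders of its
  subgroups divide a factorial.
\<close>

lemma clifford_exp_exists:
  fixes S :: "'a sgrp"
  assumes fin: "finite (carrier S)" and cl: "clifford S"
  obtains k where "clifford_exp S (carrier S) k"
proof -
  let ?C = "carrier S"
  have sg: "sgrp S" using cl by (simp add: clifford_def completely_regular_def)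
  note closed = sgrp.mult_closed[OF sg] and assoc = sgrp.mult_assoc[OF sg]
  have ex: "\<exists>H e. subsemigroup H S \<and> x \<in> H \<and> group \<lparr>carrier = H, monoid.mult = sg_mult S, one = e\<rparr>"
    if "x \<in> ?C" for x
    using cl that unfolding clifford_def completely_regular_def by blast
  \<comment> \<open>The exponent k + 1 is a multiple of the order of every subgroup. The factor 2
    gives k at least 1 even for a one-element carrier, so that the inverse, the k-th power, is
    \<open>spow\<close> at k - 1.\<close>
  define k where "k = 2 * fact (card ?C) - (1 :: nat)"
  have k: "k \<ge> 1" "Suc k = 2 * fact (card ?C)"
    unfolding k_def using fact_ge_1[of "card ?C", where 'a = nat] by linarith+
  have key: "sg_mult S (spow S x k) (spow S x k) = spow S x k \<and> sg_mult S (spow S x k) x = x"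
    if x: "x \<in> ?C" for x
  proof -
    obtain H e where H: "subsemigroup H S" "x \<in> H"
      and g: "group \<lparr>carrier = H, monoid.mult = sg_mult S, one = e\<rparr>"
      using ex[OF x] by blast
    let ?G = "\<lparr>carrier = H, monoid.mult = sg_mult S, one = e\<rparr>"
    interpret G: group ?G by (rule g)
    have HC: "H \<subseteq> ?C" using H by (simp add: subsemigroup_def)
    then have finH: "finite H" using fin finite_subset by blast
    have pw: "spow S x j = x [^]\<^bsub>?G\<^esub> Suc j" for j
    proof (induction j)
      case 0
      then show ?case using G.l_one[of x] H by (simp add: nat_pow_def)
    next
      case (Suc j)
      then show ?case using G.nat_pow_Suc2[of x "Suc j"] H by (simp del: G.nat_pow_Suc)
    qed
    have "card H dvd fact (card ?C)"
      using card_mono[OF fin HC] H finH by (intro dvd_fact) (auto simp: Suc_le_eq card_gt_0_iff)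
    then obtain j where "Suc k = card H * j" using k by (metis dvd_def dvd_mult)
    moreover have "x [^]\<^bsub>?G\<^esub> card H = e" using G.pow_order_eq_1[of x] H by (simp add: order_def)
    ultimately have "x [^]\<^bsub>?G\<^esub> Suc k = e"
      using G.nat_pow_pow[of x "card H" j] H G.nat_pow_one[of j] by simp
    then have "spow S x k = e" by (simp only: pw)
    then show ?thesis using G.l_one[of x] G.l_one[of e] G.one_closed H by simp
  qed
  have sp: "spow S x j \<in> ?C" if "x \<in> ?C" for x j
    using that by (induction j) (auto intro: closed)
  have central: "sg_mult S (spow S x k) y = sg_mult S y (spow S x k)" if "x \<in> ?C" "y \<in> ?C" for x y
    using cl that key[of x] sp unfolding clifford_def by blast
  have comm: "sg_mult S (spow S x j) x = sg_mult S x (spow S x j)" if "x \<in> ?C" for x j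
    using that by (induction j) (auto simp: assoc sp)
  obtain j where j: "k = Suc j" using k(1) by (cases k) auto
  have right: "sg_mult S x (spow S x (k - Suc 0)) = spow S x k" for x
    unfolding j by simp
  \<comment> \<open>An element lies in the maximal subgroup of only one idempotent. If f fixes x and
    x p = f, then f acts as an identity on powers of x, and the idempotent of x acts as an identity
    on x p; both are idempotents that absorb each other. For a product x y, p is the product of the
    inverses in reverse order.\<close>
  have uniq: "spow S x k = f"
    if f: "f \<in> ?C" "sg_mult S f f = f" and x: "x \<in> ?C" "sg_mult S f x = x"
      and p: "p \<in> ?C" "sg_mult S x p = f" for x f p
  proof -
    have "sg_mult S f (spow S x k) = sg_mult S f (sg_mult S x (spow S x (k - Suc 0)))"
      by (simp only: right)
    also have "\<dots> = sg_mult S (sg_mult S f x) (spow S x (k - Suc 0))"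
      by (rule assoc[symmetric]) (use f x sp in auto)
    finally have "sg_mult S f (spow S x k) = sg_mult S (sg_mult S f x) (spow S x (k - Suc 0))" .
    then have 1: "sg_mult S f (spow S x k) = spow S x k" by (simp only: right x)
    have "sg_mult S (spow S x k) f = sg_mult S (sg_mult S (spow S x k) x) p"
      using p x sp by (simp add: assoc)
    then have "sg_mult S (spow S x k) f = f" using p key[OF x(1)] by simp
    then show ?thesis using 1 central[OF x(1) f(1)] by simp
  qed
  have "clifford_exp S ?C k"
  proof
    show "spow S (spow S x k) k = spow S x k" if "x \<in> ?C" for x
    proof -
      have "spow S (spow S x k) j = spow S x k" for j
        by (induction j) (use that key in auto)
      then show ?thesis .
    qed
    show "spow S (sg_mult S x y) k = sg_mult S (spow S x k) (spow S y k)"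
      if xy: "x \<in> ?C" "y \<in> ?C" for x y
    proof (rule uniq)
      let ?x = "spow S x k" and ?y = "spow S y k"
      let ?u = "spow S x (k - Suc 0)" and ?v = "spow S y (k - Suc 0)"
      note m = xy sp[of x] sp[of y] closed
      show "sg_mult S ?x ?y \<in> ?C" "sg_mult S x y \<in> ?C" "sg_mult S ?v ?u \<in> ?C" using m by auto
      have "sg_mult S (sg_mult S ?x ?y) (sg_mult S ?x ?y) = sg_mult S ?x (sg_mult S (sg_mult S ?y ?x) ?y)"
        using m by (simp add: assoc)
      also have "\<dots> = sg_mult S (sg_mult S ?x ?x) (sg_mult S ?y ?y)"
        using m central[of y ?x] by (simp add: assoc)
      finally show "sg_mult S (sg_mult S ?x ?y) (sg_mult S ?x ?y) = sg_mult S ?x ?y"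
        using xy key by simp
      have "sg_mult S (sg_mult S ?x ?y) (sg_mult S x y) = sg_mult S ?x (sg_mult S (sg_mult S ?y x) y)"
        using m by (simp add: assoc)
      also have "\<dots> = sg_mult S (sg_mult S ?x x) (sg_mult S ?y y)"
        using m central[of y x] by (simp add: assoc)
      finally show "sg_mult S (sg_mult S ?x ?y) (sg_mult S x y) = sg_mult S x y"
        using xy key by simp
      have "sg_mult S (sg_mult S x y) (sg_mult S ?v ?u) = sg_mult S x (sg_mult S (sg_mult S y ?v) ?u)"
        using m by (simp add: assoc)
      also have "\<dots> = sg_mult S (sg_mult S x ?u) ?y"
        using m central[of y ?u] by (simp add: assoc right[of y])
      finally show "sg_mult S (sg_mult S x y) (sg_mult S ?v ?u) = sg_mult S ?x ?y"
        by (simp add: right)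
    qed
  qed (use closed assoc k key central in auto)
  then show thesis by (rule that)
qed


section \<open>Tuples\<close>

lemma sg_mult_power [simp]: "sg_mult (sgrp_power S n) = map2 (sg_mult S)"
  by (simp add: sgrp_power_def)

lemma spow_power: "spow (sgrp_power S n) xs j = map (\<lambda>a. spow S a j) xs"
  by (induction j) (auto intro!: nth_equalityI)

definition tuples :: "nat \<Rightarrow> 'a set \<Rightarrow> 'a list set" where
  "tuples n A = {xs. length xs = n \<and> set xs \<subseteq> A}"

lemma tuples_iff: "xs \<in> tuples n A \<longleftrightarrow> length xs = n \<and> (\<forall>i<n. xs ! i \<in> A)"
  by (auto simp: tuples_def set_conv_nth)

text \<open>The exponent is common to all elements, so it works in all coordinates at once.\<close>

lemma clifford_exp_power:
  assumes "clifford_exp S I k"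
  shows "clifford_exp (sgrp_power S n) (tuples n I) k"
proof -
  interpret clifford_exp S I k by fact
  show ?thesis
    by unfold_locales
      (use k in \<open>auto simp: tuples_iff spow_power closed assoc idp_mult idp_hom in_set_conv_nth
         intro!: nth_equalityI idp_idp idp_central\<close>)
qed


section \<open>Sifting in subgroups of direct powers\<close>

text \<open>If the measure did not grow, no step changed anything, so every step was idle already on
  the initial value. This is applied to passes, rows and rounds of sifting.\<close>

lemma fold_progress:
  assumes step: "\<And>x a. x \<in> X \<Longrightarrow> Inv a \<Longrightarrow> Inv (f x a) \<and> (f x a = a \<or> \<mu> a < (\<mu> (f x a) :: nat))"
    and "set xs \<subseteq> X" "Inv a"
  shows "Inv (fold f xs a) \<and>
    ((fold f xs a = a \<and> (\<forall>x \<in> set xs. f x a = a)) \<or> \<mu> a < \<mu> (fold f xs a))"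
  using assms(2,3)
proof (induction xs arbitrary: a)
  case (Cons x xs)
  have s: "Inv (f x a)" "f x a = a \<or> \<mu> a < \<mu> (f x a)" using step Cons.prems by auto
  have IH: "Inv (fold f xs (f x a)) \<and>
      ((fold f xs (f x a) = f x a \<and> (\<forall>y \<in> set xs. f y (f x a) = f x a)) \<or>
       \<mu> (f x a) < \<mu> (fold f xs (f x a)))"
    using Cons.IH[OF _ s(1)] Cons.prems by simp
  show ?case using s IH by (auto dest: less_trans)
qed simp

context clifford_exp
begin

text \<open>
  Within a subgroup of a power whose identity is a tuple of idempotents, \<open>ld x\<close> is the first
  coordinate where \<open>x\<close> differs from the identity. Sifting \<open>x\<close> divides it by members of a list
  that agree with it at this coordinate.
\<close>

definition ld :: "'x list \<Rightarrow> nat" where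
  "ld x = length (takeWhile (\<lambda>a. idp a = a) x)"

definition match :: "'x list \<Rightarrow> 'x list \<Rightarrow> bool" where
  "match t x \<longleftrightarrow> ld t = ld x \<and> ld x < length x \<and> t ! ld x = x ! ld x"

definition red :: "'x list \<Rightarrow> 'x list \<Rightarrow> 'x list" where
  "red t x = (if match t x then map2 (\<lambda>a c. iv a \<cdot> c) t x else x)"

definition pass :: "'x list list \<Rightarrow> 'x list \<Rightarrow> 'x list" where
  "pass L x = fold red L x"

text \<open>A pass that changes a nontrivial element moves its lead to the right, and there are
  \<open>n\<close> coordinates; after \<open>n\<close> passes nothing in the list matches.\<close>

definition sift :: "nat \<Rightarrow> 'x list list \<Rightarrow> 'x list \<Rightarrow> 'x list" where
  "sift n L x = (pass L ^^ n) x"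

definition sift_add :: "nat \<Rightarrow> 'x list \<Rightarrow> 'x list list \<Rightarrow> 'x list list" where
  "sift_add n x L = (let y = sift n L x in if list_all (\<lambda>a. idp a = a) y then L else y # L)"

text \<open>Here and in \<open>sift_round\<close>, the loop runs over the list as it was when the
  loop started, while the accumulator grows.\<close>

definition sift_row :: "nat \<Rightarrow> 'x list \<Rightarrow> 'x list list \<Rightarrow> 'x list list" where
  "sift_row n s L = fold (\<lambda>t. sift_add n (map2 (\<cdot>) t s)) L L"

definition sift_round :: "nat \<Rightarrow> 'x list list \<Rightarrow> 'x list list" where
  "sift_round n L = fold (sift_row n) L L"

end

locale power_group = clifford_exp S I k
  for S :: "'a sgrp" (structure) and I :: "'a set" and k :: nat +
  fixes n :: nat and e :: "'a list"
  assumes fin: "finite I" and e_len: "length e = n" and e_in: "set e \<subseteq> I"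
    and e_idp: "\<And>i. i < n \<Longrightarrow> idp (e ! i) = e ! i"
begin

abbreviation mul :: "'a list \<Rightarrow> 'a list \<Rightarrow> 'a list" (infixl "\<odot>" 70) where
  "x \<odot> y \<equiv> map2 (sg_mult S) x y"

abbreviation gen :: "'a list set \<Rightarrow> 'a list set" where
  "gen \<equiv> sgrp_gen (sgrp_power S n)"

text \<open>The direct product of the maximal subgroups of \<open>I\<close> whose identities are the
  entries of \<open>e\<close>.\<close>

definition H :: "'a list set" where
  "H = {x. length x = n \<and> (\<forall>i<n. x ! i \<in> I \<and> idp (x ! i) = e ! i)}"

lemma HI:
  "length x = n \<Longrightarrow> (\<And>i. i < n \<Longrightarrow> x ! i \<in> I) \<Longrightarrow> (\<And>i. i < n \<Longrightarrow> idp (x ! i) = e ! i) \<Longrightarrow> x \<in> H"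
  by (simp add: H_def)

lemma H_len [simp]: "x \<in> H \<Longrightarrow> length x = n"
  and H_in [simp]: "x \<in> H \<Longrightarrow> i < n \<Longrightarrow> x ! i \<in> I"
  and H_idp [simp]: "x \<in> H \<Longrightarrow> i < n \<Longrightarrow> idp (x ! i) = e ! i"
  by (auto simp: H_def)

lemma e_nth_in [simp]: "i < n \<Longrightarrow> e ! i \<in> I"
  using e_in e_len by (auto simp: subset_iff)

lemma H_e [simp]: "e \<in> H"
  by (rule HI) (simp_all add: e_len e_idp)

lemma e_mult_nth [simp]: "x \<in> H \<Longrightarrow> i < n \<Longrightarrow> e ! i \<cdot> x ! i = x ! i"
  and mult_e_nth [simp]: "x \<in> H \<Longrightarrow> i < n \<Longrightarrow> x ! i \<cdot> e ! i = x ! i"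
  using idp_mult[of "x ! i"] idp_mult_right[of "x ! i"] by simp_all

lemma H_mul [simp]: "x \<in> H \<Longrightarrow> y \<in> H \<Longrightarrow> x \<odot> y \<in> H"
  by (rule HI) (simp_all add: closed idp_hom e_mult_nth[OF H_e])

lemma H_eqI: "x \<in> H \<Longrightarrow> y \<in> H \<Longrightarrow> (\<And>i. i < n \<Longrightarrow> x ! i = y ! i) \<Longrightarrow> x = y"
  by (rule nth_equalityI) auto

lemma e_mul [simp]: "x \<in> H \<Longrightarrow> e \<odot> x = x"
  and mul_e [simp]: "x \<in> H \<Longrightarrow> x \<odot> e = x"
  by (rule H_eqI; simp)+

lemma mul_assoc: "x \<in> H \<Longrightarrow> y \<in> H \<Longrightarrow> z \<in> H \<Longrightarrow> (x \<odot> y) \<odot> z = x \<odot> (y \<odot> z)"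
  by (rule H_eqI) (simp_all add: assoc)

lemma H_iv: "x \<in> H \<Longrightarrow> map iv x \<in> H"
  by (rule HI) (simp_all add: idp_spow)

lemma mul_iv: "x \<in> H \<Longrightarrow> x \<odot> map iv x = e"
  by (rule H_eqI) (simp_all add: H_iv iv_right)

lemma triv_iff: "x \<in> H \<Longrightarrow> i < n \<Longrightarrow> idp (x ! i) = x ! i \<longleftrightarrow> x ! i = e ! i"
  by auto

section \<open>Leading coordinates and division\<close>

lemma ld_le: "x \<in> H \<Longrightarrow> ld x \<le> n"
  using length_takeWhile_le[of _ x] by (simp add: ld_def)

lemma ld_before: "x \<in> H \<Longrightarrow> i < ld x \<Longrightarrow> x ! i = e ! i"
  using ld_le[of x] nth_length_takeWhile set_takeWhileD[of "x ! i" "\<lambda>a. idp a = a" x]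
    takeWhile_nth[of i "\<lambda>a. idp a = a" x] nth_mem[of i "takeWhile (\<lambda>a. idp a = a) x"]
    triv_iff[of x i]
  by (auto simp: ld_def)

lemma ld_at: "x \<in> H \<Longrightarrow> ld x < n \<Longrightarrow> x ! ld x \<noteq> e ! ld x"
  using nth_length_takeWhile[of "\<lambda>a. idp a = a" x] triv_iff[of x "ld x"] by (auto simp: ld_def)

lemma ld_geI: "x \<in> H \<Longrightarrow> j \<le> n \<Longrightarrow> (\<And>i. i < j \<Longrightarrow> x ! i = e ! i) \<Longrightarrow> j \<le> ld x"
  using ld_at[of x] by (meson leI le_trans linorder_not_less)

lemma ld_eqI:
  assumes "x \<in> H" "j < n" "\<And>i. i < j \<Longrightarrow> x ! i = e ! i" "x ! j \<noteq> e ! j"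
  shows "ld x = j"
proof -
  have "j \<le> ld x" using assms by (intro ld_geI) auto
  moreover have "\<not> j < ld x" using ld_before[of x j] assms by auto
  ultimately show ?thesis by simp
qed

lemma ld_eq_n: "x \<in> H \<Longrightarrow> ld x = n \<longleftrightarrow> x = e"
proof
  show "x = e" if "x \<in> H" "ld x = n"
    using that ld_before[of x] by (intro H_eqI) auto
  show "ld x = n" if "x \<in> H" "x = e"
    using that ld_geI[of x n] ld_le[of x] by auto
qed

lemma list_all_triv: "x \<in> H \<Longrightarrow> list_all (\<lambda>a. idp a = a) x \<longleftrightarrow> x = e"
  using H_eqI[of x e] triv_iff[of x] triv_iff[of e] by (auto simp: list_all_length)

lemma red_match: "match t x \<Longrightarrow> t \<in> H \<Longrightarrow> x \<in> H \<Longrightarrow> red t x = map iv t \<odot> x"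
  by (simp add: red_def zip_map1 case_prod_beta' comp_def)

lemma red_H: "t \<in> H \<Longrightarrow> x \<in> H \<Longrightarrow> red t x \<in> H"
  using red_match[of t x] H_iv[of t] H_mul[of "map iv t" x] by (cases "match t x") (auto simp: red_def)

text \<open>Up to and including the common lead, \<open>t\<close> and \<open>x\<close> coincide, so
  their quotient is trivial there.\<close>

lemma red_ld:
  assumes "match t x" "t \<in> H" "x \<in> H"
  shows "ld x < ld (red t x)"
proof -
  have m: "ld t = ld x" "ld x < n" "t ! ld x = x ! ld x" using assms by (auto simp: match_def)
  have "red t x ! i = e ! i" if "i < Suc (ld x)" for i
  proof -
    have "t ! i = x ! i" using that m assms ld_before[of t i] ld_before[of x i]
      by (cases "i = ld x") auto
    then show ?thesis
      using that m assms H_iv[of t] iv_left[of "x ! i"] by (simp add: red_match)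
  qed
  then have "Suc (ld x) \<le> ld (red t x)" using m assms red_H by (intro ld_geI) auto
  then show ?thesis by simp
qed

lemma pass_progress:
  assumes "set L \<subseteq> H" "x \<in> H"
  shows "pass L x \<in> H \<and>
    ((pass L x = x \<and> (\<forall>t \<in> set L. \<not> match t x)) \<or> ld x < ld (pass L x))"
proof -
  have "pass L x \<in> H \<and> ((pass L x = x \<and> (\<forall>t \<in> set L. red t x = x)) \<or> ld x < ld (pass L x))"
    unfolding pass_def
    by (rule fold_progress[where X = H]) (use assms red_H red_ld in \<open>auto simp: red_def\<close>)
  then show ?thesis using red_ld assms by (metis less_irrefl subsetD)
qed

lemma pass_iter:
  assumes "set L \<subseteq> H" "x \<in> H"
  shows "(pass L ^^ m) x \<in> H \<and> ((\<forall>t \<in> set L. \<not> match t ((pass L ^^ m) x)) \<or> m \<le> ld ((pass L ^^ m) x))"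
proof (induction m)
  case (Suc m)
  let ?y = "(pass L ^^ m) x"
  have "pass L ?y \<in> H \<and> ((pass L ?y = ?y \<and> (\<forall>t \<in> set L. \<not> match t ?y)) \<or> ld ?y < ld (pass L ?y))"
    using pass_progress assms Suc by blast
  moreover have "pass L ?y = ?y" if "\<forall>t \<in> set L. \<not> match t ?y"
  proof -
    have "fold red L' ?y = ?y" if "set L' \<subseteq> set L" for L'
      using that \<open>\<forall>t \<in> set L. \<not> match t ?y\<close> by (induction L') (auto simp: red_def)
    then show ?thesis by (simp add: pass_def)
  qed
  ultimately show ?case using Suc by auto
qed (use assms in simp)

lemma sift_H: "set L \<subseteq> H \<Longrightarrow> x \<in> H \<Longrightarrow> sift n L x \<in> H"
  using pass_iter[of L x n] by (simp add: sift_def)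

lemma sift_irreducible:
  assumes "set L \<subseteq> H" "x \<in> H" "t \<in> set L"
  shows "\<not> match t (sift n L x)"
  using pass_iter[OF assms(1,2), of n] assms(3) by (auto simp: sift_def match_def)

lemma gen_H: "A \<subseteq> H \<Longrightarrow> gen A \<subseteq> H"
  by (rule sgrp_gen_least) auto

lemma gen_mul: "x \<in> gen A \<Longrightarrow> y \<in> gen A \<Longrightarrow> x \<odot> y \<in> gen A"
  using sgrp_gen.mult[of x "sgrp_power S n" A y] by simp

lemma gen_iv: "x \<in> gen A \<Longrightarrow> map iv x \<in> gen A"
  using spow_in_gen[of x "sgrp_power S n" A "k - Suc 0"] by (simp add: spow_power)

text \<open>Sifting only multiplies by inverses of members, and these are powers of members.\<close>

lemma sift_gen:
  assumes "set L \<subseteq> gen A" "A \<subseteq> H" "x \<in> gen A"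
  shows "sift n L x \<in> gen A"
proof -
  have red: "red t x \<in> gen A" if "t \<in> gen A" "x \<in> gen A" for t x
  proof (cases "match t x")
    case True
    have "red t x = map iv t \<odot> x" using that gen_H[OF assms(2)] by (intro red_match[OF True]) auto
    then show ?thesis using that gen_mul[OF gen_iv] by simp
  qed (use that in \<open>simp add: red_def\<close>)
  have "fold red L' x \<in> gen A" if "set L' \<subseteq> gen A" "x \<in> gen A" for L' x
    using that by (induction L' arbitrary: x) (auto intro: red)
  then have "pass L x \<in> gen A" if "x \<in> gen A" for x
    using that assms by (simp add: pass_def)
  then have "(pass L ^^ m) x \<in> gen A" for m
    using assms by (induction m) auto
  then show ?thesis by (simp add: sift_def)
qed

text \<open>Normal forms: products of members of \<open>L\<close> with strictly increasing leads,
  all at least \<open>i\<close>, as in the factorisation along a strong generating set. Later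
  factors are trivial at the lead of the first one and do not disturb it.\<close>

inductive dec :: "'a list set \<Rightarrow> nat \<Rightarrow> 'a list \<Rightarrow> bool" for L where
  dec_e: "dec L i e"
| dec_mul: "t \<in> L \<Longrightarrow> i \<le> ld t \<Longrightarrow> ld t < n \<Longrightarrow> dec L (Suc (ld t)) y \<Longrightarrow> dec L i (t \<odot> y)"

lemma dec_mono: "dec L j x \<Longrightarrow> i \<le> j \<Longrightarrow> dec L i x"
  by (induction arbitrary: i rule: dec.induct) (auto intro: dec.intros)

lemma dec_H: "dec L i x \<Longrightarrow> L \<subseteq> H \<Longrightarrow> x \<in> H"
  by (induction rule: dec.induct) auto

text \<open>Semigroup products are nonempty, so the empty normal form counts as generated only
  because \<open>e\<close> is in \<open>L\<close>.\<close>

lemma dec_gen: "dec L i x \<Longrightarrow> e \<in> L \<Longrightarrow> x \<in> gen L"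
  by (induction rule: dec.induct) (auto intro: sgrp_gen.incl gen_mul)

lemma dec_single: "t \<in> L \<Longrightarrow> L \<subseteq> H \<Longrightarrow> i \<le> ld t \<Longrightarrow> dec L i t"
  using dec_mul[of t L i e] ld_eq_n[of t] ld_le[of t] dec_e[of L i] dec_e[of L "Suc (ld t)"]
  by (cases "ld t = n") auto

lemma dec_before:
  assumes "dec L i x" "L \<subseteq> H" "j < i" "j < n"
  shows "x ! j = e ! j"
  using assms
proof (induction arbitrary: j rule: dec.induct)
  case (dec_mul t i y)
  then have "y ! j = e ! j" "t ! j = e ! j" "y \<in> H" "t \<in> H"
    using ld_before[of t j] dec_H by auto
  then show ?case using dec_mul.prems by simp
qed simp

text \<open>All factors but the first are trivial up to the lead of the first one, which therefore
  determines the lead of the product and the entry there. So a nontrivial normal form can always be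
  reduced.\<close>

lemma dec_lead:
  assumes "dec L i x" "L \<subseteq> H" "x \<noteq> e"
  shows "\<exists>t \<in> L. match t x"
  using assms(1)
proof cases
  case (dec_mul t y)
  have H: "t \<in> H" "y \<in> H" using dec_mul assms(2) dec_H by auto
  have "y ! j = e ! j" if "j \<le> ld t" for j
    using dec_before[OF dec_mul(5) assms(2), of j] that dec_mul(4) by simp
  then have eq: "x ! j = t ! j" if "j \<le> ld t" for j
    using that H dec_mul by simp
  have xH: "x \<in> H" using H dec_mul(1) by simp
  have "ld x = ld t"
  proof (rule ld_eqI[OF xH dec_mul(4)])
    show "x ! i = e ! i" if "i < ld t" for i using eq[of i] ld_before[OF H(1) that] that by simp
    show "x ! ld t \<noteq> e ! ld t" using eq[of "ld t"] ld_at[OF H(1) dec_mul(4)] by simp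
  qed
  then have "match t x" using eq[of "ld t"] dec_mul(4) xH by (simp add: match_def)
  then show ?thesis using dec_mul(2) by blast
qed (use assms in simp)

lemma dec_split:
  assumes "dec L i x"
  obtains "dec L (Suc i) x"
  | t y where "t \<in> L" "ld t = i" "dec L (Suc i) y" "x = t \<odot> y"
  using assms
proof cases
  case (dec_mul t y)
  show thesis
  proof (cases "ld t = i")
    case False
    then have "dec L (Suc i) x" unfolding dec_mul(1) using dec_mul by (intro dec.intros) auto
    then show ?thesis by (rule that(1))
  qed (use that(2) dec_mul in blast)
next
  case dec_e
  have "dec L (Suc i) x" unfolding dec_e by (rule dec.dec_e)
  then show thesis by (rule that(1))
qed

text \<open>A pass read backwards: where it divides by \<open>t\<close>, the element before is
  \<open>t\<close> times a normal form with larger leads.\<close>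

lemma dec_of_pass:
  assumes "set L' \<subseteq> L" "L \<subseteq> H" "x \<in> H" "dec L (ld (pass L' x)) (pass L' x)"
  shows "dec L (ld x) x"
  using assms
proof (induction L' arbitrary: x)
  case (Cons t L')
  have t: "t \<in> L" "t \<in> H" using Cons.prems by auto
  have d: "dec L (ld (red t x)) (red t x)"
    using Cons.IH[of "red t x"] Cons.prems t red_H by (simp add: pass_def)
  show ?case
  proof (cases "match t x")
    case True
    have ld: "ld t = ld x" "ld x < n" using True Cons.prems by (auto simp: match_def)
    have "x = t \<odot> red t x"
      using red_match[OF True t(2)] Cons.prems t H_iv[of t] mul_iv[of t]
      by (simp flip: mul_assoc)
    moreover have "dec L (Suc (ld t)) (red t x)"
      using dec_mono[OF d] red_ld[OF True t(2)] Cons.prems ld by simp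
    ultimately show ?thesis using dec_mul[of t L "ld x" "red t x"] t ld by simp
  qed (use d in \<open>simp add: red_def\<close>)
qed (simp add: pass_def)

lemma dec_of_sift:
  assumes "set L \<subseteq> H" "x \<in> H" "sift n L x = e"
  shows "dec (set L) 0 x"
proof -
  have "dec (set L) (ld x) x" if "(pass L ^^ m) x = e" "x \<in> H" for m x
    using that
  proof (induction m arbitrary: x)
    case (Suc m)
    have "pass L x \<in> H" using pass_progress assms Suc.prems by blast
    then have "dec (set L) (ld (pass L x)) (pass L x)"
      using Suc by (simp add: funpow_swap1)
    then show ?case using dec_of_pass assms Suc.prems by blast
  qed (auto intro: dec_e)
  from this[OF assms(3)[unfolded sift_def] assms(2)] show ?thesis by (rule dec_mono) simp
qed

section \<open>Lists in which all products of two members have normal forms\<close>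

context
  fixes L :: "'a list set"
  assumes L: "L \<subseteq> H" and pairs: "\<And>s t. s \<in> L \<Longrightarrow> t \<in> L \<Longrightarrow> dec L 0 (s \<odot> t)"
begin

text \<open>The product is trivial before coordinate \<open>i\<close> because both factors are. The
  first factor of its normal form is visible in the product at its own lead, so this lead cannot
  come before \<open>i\<close>.\<close>

lemma dec_pair:
  assumes "s \<in> L" "t \<in> L" "i \<le> ld s" "i \<le> ld t"
  shows "dec L i (s \<odot> t)"
  using pairs[OF assms(1,2)]
proof cases
  case (dec_mul u y)
  have H: "s \<in> H" "t \<in> H" "u \<in> H" using assms L dec_mul by auto
  have st: "s \<odot> t \<noteq> e"
  proof
    assume st: "s \<odot> t = e"
    have "e ! ld u = (u \<odot> y) ! ld u" using st dec_mul(1) by simp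
    also have "\<dots> = u ! ld u"
      using H dec_mul dec_before[OF dec_mul(5) L, of "ld u"] dec_H[OF dec_mul(5) L] by simp
    finally show False using ld_at[OF H(3)] dec_mul by simp
  qed
  have "i \<le> ld (s \<odot> t)"
    using H assms ld_le[of s] ld_before[of s] ld_before[of t] by (intro ld_geI) auto
  moreover have "ld u \<ge> i"
  proof (rule ccontr)
    assume "\<not> i \<le> ld u"
    then have "(s \<odot> t) ! ld u = e ! ld u" using \<open>i \<le> ld (s \<odot> t)\<close> H ld_before[of "s \<odot> t"] by auto
    moreover have "(s \<odot> t) ! ld u = u ! ld u"
      using H dec_mul dec_before[OF dec_mul(5) L, of "ld u"] dec_H[OF dec_mul(5) L] by simp
    ultimately show False using ld_at[OF H(3)] dec_mul by simp
  qed
  ultimately show ?thesis using dec_mul by (auto intro: dec.dec_mul)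
next
  case dec_e
  show ?thesis unfolding dec_e by (rule dec.dec_e)
qed

text \<open>
  By the hypothesis on pairs, a factor with lead \<open>i\<close> moves to the front past normal forms whose
  leads are larger.
\<close>

lemma dec_closed_step:
  assumes IH: "\<And>x y. dec L (Suc i) x \<Longrightarrow> dec L (Suc i) y \<Longrightarrow> dec L (Suc i) (x \<odot> y)"
    and x: "dec L i x" and y: "dec L i y" and i: "i < n"
  shows "dec L i (x \<odot> y)"
proof -
  note dH = dec_H[OF _ L]
  have LH: "t \<in> H" if "t \<in> L" for t using that L by auto
  have up: "dec L i (x \<odot> y)" if x: "dec L i x" and y: "dec L (Suc i) y" for x y
  proof (rule dec_split[OF x])
    assume "dec L (Suc i) x"
    then show ?thesis using IH[OF _ y] dec_mono by (meson le_SucI order_refl)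
  next
    fix t z assume tz: "t \<in> L" "ld t = i" "dec L (Suc i) z" "x = t \<odot> z"
    have "dec L i (t \<odot> (z \<odot> y))" using dec_mul[of t L i] tz IH[OF tz(3) y] i by simp
    then show ?thesis using tz y dH LH by (simp add: mul_assoc)
  qed
  have shift: "dec L i (y \<odot> t)" if "dec L j y" "Suc i \<le> j" "t \<in> L" "i \<le> ld t" for j y t
    using that
  proof (induction arbitrary: t rule: dec.induct)
    case (dec_e j)
    then show ?case using dec_single[OF _ L] LH by simp
  next
    case (dec_mul u j y)
    have H: "u \<in> H" "y \<in> H" "t \<in> H" using dec_mul L dH by auto
    have u: "dec L (Suc i) u" using dec_single[OF _ L, of u "Suc i"] dec_mul by simp
    have "dec L i (y \<odot> t)" using dec_mul by simp
    then have "dec L i (u \<odot> (y \<odot> t))"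
    proof (rule dec_split)
      assume "dec L (Suc i) (y \<odot> t)"
      then show ?thesis using IH[OF u] dec_mono by (meson le_SucI order_refl)
    next
      fix v z assume v: "v \<in> L" "ld v = i" "dec L (Suc i) z" "y \<odot> t = v \<odot> z"
      \<comment> \<open>Moving \<open>t\<close> to the front of the tail \<open>y\<close> may expose
        a factor \<open>v\<close> with lead \<open>i\<close>. It meets \<open>u\<close>, and the
        product of these two members has a normal form by hypothesis.\<close>
      have "dec L i (u \<odot> v)" using dec_pair[of u v i] dec_mul v by simp
      then have "dec L i ((u \<odot> v) \<odot> z)" using up v by blast
      then show ?thesis using v H LH dH by (simp add: mul_assoc)
    qed
    then show ?case using H by (simp add: mul_assoc)
  qed
  have up': "dec L i (z \<odot> y)" if z: "dec L (Suc i) z" for z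
  proof (rule dec_split[OF y])
    assume "dec L (Suc i) y"
    then show ?thesis using IH[OF z] dec_mono by (meson le_SucI order_refl)
  next
    fix t w assume t: "t \<in> L" "ld t = i" "dec L (Suc i) w" "y = t \<odot> w"
    have "dec L i ((z \<odot> t) \<odot> w)" using up[OF shift[OF z order_refl t(1)] t(3)] t by simp
    then show ?thesis using t z LH dH by (simp add: mul_assoc)
  qed
  from x show ?thesis
  proof (rule dec_split)
    assume "dec L (Suc i) x"
    then show ?thesis by (rule up')
  next
    fix t z assume t: "t \<in> L" "ld t = i" "dec L (Suc i) z" "x = t \<odot> z"
    have zy: "dec L i (z \<odot> y)" using up' t by blast
    from zy have "dec L i (t \<odot> (z \<odot> y))"
    proof (rule dec_split)
      assume "dec L (Suc i) (z \<odot> y)"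
      then show ?thesis using dec_mul[of t L i] t i by simp
    next
      fix v w assume v: "v \<in> L" "ld v = i" "dec L (Suc i) w" "z \<odot> y = v \<odot> w"
      \<comment> \<open>Now the two factors with lead \<open>i\<close> are adjacent, and everything
        to their right is a normal form with larger leads.\<close>
      have "dec L i (t \<odot> v)" using dec_pair[of t v i] t v by simp
      then have "dec L i ((t \<odot> v) \<odot> w)" using up v by blast
      then show ?thesis using t v LH dH by (simp add: mul_assoc)
    qed
    then show ?thesis using t y LH dH by (simp add: mul_assoc)
  qed
qed

lemma dec_closed: "dec L 0 x \<Longrightarrow> dec L 0 y \<Longrightarrow> dec L 0 (x \<odot> y)"
proof -
  \<comment> \<open>Downward induction on the first admissible lead n - m; at n only the identity is
    left.\<close>
  have "dec L (n - m) x \<Longrightarrow> dec L (n - m) y \<Longrightarrow> dec L (n - m) (x \<odot> y)" if "m \<le> n" for m x y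
    using that
  proof (induction m arbitrary: x y)
    case 0
    have "z = e" if "dec L n z" for z using that by cases auto
    then show ?case using 0 by (metis H_e diff_zero mul_e)
  next
    case (Suc m)
    have eq: "Suc (n - Suc m) = n - m" using Suc.prems by simp
    show ?case
    proof (rule dec_closed_step)
      show "dec L (Suc (n - Suc m)) (x \<odot> y)"
        if "dec L (Suc (n - Suc m)) x" "dec L (Suc (n - Suc m)) y" for x y
        using Suc.IH[of x y] that Suc.prems(3) eq by simp
    qed (use Suc.prems in simp_all)
  qed
  from this[of n] show "dec L 0 x \<Longrightarrow> dec L 0 y \<Longrightarrow> dec L 0 (x \<odot> y)" by simp
qed

lemma gen_dec: "x \<in> gen L \<Longrightarrow> dec L 0 x"
  by (induction rule: sgrp_gen.induct) (auto intro: dec_single[OF _ L] dec_closed)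

end

text \<open>If the products of pairs sift to the identity, they have normal forms, and then so has
  every generated element. What remains of a generated element after sifting is again generated, but
  irreducible, and an irreducible normal form is the identity.\<close>

theorem sift_eq_iff:
  assumes L: "set L \<subseteq> H" "e \<in> set L" and x: "x \<in> H"
    and pairs: "\<And>s t. s \<in> set L \<Longrightarrow> t \<in> set L \<Longrightarrow> sift n L (s \<odot> t) = e"
  shows "sift n L x = e \<longleftrightarrow> x \<in> gen (set L)"
proof
  assume "sift n L x = e"
  then show "x \<in> gen (set L)" using dec_gen[OF dec_of_sift] L x by blast
next
  assume g: "x \<in> gen (set L)"
  have p: "dec (set L) 0 (s \<odot> t)" if "s \<in> set L" "t \<in> set L" for s t
    using that L pairs by (intro dec_of_sift) (auto intro!: H_mul)
  have "sift n L x \<in> gen (set L)"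
    using L g by (intro sift_gen) (auto intro: sgrp_gen.incl)
  then have "dec (set L) 0 (sift n L x)" using gen_dec[OF L(1) p] by blast
  then show "sift n L x = e"
    using dec_lead[OF _ L(1)] sift_irreducible[OF L(1) x] by blast
qed

text \<open>A nontrivial result of sifting matches no member of the list, so its lead and the entry
  there form a new pair. The number of pairs measures progress, and n |I| bounds how many members
  can be added.\<close>

definition leads :: "'a list list \<Rightarrow> (nat \<times> 'a) set" where
  "leads L = {(ld t, t ! ld t) | t. t \<in> set L \<and> ld t < n}"

lemma finite_card_leads:
  assumes "set L \<subseteq> H"
  shows "finite (leads L)" "card (leads L) \<le> n * card I"
proof -
  have "leads L \<subseteq> {..<n} \<times> I" using assms by (auto simp: leads_def)
  then show "finite (leads L)" "card (leads L) \<le> n * card I"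
    using fin finite_subset[of "leads L" "{..<n} \<times> I"] card_mono[of "{..<n} \<times> I" "leads L"]
    by (auto simp: card_cartesian_product)
qed

definition sift_inv :: "'a list list \<Rightarrow> 'a list list \<Rightarrow> bool" where
  "sift_inv L0 L \<longleftrightarrow> set L0 \<subseteq> set L \<and> set L \<subseteq> gen (set L0) \<and>
     length L \<le> length L0 + card (leads L)"

section \<open>Termination and correctness of the rounds of sifting\<close>

context
  fixes L0 :: "'a list list"
  assumes L0: "set L0 \<subseteq> H" "e \<in> set L0"
begin

lemma sift_inv_H: "sift_inv L0 L \<Longrightarrow> set L \<subseteq> H"
  using gen_H[OF L0(1)] by (auto simp: sift_inv_def)

lemma sift_add_progress:
  assumes x: "x \<in> gen (set L0)" and L: "sift_inv L0 L"
  shows "sift_inv L0 (sift_add n x L) \<and>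
    ((sift_add n x L = L \<and> sift n L x = e) \<or> card (leads L) < card (leads (sift_add n x L)))"
proof -
  define y where "y = sift n L x"
  have LH: "set L \<subseteq> H" using sift_inv_H[OF L] .
  have xH: "x \<in> H" using x gen_H[OF L0(1)] by auto
  have yH: "y \<in> H" using sift_H[OF LH xH] by (simp add: y_def)
  have eq: "sift_add n x L = (if y = e then L else y # L)"
    using list_all_triv[OF yH] by (simp add: sift_add_def y_def Let_def)
  show ?thesis
  proof (cases "y = e")
    case False
    have yg: "y \<in> gen (set L0)" unfolding y_def
      using L x L0 by (intro sift_gen) (auto simp: sift_inv_def)
    have ldy: "ld y < n" using False ld_eq_n[OF yH] ld_le[OF yH] by linarith
    have new: "(ld y, y ! ld y) \<notin> leads L"
    proof
      assume "(ld y, y ! ld y) \<in> leads L"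
      then obtain t where "t \<in> set L" "ld y = ld t" "y ! ld y = t ! ld t"
        by (auto simp: leads_def)
      then show False
        using sift_irreducible[OF LH xH, of t] ldy yH by (simp add: match_def flip: y_def)
    qed
    have "leads (y # L) = insert (ld y, y ! ld y) (leads L)"
      using ldy by (auto simp: leads_def)
    then have "card (leads (y # L)) = Suc (card (leads L))"
      using new finite_card_leads[OF LH] by simp
    then show ?thesis using False L yg by (auto simp: eq sift_inv_def)
  qed (use L in \<open>simp add: eq y_def\<close>)
qed

lemma sift_row_progress:
  assumes s: "s \<in> gen (set L0)" and L: "sift_inv L0 L"
  shows "sift_inv L0 (sift_row n s L) \<and>
    ((sift_row n s L = L \<and> (\<forall>t \<in> set L. sift n L (t \<odot> s) = e)) \<or>
     card (leads L) < card (leads (sift_row n s L)))"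
proof -
  have g: "t \<odot> s \<in> gen (set L0)" if "t \<in> gen (set L0)" for t using that s gen_mul by blast
  have "sift_inv L0 (sift_row n s L) \<and>
    ((sift_row n s L = L \<and> (\<forall>t \<in> set L. sift_add n (t \<odot> s) L = L)) \<or>
     card (leads L) < card (leads (sift_row n s L)))"
    unfolding sift_row_def
  proof (rule fold_progress[where X = "gen (set L0)"])
    show "set L \<subseteq> gen (set L0)" using L by (simp add: sift_inv_def)
  qed (use L sift_add_progress[OF g] in blast)+
  moreover have "sift n L (t \<odot> s) = e" if "t \<in> set L" "sift_add n (t \<odot> s) L = L" for t
    using sift_add_progress[OF g L, of t] that L by (auto simp: sift_inv_def)
  ultimately show ?thesis by auto
qed

lemma sift_round_progress:
  assumes L: "sift_inv L0 L"
  shows "sift_inv L0 (sift_round n L) \<and>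
    ((sift_round n L = L \<and> (\<forall>s \<in> set L. \<forall>t \<in> set L. sift n L (t \<odot> s) = e)) \<or>
     card (leads L) < card (leads (sift_round n L)))"
proof -
  have "sift_inv L0 (sift_round n L) \<and>
    ((sift_round n L = L \<and> (\<forall>s \<in> set L. sift_row n s L = L)) \<or>
     card (leads L) < card (leads (sift_round n L)))"
    unfolding sift_round_def
  proof (rule fold_progress[where X = "gen (set L0)"])
    show "set L \<subseteq> gen (set L0)" using L by (simp add: sift_inv_def)
  qed (use L sift_row_progress in blast)+
  moreover have "\<forall>t \<in> set L. sift n L (t \<odot> s) = e" if "s \<in> set L" "sift_row n s L = L" for s
    using sift_row_progress[OF _ L, of s] that L by (auto simp: sift_inv_def)
  ultimately show ?thesis by blast
qed

lemma sift_inv_init: "sift_inv L0 L0"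
  by (auto simp: sift_inv_def intro: sgrp_gen.incl)

lemma sift_rounds_inv: "sift_inv L0 ((sift_round n ^^ m) L0)"
  by (induction m) (use sift_inv_init sift_round_progress in auto)

lemma sift_inv_length:
  assumes "sift_inv L0 L"
  shows "length L \<le> length L0 + n * card I"
  using assms finite_card_leads(2)[OF sift_inv_H[OF assms]] by (simp add: sift_inv_def)

text \<open>A list whose pairs all sift to the identity is left unchanged by a round; any other list
  gains a pair in \<open>leads\<close>.\<close>

lemma sift_rounds_iter:
  fixes m
  defines "L \<equiv> (sift_round n ^^ m) L0"
  shows "(\<forall>s \<in> set L. \<forall>t \<in> set L. sift n L (t \<odot> s) = e) \<or> m \<le> card (leads L)"
  unfolding L_def
proof (induction m)
  case (Suc m)
  let ?L = "(sift_round n ^^ m) L0"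
  have p: "(sift_round n ?L = ?L \<and> (\<forall>s \<in> set ?L. \<forall>t \<in> set ?L. sift n ?L (t \<odot> s) = e)) \<or>
      card (leads ?L) < card (leads (sift_round n ?L))"
    using sift_round_progress[OF sift_rounds_inv] by blast
  show ?case
  proof (cases "\<forall>s \<in> set ?L. \<forall>t \<in> set ?L. sift n ?L (t \<odot> s) = e")
    case True
    have "sift_row n s ?L = ?L" if "s \<in> set ?L" for s
    proof -
      have "fold (\<lambda>t. sift_add n (t \<odot> s)) M ?L = ?L" if "set M \<subseteq> set ?L" for M
        using that
      proof (induction M)
        case (Cons t M)
        have "sift n ?L (t \<odot> s) = e" using True Cons.prems \<open>s \<in> set ?L\<close> by auto
        then have "sift_add n (t \<odot> s) ?L = ?L"
          using list_all_triv[OF H_e] by (simp add: sift_add_def)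
        then show ?case using Cons by simp
      qed simp
      then show ?thesis by (simp add: sift_row_def)
    qed
    then have "fold (sift_row n) M ?L = ?L" if "set M \<subseteq> set ?L" for M
      using that by (induction M) auto
    then have "sift_round n ?L = ?L" by (simp add: sift_round_def)
    then show ?thesis using True by simp
  qed (use Suc p in auto)
qed simp

text \<open>The number of rounds is a multiple of \<open>n\<close>, rather than n |I| + 1, because
  the program counts rounds by using up an \<open>n\<close>-tuple a constant number of
  times.\<close>

theorem sift_rounds_decide:
  assumes x: "x \<in> H"
  shows "list_all (\<lambda>a. idp a = a) (sift n ((sift_round n ^^ (n * Suc (card I))) L0) x)
    \<longleftrightarrow> x \<in> gen (set L0)"
proof -
  define L where "L = (sift_round n ^^ (n * Suc (card I))) L0"
  have inv: "sift_inv L0 L" using sift_rounds_inv by (simp add: L_def)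
  have LH: "set L \<subseteq> H" using sift_inv_H[OF inv] .
  have "sift n L (s \<odot> t) = e" if "s \<in> set L" "t \<in> set L" for s t
  \<comment> \<open>For n = 0 no round takes place, but the empty tuple is the only one. Otherwise
    there are more rounds than possible leads.\<close>
  proof (cases "n = 0")
    case True
    have "sift n L (s \<odot> t) \<in> H" using that LH by (intro sift_H) (auto intro!: H_mul)
    from H_len[OF this] show ?thesis using True e_len by simp
  next
    case False
    then have "\<not> n * Suc (card I) \<le> card (leads L)"
      using finite_card_leads(2)[OF LH] by simp
    then show ?thesis using that sift_rounds_iter[of "n * Suc (card I)"] by (auto simp: L_def)
  qed
  then have "sift n L x = e \<longleftrightarrow> x \<in> gen (set L)"
    using sift_eq_iff[OF LH _ x] L0 inv by (auto simp: sift_inv_def)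
  moreover have "gen (set L) = gen (set L0)"
    using inv sgrp_gen_mono[of "set L0" "set L" "sgrp_power S n"] sgrp_gen_subset[of "set L"]
    by (auto simp: sift_inv_def)
  ultimately show ?thesis using list_all_triv[OF sift_H[OF LH x]] by (simp add: L_def)
qed

end

end


section \<open>Nilpotent extensions\<close>

text \<open>\<open>prodn T A m\<close> consists of the products of \<open>m + 1\<close> elements of \<open>A\<close>.\<close>

primrec prodn :: "'x sgrp \<Rightarrow> 'x set \<Rightarrow> nat \<Rightarrow> 'x set" where
  "prodn T A 0 = A"
| "prodn T A (Suc m) = {sg_mult T a x | a x. a \<in> A \<and> x \<in> prodn T A m}"

locale sgrp_on =
  fixes T :: "'x sgrp" (structure) and X :: "'x set"
  assumes X_closed: "\<lbrakk>x \<in> X; y \<in> X\<rbrakk> \<Longrightarrow> x \<cdot> y \<in> X"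
    and X_assoc: "\<lbrakk>x \<in> X; y \<in> X; z \<in> X\<rbrakk> \<Longrightarrow> (x \<cdot> y) \<cdot> z = x \<cdot> (y \<cdot> z)"
begin

lemma prodn_closed: "A \<subseteq> X \<Longrightarrow> prodn T A m \<subseteq> X"
  by (induction m) (auto intro: X_closed)

lemma prodn_mult:
  assumes "A \<subseteq> X" "x \<in> prodn T A m" "y \<in> prodn T A j"
  shows "x \<cdot> y \<in> prodn T A (Suc (m + j))"
  using assms(2)
proof (induction m arbitrary: x)
  case (Suc m)
  then obtain a z where az: "x = a \<cdot> z" "a \<in> A" "z \<in> prodn T A m" by auto
  then have "x \<cdot> y = a \<cdot> (z \<cdot> y)"
    using assms prodn_closed[OF assms(1)] by (auto intro!: X_assoc)
  then show ?case using az Suc.IH[OF az(3)] by auto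
qed (use assms in auto)

lemma prodn_split:
  assumes "A \<subseteq> X" "x \<in> prodn T A (Suc (m + j))"
  shows "\<exists>u \<in> prodn T A m. \<exists>v \<in> prodn T A j. x = u \<cdot> v"
  using assms(2)
proof (induction m arbitrary: x)
  case (Suc m)
  then obtain a z where az: "x = a \<cdot> z" "a \<in> A" "z \<in> prodn T A (Suc (m + j))" by auto
  from Suc.IH[OF az(3)] obtain u v where
    uv: "u \<in> prodn T A m" "v \<in> prodn T A j" "z = u \<cdot> v" by blast
  then have "x = (a \<cdot> u) \<cdot> v"
    using assms az prodn_closed[OF assms(1)] by (auto intro!: X_assoc[symmetric])
  then show ?case using az uv by auto
qed auto

lemma gen_eq_prodn:
  assumes "A \<subseteq> X"
  shows "sgrp_gen T A = (\<Union>m. prodn T A m)"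
proof
  show "sgrp_gen T A \<subseteq> (\<Union>m. prodn T A m)"
  proof
    fix x assume "x \<in> sgrp_gen T A"
    then show "x \<in> (\<Union>m. prodn T A m)"
    proof induction
      case (incl a)
      then show ?case by (intro UN_I[of 0]) auto
    qed (use prodn_mult[OF assms] in blast)
  qed
  have "prodn T A m \<subseteq> sgrp_gen T A" for m
    by (induction m) (auto intro: sgrp_gen.intros)
  then show "(\<Union>m. prodn T A m) \<subseteq> sgrp_gen T A" by blast
qed

end

lemma sprod_Cons:
  assumes "sgrp_on S C" "set (a # xs) \<subseteq> C" "xs \<noteq> []"
  shows "sprod S (a # xs) = sg_mult S a (sprod S xs)"
proof -
  interpret sgrp_on S C by fact
  obtain b ys where xs: "xs = b # ys" using assms(3) by (cases xs) auto
  have "foldl (sg_mult S) (sg_mult S a b) ys = sg_mult S a (foldl (sg_mult S) b ys)"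
    using assms(2) unfolding xs
  proof (induction ys arbitrary: b)
    case (Cons c ys)
    have "sg_mult S (sg_mult S a b) c = sg_mult S a (sg_mult S b c)"
      using Cons.prems by (intro X_assoc) auto
    then show ?case using Cons.IH[of "sg_mult S b c"] Cons.prems X_closed by auto
  qed simp
  then show ?thesis by (simp add: sprod_def xs)
qed

text \<open>The ideal is the zero of the Rees quotient, so long products lie in the ideal.\<close>

lemma nilpotent_extension_products:
  fixes S :: "'a sgrp" and Q :: "'b sgrp"
  assumes ext: "ideal_extension S I Q" and nil: "nilpotent_sgrp Q"
  obtains d where "d \<ge> 1" "\<And>xs. set xs \<subseteq> carrier S \<Longrightarrow> length xs = d \<Longrightarrow> sprod S xs \<in> I"
proof -
  let ?C = "carrier S" and ?R = "rees_quotient S I"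
  have sg: "sgrp S" and ideal: "sgrp_ideal I S"
    using ext by (auto simp: ideal_extension_def)
  then have I: "I \<subseteq> ?C" "I \<noteq> {}"
    and mI: "\<And>i s. i \<in> I \<Longrightarrow> s \<in> ?C \<Longrightarrow> sg_mult S s i \<in> I \<and> sg_mult S i s \<in> I"
    by (auto simp: sgrp_ideal_def)
  note closed = sgrp.mult_closed[OF sg] and assoc = sgrp.mult_assoc[OF sg]
  obtain d where d: "d_nilpotent d Q" using nil by (auto simp: nilpotent_sgrp_def)
  obtain h where bij: "bij_betw h (carrier ?R) (carrier Q)"
    and hom: "\<And>A B. A \<in> carrier ?R \<Longrightarrow> B \<in> carrier ?R \<Longrightarrow>
      h (sg_mult ?R A B) = sg_mult Q (h A) (h B)"
    using ext unfolding ideal_extension_def sgrp_isomorphic_def by blast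
  define cl where "cl x = rees_cong S I `` {x}" for x
  have cl: "cl x = (if x \<in> I then I else {x})" if "x \<in> ?C" for x
    using that I by (auto simp: cl_def rees_cong_def)
  have cl_carrier: "cl x \<in> carrier ?R" if "x \<in> ?C" for x
    using that by (auto simp: rees_quotient_def cl_def quotient_def)
  have cl_mult: "sg_mult ?R (cl x) (cl y) = cl (sg_mult S x y)" if "x \<in> ?C" "y \<in> ?C" for x y
  proof -
    let ?P = "{a \<cdot>\<^bsub>S\<^esub> b | a b. a \<in> cl x \<and> b \<in> cl y}"
    have xy: "x \<in> cl x" "y \<in> cl y" using that cl by auto
    have P: "?P \<subseteq> cl (sg_mult S x y)"
      using that mI I closed by (auto simp: cl split: if_splits)
    have xyP: "sg_mult S x y \<in> ?P" using xy by blast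
    have rc: "rees_cong S I `` B = cl z" if B: "B \<subseteq> cl z" "z \<in> B" "z \<in> ?C" for B z
    proof (cases "z \<in> I")
      case True
      then have "B \<subseteq> I" "cl z = I" using B cl by auto
      moreover have "rees_cong S I `` B \<subseteq> I" if "B \<subseteq> I"
        using that unfolding rees_cong_def by blast
      moreover have "I \<subseteq> rees_cong S I `` B" using B(2) True unfolding rees_cong_def by blast
      ultimately show ?thesis by blast
    next
      case False
      then have "B = {z}" using B cl by auto
      then show ?thesis by (simp add: cl_def)
    qed
    have "rees_cong S I `` ?P = cl (sg_mult S x y)" by (rule rc[OF P xyP closed[OF that]])
    then show ?thesis by (simp add: rees_quotient_def)
  qed
  have on: "sgrp_on S ?C" by unfold_locales (auto intro: closed assoc)
  have hQ: "h (cl x) \<in> carrier Q" if "x \<in> ?C" for x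
    using bij cl_carrier[OF that] by (auto simp: bij_betw_def)
  have h_sprod: "sprod S xs \<in> ?C \<and> h (cl (sprod S xs)) = sprod Q (map (\<lambda>x. h (cl x)) xs)"
    if "xs \<noteq> []" "set xs \<subseteq> ?C" for xs
    using that
  proof (induction xs rule: rev_induct)
    case (snoc y xs)
    show ?case
    proof (cases xs)
      case Nil
      then show ?thesis using snoc.prems by (simp add: sprod_def)
    next
      case (Cons a as)
      have e: "sprod S (xs @ [y]) = sg_mult S (sprod S xs) y"
        "sprod Q (map (\<lambda>x. h (cl x)) (xs @ [y])) =
          sg_mult Q (sprod Q (map (\<lambda>x. h (cl x)) xs)) (h (cl y))"
        by (simp_all add: sprod_def Cons)
      have IH: "sprod S xs \<in> ?C" "h (cl (sprod S xs)) = sprod Q (map (\<lambda>x. h (cl x)) xs)"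
        using snoc Cons by auto
      have y: "y \<in> ?C" using snoc.prems by simp
      have "h (cl (sg_mult S (sprod S xs) y)) = sg_mult Q (h (cl (sprod S xs))) (h (cl y))"
        using hom[OF cl_carrier cl_carrier] IH(1) y cl_mult by metis
      then show ?thesis unfolding e using IH y closed by simp
    qed
  qed simp
  have nilQ: "sprod Q us = sprod Q vs"
    if "set us \<subseteq> carrier Q" "set vs \<subseteq> carrier Q" "length us = d" "length vs = d" for us vs
    using d that unfolding d_nilpotent_def by blast
  have "sprod S xs \<in> I" if xs: "set xs \<subseteq> ?C" "length xs = d" for xs
  proof -
    obtain i where i: "i \<in> I" "i \<in> ?C" using I by auto
    have d1: "d \<ge> 1" using d by (simp add: d_nilpotent_def)
    have ne: "xs \<noteq> []" "replicate d i \<noteq> []" using xs d1 by auto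
    have "sprod S (replicate d i) \<in> I"
    proof -
      have "foldl (sg_mult S) j (replicate m i) \<in> I" if "j \<in> I" for m j
        using that by (induction m arbitrary: j) (use mI i in auto)
      then show ?thesis using i d1 by (simp add: sprod_def hd_replicate)
    qed
    then have clr: "cl (sprod S (replicate d i)) = I" using cl I by auto
    \<comment> \<open>The product is compared with one of \<open>d\<close> elements of the ideal,
      whose class is known to be \<open>I\<close>; nilpotency of \<open>Q\<close> identifies the two
      images.\<close>
    have "sprod Q (map (\<lambda>x. h (cl x)) xs) = sprod Q (map (\<lambda>x. h (cl x)) (replicate d i))"
      by (rule nilQ) (use xs hQ i in auto)
    moreover have "h (cl (sprod S xs)) = sprod Q (map (\<lambda>x. h (cl x)) xs)"
      using h_sprod[OF ne(1) xs(1)] by blast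
    moreover have "h I = sprod Q (map (\<lambda>x. h (cl x)) (replicate d i))"
      using h_sprod[OF ne(2)] i clr by (simp add: set_replicate_conv_if)
    moreover have cli: "cl i = I" using cl[OF i(2)] i(1) by simp
    ultimately have "h (cl (sprod S xs)) = h (cl i)" by (simp only:)
    then have "cl (sprod S xs) = cl i"
      using inj_onD[OF bij_betw_imp_inj_on[OF bij]] cl_carrier[OF i(2)]
        cl_carrier[of "sprod S xs"] h_sprod[OF ne(1) xs(1)] by blast
    then have "cl (sprod S xs) = I" by (simp only: cli)
    moreover have "sprod S xs \<in> ?C" using h_sprod[OF ne(1) xs(1)] by blast
    moreover from this have "sprod S xs \<in> cl (sprod S xs)" by (simp add: cl)
    ultimately show ?thesis by simp
  qed
  then show thesis using d that by (auto simp: d_nilpotent_def)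
qed

text \<open>Keeping \<open>L\<close> preserves the shorter products, so j iterations reach all
  products of at most 2^j factors. The nested folds are the two loops of
  \<open>square_prog\<close>.\<close>

definition square_list :: "'a sgrp \<Rightarrow> 'a list list \<Rightarrow> 'a list list" where
  "square_list S L =
     fold (\<lambda>s. fold (\<lambda>t A. map2 (sg_mult S) t s # A) L) L [] @ L"

lemma fold_Cons_map: "fold (\<lambda>x A. f x # A) xs A = rev (map f xs) @ A"
  by (induction xs arbitrary: A) auto

lemma fold_Cons_filter: "fold (\<lambda>x A. if Q x then x # A else A) xs A = rev (filter Q xs) @ A"
  by (induction xs arbitrary: A) auto

lemma square_list_facts:
  shows "set (square_list S L) = set L \<union> {map2 (sg_mult S) t s | t s. t \<in> set L \<and> s \<in> set L}"
    and "length (square_list S L) = length L * length L + length L"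
proof -
  have "set (fold (\<lambda>s. fold (\<lambda>t A. map2 (sg_mult S) t s # A) L) M A) =
      set A \<union> {map2 (sg_mult S) t s | t s. t \<in> set L \<and> s \<in> set M} \<and>
    length (fold (\<lambda>s. fold (\<lambda>t A. map2 (sg_mult S) t s # A) L) M A) =
      length M * length L + length A" for M A
    by (induction M arbitrary: A) (auto simp: fold_Cons_map)
  then show "set (square_list S L) = set L \<union> {map2 (sg_mult S) t s | t s. t \<in> set L \<and> s \<in> set L}"
    "length (square_list S L) = length L * length L + length L"
    by (auto simp: square_list_def)
qed

text \<open>Adding 1 turns the recurrence l^2 + l into squaring, since l^2 + l + 1 is at most (l +
  1)^2. With \<open>r\<close> fixed this is polynomial in the length of \<open>L\<close>.\<close>

lemma length_square_list_iter:
  "length ((square_list S ^^ r) L) + 1 \<le> (length L + 1) ^ (2 ^ r)"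
proof (induction r)
  case (Suc r)
  let ?l = "length ((square_list S ^^ r) L)"
  have "?l * ?l + ?l + 1 \<le> (?l + 1) * (?l + 1)" by simp
  also have "\<dots> \<le> (length L + 1) ^ (2 ^ r) * (length L + 1) ^ (2 ^ r)"
    using Suc by (intro mult_mono) auto
  also have "\<dots> = (length L + 1) ^ (2 ^ Suc r)"
    by (simp add: mult_2 flip: power_add)
  finally show ?case by (simp add: square_list_facts)
qed simp

text \<open>Here \<open>r\<close> is the number of squarings; its condition makes them reach every
  block of fewer than 2 d factors.\<close>

locale nil_ext_clifford = clifford_exp S I k
  for S :: "'a sgrp" (structure) and I :: "'a set" and k :: nat +
  fixes d r :: nat
  assumes fin: "finite (carrier S)" and I_sub: "I \<subseteq> carrier S"
    and S_closed: "\<lbrakk>x \<in> carrier S; y \<in> carrier S\<rbrakk> \<Longrightarrow> x \<cdot> y \<in> carrier S"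
    and S_assoc: "\<lbrakk>x \<in> carrier S; y \<in> carrier S; z \<in> carrier S\<rbrakk> \<Longrightarrow> (x \<cdot> y) \<cdot> z = x \<cdot> (y \<cdot> z)"
    and I_ideal: "\<lbrakk>s \<in> carrier S; i \<in> I\<rbrakk> \<Longrightarrow> s \<cdot> i \<in> I"
    and d: "d \<ge> 1"
    and nil: "\<lbrakk>set xs \<subseteq> carrier S; length xs = d\<rbrakk> \<Longrightarrow> sprod S xs \<in> I"
    and r: "2 * d \<le> 2 ^ r"
begin

lemma carrier_on: "sgrp_on S (carrier S)"
  by unfold_locales (auto intro: S_closed S_assoc)

lemma power_on: "sgrp_on (sgrp_power S n) (tuples n (carrier S))"
  by unfold_locales (auto simp: tuples_iff S_closed S_assoc intro!: nth_equalityI)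

lemma power_prodn_split:
  assumes "A \<subseteq> tuples n (carrier S)" "x \<in> prodn (sgrp_power S n) A (Suc (m + j))"
  obtains u v where "u \<in> prodn (sgrp_power S n) A m" "v \<in> prodn (sgrp_power S n) A j"
    "x = map2 (\<cdot>) u v"
  using sgrp_on.prodn_split[OF power_on assms] that unfolding sg_mult_power by blast

lemma prodn_carrier: "d \<le> Suc m \<Longrightarrow> prodn S (carrier S) m \<subseteq> I"
proof -
  have len: "\<exists>xs. set xs \<subseteq> carrier S \<and> length xs = Suc m \<and> sprod S xs = x"
    if "x \<in> prodn S (carrier S) m" for m x
    using that
  proof (induction m arbitrary: x)
    case 0
    then show ?case by (intro exI[of _ "[x]"]) (simp add: sprod_def)
  next
    case (Suc m)
    then obtain a z where az: "x = a \<cdot> z" "a \<in> carrier S" "z \<in> prodn S (carrier S) m" by auto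
    from Suc.IH[OF az(3)] obtain xs where
      xs: "set xs \<subseteq> carrier S" "length xs = Suc m" "sprod S xs = z" by blast
    then have "xs \<noteq> []" by auto
    then have "sprod S (a # xs) = x" using az xs sprod_Cons[OF carrier_on, of a xs] by simp
    then show ?case using xs az by (intro exI[of _ "a # xs"]) auto
  qed
  have base: "prodn S (carrier S) m \<subseteq> I" if "Suc m = d" for m
    using len[of _ m] nil that by (metis subsetI)
  show "d \<le> Suc m \<Longrightarrow> prodn S (carrier S) m \<subseteq> I"
  proof (induction m)
    case 0
    then show ?case using base[of 0] d by simp
  next
    case (Suc m)
    show ?case
    proof (cases "d = Suc (Suc m)")
      case False
      then show ?thesis using Suc I_ideal by auto
    qed (use base[of "Suc m"] in simp)
  qed
qed

lemma prodn_nth: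
  assumes "A \<subseteq> tuples n (carrier S)" "x \<in> prodn (sgrp_power S n) A m" "i < n"
  shows "x ! i \<in> prodn S (carrier S) m"
  using assms(2)
proof (induction m arbitrary: x)
  case 0
  then show ?case using assms by (auto simp: tuples_iff)
next
  case (Suc m)
  then obtain a z where az: "x = map2 (\<cdot>) a z" "a \<in> A" "z \<in> prodn (sgrp_power S n) A m" by auto
  moreover have "length z = n" "length a = n"
    using az assms(1) sgrp_on.prodn_closed[OF power_on assms(1)] by (auto simp: tuples_def)
  moreover have "a ! i \<in> carrier S" using az(2) assms by (auto simp: tuples_iff)
  ultimately have "x ! i = a ! i \<cdot> z ! i \<and> a ! i \<in> carrier S \<and> z ! i \<in> prodn S (carrier S) m"
    using Suc.IH[OF az(3)] assms(3) by simp
  then show ?case by auto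
qed

lemma prodn_tuples_I:
  assumes "A \<subseteq> tuples n (carrier S)" "d \<le> Suc m"
  shows "prodn (sgrp_power S n) A m \<subseteq> tuples n I"
  using prodn_nth[OF assms(1)] prodn_carrier[OF assms(2)]
    sgrp_on.prodn_closed[OF power_on assms(1), of m]
  by (auto simp: tuples_iff subset_iff)

lemma square_list_gen:
  "set ((square_list S ^^ j) L) \<subseteq> sgrp_gen (sgrp_power S n) (set L)"
proof (induction j)
  case (Suc j)
  then show ?case
    using sgrp_gen.mult[of _ "sgrp_power S n" "set L"] by (auto simp: square_list_facts)
qed (auto intro: sgrp_gen.incl)

lemma prodn_square_list:
  assumes "set L \<subseteq> tuples n (carrier S)" "m < 2 ^ j"
  shows "prodn (sgrp_power S n) (set L) m \<subseteq> set ((square_list S ^^ j) L)"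
  using assms(2)
proof (induction j arbitrary: m)
  case (Suc j)
  show ?case
  proof (cases "m < 2 ^ j")
    case False
    \<comment> \<open>The index of \<open>prodn\<close> is one less than the number of factors: 2^j
      factors are split off on the left, and i + 1, at most 2^j, remain.\<close>
    define i where "i = m - 2 ^ j"
    have m: "m = Suc ((2 ^ j - 1) + i)" and i: "i < 2 ^ j" "2 ^ j - 1 < (2 :: nat) ^ j"
      using False Suc.prems by (auto simp: i_def)
    show ?thesis
    proof
      fix x assume x: "x \<in> prodn (sgrp_power S n) (set L) m"
      obtain u v where "u \<in> prodn (sgrp_power S n) (set L) (2 ^ j - 1)"
        "v \<in> prodn (sgrp_power S n) (set L) i" and xuv: "x = map2 (\<cdot>) u v"
        using power_prodn_split[OF assms(1) x[unfolded m]] by metis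
      then have "u \<in> set ((square_list S ^^ j) L)" "v \<in> set ((square_list S ^^ j) L)"
        using Suc.IH[OF i(1)] Suc.IH[OF i(2)] by auto
      then show "x \<in> set ((square_list S ^^ Suc j) L)"
        unfolding xuv by (auto simp: square_list_facts)
    qed
  qed (use Suc in \<open>auto simp: square_list_facts\<close>)
qed (use assms in simp)

text \<open>Long products are products of blocks of between \<open>d\<close> and \<open>2 d - 1\<close> factors.\<close>

lemma gen_iff_square_list:
  assumes L: "set L \<subseteq> tuples n (carrier S)"
  defines "P \<equiv> set ((square_list S ^^ r) L)"
  shows "x \<in> sgrp_gen (sgrp_power S n) (set L) \<longleftrightarrow>
    x \<in> P \<or> x \<in> sgrp_gen (sgrp_power S n) (P \<inter> tuples n I)"
proof
  let ?T = "sgrp_power S n"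
  have long: "y \<in> sgrp_gen ?T (P \<inter> tuples n I)"
    if "y \<in> prodn ?T (set L) m" "d \<le> Suc m" for y m
    using that
  proof (induction m arbitrary: y rule: less_induct)
    case (less m)
    show ?case
    proof (cases "Suc m < 2 * d")
      case True
      then have "m < 2 ^ r" using r by simp
      then have "y \<in> P" using less.prems prodn_square_list[OF L] by (auto simp: P_def)
      then show ?thesis using less.prems prodn_tuples_I[OF L] by (auto intro: sgrp_gen.incl)
    next
      case False
      \<comment> \<open>Of the m + 1 factors, the first \<open>d\<close> form a block, and at least
        \<open>d\<close> factors remain for the induction hypothesis.\<close>
      define j where "j = m - d"
      have m: "m = Suc ((d - 1) + j)" and j: "j < m" "d \<le> Suc j" and d': "d - 1 < 2 ^ r"
        using False d r by (auto simp: j_def)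
      obtain u v where uv: "u \<in> prodn ?T (set L) (d - 1)" "v \<in> prodn ?T (set L) j" "y = map2 (\<cdot>) u v"
        using power_prodn_split[OF L less.prems(1)[unfolded m]] by metis
      have "u \<in> P \<inter> tuples n I"
        using uv prodn_square_list[OF L d'] prodn_tuples_I[OF L, of "d - 1"] d by (auto simp: P_def)
      then have "u \<in> sgrp_gen ?T (P \<inter> tuples n I)" by (rule sgrp_gen.incl)
      from sgrp_gen.mult[OF this less.IH[OF j(1) uv(2) j(2)]] show ?thesis using uv by simp
    qed
  qed
  assume "x \<in> sgrp_gen ?T (set L)"
  then obtain m where m: "x \<in> prodn ?T (set L) m"
    using sgrp_on.gen_eq_prodn[OF power_on L] by auto
  show "x \<in> P \<or> x \<in> sgrp_gen ?T (P \<inter> tuples n I)"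
  proof (cases "d \<le> Suc m")
    case False
    then have "m < 2 ^ r" using r by simp
    then show ?thesis using m prodn_square_list[OF L] by (auto simp: P_def)
  qed (use long m in blast)
next
  have "P \<subseteq> sgrp_gen (sgrp_power S n) (set L)" unfolding P_def by (rule square_list_gen)
  then show "x \<in> sgrp_gen (sgrp_power S n) (set L)"
    if "x \<in> P \<or> x \<in> sgrp_gen (sgrp_power S n) (P \<inter> tuples n I)"
    using that sgrp_gen_subset[of "P \<inter> tuples n I" "sgrp_power S n" "set L"] by blast
qed

text \<open>The order \<open>below\<close> in the power together with membership in
  \<open>I\<close>, tested coordinate by coordinate so that one scan suffices. As \<open>b\<close>
  is inspected too, no tuple is relevant if \<open>b\<close> is not over \<open>I\<close>, and the
  test then fails, as it should.\<close>

definition relevant :: "'a list \<Rightarrow> 'a list \<Rightarrow> bool" where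
  "relevant b c \<longleftrightarrow> list_all2 (\<lambda>x y. x \<in> I \<and> y \<in> I \<and> idp y \<cdot> idp x = idp y) c b"

definition relevant_list :: "'a list \<Rightarrow> 'a list list \<Rightarrow> 'a list list" where
  "relevant_list b P = fold (\<lambda>c G. if relevant b c then c # G else G) P []"

text \<open>Sifting requires the identity of the group in the list, so the idempotent of
  \<open>b\<close> is put in front.\<close>

definition project_list :: "'a list \<Rightarrow> 'a list list \<Rightarrow> 'a list list" where
  "project_list b G = map idp b # fold (\<lambda>c L. map2 (\<cdot>) (map idp b) c # L) G []"

text \<open>The conditions of \<open>mem_gen_iff\<close> for the power, with group membership
  replaced by sifting.\<close>

definition clifford_test :: "nat \<Rightarrow> 'a list \<Rightarrow> 'a list list \<Rightarrow> bool" where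
  "clifford_test n b G \<longleftrightarrow> G \<noteq> [] \<and>
     map idp (fold (\<lambda>c E. map2 (\<cdot>) E c) (tl G) (hd G)) = map idp b \<and>
     list_all (\<lambda>a. idp a = a)
       (sift n ((sift_round n ^^ (n * Suc (card I))) (project_list b G)) b)"

lemma relevant_list_facts:
  "set (relevant_list b P) = {c \<in> set P. relevant b c}"
  "length (relevant_list b P) \<le> length P"
  by (simp_all add: relevant_list_def fold_Cons_filter)

lemma project_list_facts:
  "set (project_list b G) = insert (map idp b) ((\<lambda>c. map2 (\<cdot>) (map idp b) c) ` set G)"
  "length (project_list b G) = Suc (length G)"
  by (simp_all add: project_list_def fold_Cons_map)

lemma power_group_idp:
  assumes "b \<in> tuples n I"
  shows "power_group S I k n (map idp b)" "b \<in> power_group.H S I k n (map idp b)"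
proof -
  show pg: "power_group S I k n (map idp b)"
    using assms fin I_sub finite_subset
    by unfold_locales (auto simp: tuples_iff idp_idp in_set_conv_nth)
  show "b \<in> power_group.H S I k n (map idp b)"
    using assms by (intro power_group.HI[OF pg]) (auto simp: tuples_iff)
qed

lemma project_list_H:
  assumes G: "\<And>c. c \<in> set G \<Longrightarrow> c \<in> tuples n I \<and> relevant b c" and b: "b \<in> tuples n I"
  shows "set (project_list b G) \<subseteq> power_group.H S I k n (map idp b)"
    "map idp b \<in> set (project_list b G)"
proof -
  interpret P: power_group S I k n "map idp b" by (rule power_group_idp[OF b])
  have "map2 (\<cdot>) (map idp b) c \<in> P.H" if "c \<in> set G" for c
  proof (rule P.HI)
    have c: "c \<in> tuples n I" "relevant b c" using G[OF that] by auto
    show "length (map2 (\<cdot>) (map idp b) c) = n" using c b by (simp add: tuples_iff)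
    fix i assume i: "i < n"
    have "idp (b ! i) \<cdot> idp (c ! i) = idp (b ! i)"
      using c b i by (simp add: relevant_def list_all2_conv_all_nth tuples_iff)
    then show "map2 (\<cdot>) (map idp b) c ! i \<in> I" "idp (map2 (\<cdot>) (map idp b) c ! i) = map idp b ! i"
      using c b i by (auto simp: tuples_iff closed idp_hom idp_idp)
  qed
  then show "set (project_list b G) \<subseteq> P.H" "map idp b \<in> set (project_list b G)"
    by (auto simp: project_list_facts)
qed

theorem mem_gen_iff_test:
  assumes L: "set L \<subseteq> tuples n (carrier S)" and b: "b \<in> tuples n (carrier S)"
  defines "P \<equiv> (square_list S ^^ r) L"
  shows "b \<in> sgrp_gen (sgrp_power S n) (set L) \<longleftrightarrow>
    b \<in> set P \<or> clifford_test n b (relevant_list b P)"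
proof -
  let ?T = "sgrp_power S n" and ?G = "relevant_list b P"
  let ?A = "set P \<inter> tuples n I"
  interpret P: clifford_exp ?T "tuples n I" k
    using clifford_exp_power clifford_exp_axioms by blast
  have PC: "c \<in> tuples n (carrier S)" if "c \<in> set P" for c
  proof -
    have "sgrp_gen ?T (set L) \<subseteq> tuples n (carrier S)"
      using L sgrp_on.X_closed[OF power_on] by (rule sgrp_gen_least)
    then show ?thesis using square_list_gen[where j = r and L = L and n = n] that by (auto simp: P_def)
  qed
  have "b \<in> sgrp_gen ?T ?A \<longleftrightarrow> clifford_test n b ?G"
  proof (cases "b \<in> tuples n I")
    case False
    then obtain i where "i < n" "b ! i \<notin> I" using b by (auto simp: tuples_iff)
    then have "\<not> relevant b c" for c
      using b by (auto simp: relevant_def list_all2_conv_all_nth tuples_iff)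
    then have "?G = []" using relevant_list_facts(1)[of b P] by simp
    moreover have "sgrp_gen ?T ?A \<subseteq> tuples n I" by (rule P.gen_closed) simp
    ultimately show ?thesis using False by (auto simp: clifford_test_def)
  next
    case True
    let ?e = "map idp b"
    let ?J = "(\<lambda>c. map2 (\<cdot>) ?e c) ` set ?G" and ?M = "project_list b ?G"
    interpret G: power_group S I k n ?e by (rule power_group_idp[OF True])
    have bH: "b \<in> G.H" by (rule power_group_idp[OF True])
    have setG: "set ?G = {c \<in> ?A. P.below b c}"
    proof -
      have "relevant b c \<longleftrightarrow> c \<in> tuples n I \<and> P.below b c" if "c \<in> set P" for c
        using PC[OF that] True
        by (auto simp: relevant_def P.below_def list_all2_conv_all_nth tuples_iff spow_power list_eq_iff_nth_eq)
      then show ?thesis by (auto simp: relevant_list_facts)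
    qed
    have "b \<in> sgrp_gen ?T ?A \<longleftrightarrow> ?G \<noteq> [] \<and>
        map idp (fold (\<lambda>c E. map2 (\<cdot>) E c) (tl ?G) (hd ?G)) = map idp b \<and>
        b \<in> sgrp_gen ?T ?J"
      using P.mem_gen_iff[OF _ True setG] by (simp add: spow_power)
    moreover have "b \<in> sgrp_gen ?T ?J \<longleftrightarrow>
        list_all (\<lambda>a. idp a = a) (sift n ((sift_round n ^^ (n * Suc (card I))) ?M) b)"
      if ne: "?G \<noteq> []"
    proof -
      have L0: "set ?M \<subseteq> G.H" "?e \<in> set ?M"
        using project_list_H[OF _ True, of ?G] setG by (auto simp: relevant_list_facts(1))
      \<comment> \<open>The identity is a power of any projected tuple, so adding it to a nonempty
        list generates nothing new.\<close>
      have "?e \<in> sgrp_gen ?T ?J"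
      proof -
        obtain c where c: "c \<in> set ?G" using ne by (cases ?G) auto
        let ?x = "map2 (\<cdot>) ?e c"
        have "?x \<in> G.H" using L0(1) c by (auto simp: project_list_facts)
        then have "map idp ?x = ?e"
          using G.H_len[of ?x] G.H_idp[of ?x] G.e_len by (intro nth_equalityI) (simp_all only: length_map nth_map)
        then have "spow ?T ?x k = ?e" by (simp add: spow_power)
        moreover have "spow ?T ?x k \<in> sgrp_gen ?T ?J"
          using c by (intro spow_in_gen sgrp_gen.incl) auto
        ultimately show ?thesis by simp
      qed
      then have "set ?M \<subseteq> sgrp_gen ?T ?J"
        by (auto simp: project_list_facts intro: sgrp_gen.incl)
      then have "sgrp_gen ?T (set ?M) = sgrp_gen ?T ?J"
        using sgrp_gen_mono[of "?J" "set ?M" ?T]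
        by (intro equalityI sgrp_gen_subset) (auto simp: project_list_facts)
      then show ?thesis using G.sift_rounds_decide[OF L0 bH] by simp
    qed
    ultimately show ?thesis unfolding clifford_test_def by blast
  qed
  then show ?thesis using gen_iff_square_list[OF L, of b] by (simp add: P_def)
qed

end


section \<open>Programming with stacks of tuples\<close>

text \<open>The running time may be forgotten, because \<open>runs_time\<close> bounds it for every
  run with loop bound \<open>B\<close>.\<close>

definition yields :: "nat \<Rightarrow> 'c prog \<Rightarrow> 'c stacks \<Rightarrow> 'c stacks \<Rightarrow> bool" where
  "yields B P s s' \<longleftrightarrow> (\<exists>t. runs B P s s' t)"

lemma yields_Seq: "yields B P s s1 \<Longrightarrow> yields B Q s1 s2 \<Longrightarrow> yields B (P \<Zsemi> Q) s s2"
  unfolding yields_def by (blast intro: runs_Seq)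

lemma yields_Skip: "yields B Skip s s"
  unfolding yields_def by (blast intro: runs_Skip)

lemma yields_Pop: "yields B (Pop v) s (s(v := tl (s v)))"
  unfolding yields_def by (blast intro: runs_Pop)

lemma yields_Push: "yields B (Push v a) s (s(v := a # s v))"
  unfolding yields_def by (blast intro: runs_Push)

lemma yields_CondT: "c (tops s) \<Longrightarrow> yields B P s s' \<Longrightarrow> yields B (Cond c P Q) s s'"
  unfolding yields_def by (blast intro: runs_CondT)

lemma yields_CondF: "\<not> c (tops s) \<Longrightarrow> yields B Q s s' \<Longrightarrow> yields B (Cond c P Q) s s'"
  unfolding yields_def by (blast intro: runs_CondF)

lemma yields_LoopF: "\<not> c (tops s) \<Longrightarrow> yields B (Loop c v P) s s"
  unfolding yields_def by (blast intro: runs_LoopF)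

lemma yields_LoopT:
  "c (tops s) \<Longrightarrow> length (s v) \<le> B \<Longrightarrow> yields B P s s1 \<Longrightarrow> length (s1 v) < length (s v) \<Longrightarrow>
   yields B (Loop c v P) s1 s2 \<Longrightarrow> yields B (Loop c v P) s s2"
  unfolding yields_def by (blast intro: runs_LoopT)

lemma yields_eq: "yields B P s s1 \<Longrightarrow> s1 = s2 \<Longrightarrow> yields B P s s2"
  by simp

text \<open>Symbolic execution of straight-line code, which lets the simplifier compute the final
  stacks.\<close>

primrec exec :: "'c prog \<Rightarrow> 'c stacks \<Rightarrow> 'c stacks" where
  "exec Skip s = s"
| "exec (Pop v) s = s(v := tl (s v))"
| "exec (Push v a) s = s(v := a # s v)"
| "exec (P \<Zsemi> Q) s = exec Q (exec P s)"
| "exec (Cond c P Q) s = (if c (tops s) then exec P s else exec Q s)"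
| "exec (Loop c v P) s = s"

primrec loop_free :: "'c prog \<Rightarrow> bool" where
  "loop_free Skip = True"
| "loop_free (Pop v) = True"
| "loop_free (Push v a) = True"
| "loop_free (P \<Zsemi> Q) = (loop_free P \<and> loop_free Q)"
| "loop_free (Cond c P Q) = (loop_free P \<and> loop_free Q)"
| "loop_free (Loop c v P) = False"

lemma yields_exec: "loop_free P \<Longrightarrow> yields B P s (exec P s)"
  by (induction P arbitrary: s)
    (auto intro: yields_Skip yields_Pop yields_Push yields_Seq yields_CondT yields_CondF)

primrec seqn :: "nat \<Rightarrow> 'c prog \<Rightarrow> 'c prog" where
  "seqn 0 P = Skip"
| "seqn (Suc m) P = seqn m P \<Zsemi> P"

lemma yields_seqn:
  assumes "\<And>a. Inv a \<Longrightarrow> yields B P (st a) (st (f a)) \<and> Inv (f a)" "Inv a"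
  shows "yields B (seqn m P) (st a) (st ((f ^^ m) a)) \<and> Inv ((f ^^ m) a)"
  by (induction m) (use assms in \<open>auto intro: yields_Skip yields_Seq\<close>)

text \<open>Symbols outside \<open>cs\<close>, such as the blank read from an empty stack, are not pushed.\<close>

definition emit ::
  "'c tape_symbol list \<Rightarrow> nat \<Rightarrow> ((nat \<Rightarrow> 'c tape_symbol) \<Rightarrow> 'c tape_symbol) \<Rightarrow> 'c prog" where
  "emit cs v f = foldr (\<lambda>a P. Cond (\<lambda>g. f g = a) (Push v a) P) cs Skip"

lemma exec_emit [simp]:
  "exec (emit cs v f) s = (if f (tops s) \<in> set cs then s(v := f (tops s) # s v) else s)"
  unfolding emit_def by (induction cs) auto

lemma loop_free_emit [simp]: "loop_free (emit cs v f)"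
  unfolding emit_def by (induction cs) auto

lemma prog_wf_emit [simp]: "v < K \<Longrightarrow> prog_wf K (emit cs v f)"
  unfolding emit_def by (induction cs) auto

lemma prog_wf_seqn [simp]: "prog_wf K P \<Longrightarrow> prog_wf K (seqn m P)"
  by (induction m) auto

definition repeat_while :: "nat \<Rightarrow> 'c prog \<Rightarrow> 'c prog" where
  "repeat_while v P = Loop (\<lambda>g. g v \<noteq> Blank) v P"

text \<open>Stack \<open>v\<close> serves as a unary counter, whatever its symbols are. It will hold
  copies of \<open>b\<close>, so that the loop runs \<open>n\<close> times.\<close>

lemma yields_repeat:
  assumes step: "\<And>xs a. Inv a \<Longrightarrow> yields B P (st xs a) (st xs (f a)) \<and> Inv (f a)"
    and st: "\<And>x xs a. (st (x # xs) a)(v := xs) = st xs a" "\<And>xs a. st xs a v = xs"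
    and us: "Blank \<notin> set us" "length us \<le> B" and "Inv a"
  shows "yields B (repeat_while v (Pop v \<Zsemi> P)) (st us a) (st [] ((f ^^ length us) a)) \<and>
    Inv ((f ^^ length us) a)"
  using us \<open>Inv a\<close>
proof (induction us arbitrary: a)
  case Nil
  have "yields B (repeat_while v (Pop v \<Zsemi> P)) (st [] a) (st [] a)"
    unfolding repeat_while_def by (rule yields_LoopF) (simp add: st)
  then show ?case using Nil by simp
next
  case (Cons u us)
  have IH: "yields B (repeat_while v (Pop v \<Zsemi> P)) (st us (f a)) (st [] ((f ^^ length us) (f a)))"
    "Inv ((f ^^ length us) (f a))"
    using Cons step[of a us] by auto
  have step1: "yields B (Pop v \<Zsemi> P) (st (u # us) a) (st us (f a))"
    using yields_Seq[OF yields_Pop[of B v "st (u # us) a"], of P] step[of a us] Cons.prems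
    by (simp add: st)
  have "yields B (repeat_while v (Pop v \<Zsemi> P)) (st (u # us) a) (st [] ((f ^^ length us) (f a)))"
    unfolding repeat_while_def
    by (rule yields_LoopT[OF _ _ step1 _ IH(1)[unfolded repeat_while_def]])
      (use Cons.prems in \<open>auto simp: st\<close>)
  then show ?case using IH(2) by (simp add: funpow_swap1)
qed

abbreviation El :: "'a \<Rightarrow> 'a smp_symbol tape_symbol" where "El a \<equiv> Input (Elem a)"
abbreviation SEP :: "'a smp_symbol tape_symbol" where "SEP \<equiv> Input Sep"

definition enc :: "'a list list \<Rightarrow> 'a smp_symbol tape_symbol list" where
  "enc ts = concat (map (\<lambda>t. map El t @ [SEP]) ts)"

lemma enc_simps [simp]: "enc [] = []" "enc (t # ts) = map El t @ SEP # enc ts"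
  "enc (ts @ ts') = enc ts @ enc ts'"
  by (simp_all add: enc_def)

lemma length_enc: "set ts \<subseteq> tuples n A \<Longrightarrow> length (enc ts) = length ts * (n + 1)"
  by (induction ts) (auto simp: tuples_def)

lemma peek_enc [simp]: "peek (enc ts) = Blank \<longleftrightarrow> ts = []"
proof (cases ts)
  case (Cons t us)
  then show ?thesis by (cases t) auto
qed simp

text \<open>A loop that consumes an encoded list computes a fold; this is why the mathematical
  algorithm is phrased with \<open>fold\<close>. The invariant also has to supply the height bound
  for the rest of the list.\<close>

lemma yields_foreach:
  assumes step: "\<And>t ts a. Inv (t # ts) a \<Longrightarrow> yields B P (st (t # ts) a) (st ts (f t a)) \<and> Inv ts (f t a)"
    and st: "\<And>ts a. st ts a v = enc ts"
    and B: "\<And>ts a. Inv ts a \<Longrightarrow> length (enc ts) \<le> B" and "Inv us a"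
  shows "yields B (repeat_while v P) (st us a) (st [] (fold f us a)) \<and> Inv [] (fold f us a)"
  using \<open>Inv us a\<close>
proof (induction us arbitrary: a)
  case Nil
  have "yields B (repeat_while v P) (st [] a) (st [] a)"
    unfolding repeat_while_def by (rule yields_LoopF) (simp add: st)
  then show ?case using Nil by simp
next
  case (Cons u us)
  have 1: "yields B P (st (u # us) a) (st us (f u a))" "Inv us (f u a)"
    using step[OF Cons.prems] by auto
  have pk: "peek (map El u @ SEP # enc us) \<noteq> Blank" by (cases u) auto
  have "yields B (repeat_while v P) (st (u # us) a) (st [] (fold f us (f u a)))"
    unfolding repeat_while_def
    by (rule yields_LoopT[OF _ _ 1(1) _ Cons.IH[OF 1(2), THEN conjunct1, unfolded repeat_while_def]])
      (use B[OF Cons.prems] pk in \<open>simp_all add: st\<close>)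
  then show ?case using Cons.IH[OF 1(2)] by simp
qed

section \<open>Mealy machines that read two tuples in parallel\<close>

primrec mealy_mode :: "(nat \<Rightarrow> 'a \<Rightarrow> 'a \<Rightarrow> nat) \<Rightarrow> nat \<Rightarrow> ('a \<times> 'a) list \<Rightarrow> nat" where
  "mealy_mode \<delta> m [] = m"
| "mealy_mode \<delta> m (p # ps) = mealy_mode \<delta> (\<delta> m (fst p) (snd p)) ps"

primrec mealy_out ::
  "(nat \<Rightarrow> 'a \<Rightarrow> 'a \<Rightarrow> nat) \<Rightarrow> (nat \<Rightarrow> 'a \<Rightarrow> 'a \<Rightarrow> 'a) \<Rightarrow> nat \<Rightarrow> ('a \<times> 'a) list \<Rightarrow> 'a list" where
  "mealy_out \<delta> f m [] = []"
| "mealy_out \<delta> f m (p # ps) = f m (fst p) (snd p) # mealy_out \<delta> f (\<delta> m (fst p) (snd p)) ps"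

lemma length_mealy_out [simp]: "length (mealy_out \<delta> f m ps) = length ps"
  by (induction ps arbitrary: m) auto

lemma mealy_out_stateless: "mealy_out \<delta> (\<lambda>_. f) m (zip t u) = map2 f t u"
proof -
  have "mealy_out \<delta> (\<lambda>_. f) m ps = map (\<lambda>(a, b). f a b) ps" for ps
    by (induction ps arbitrary: m) auto
  then show ?thesis .
qed

definition test_mode :: "('a \<Rightarrow> 'a \<Rightarrow> bool) \<Rightarrow> nat \<Rightarrow> 'a \<Rightarrow> 'a \<Rightarrow> nat" where
  "test_mode Q m a b = (if m = 0 \<and> Q a b then 0 else 1)"

lemma mealy_mode_test:
  assumes "length t = length u"
  shows "mealy_mode (test_mode Q) 0 (zip t u) = (if list_all2 Q t u then 0 else 1)"
proof -
  have 1: "mealy_mode (test_mode Q) (Suc 0) ps = 1" for ps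
    by (induction ps) (auto simp: test_mode_def)
  show ?thesis
    using assms
  proof (induction t u rule: list_induct2)
    case (Cons x xs y ys)
    then show ?case using 1 by (cases "Q x y") (simp_all add: test_mode_def[of Q 0])
  qed simp
qed

fun sym_val :: "'a smp_symbol tape_symbol \<Rightarrow> 'a" where
  "sym_val (Input (Elem a)) = a"
| "sym_val _ = undefined"

fun sym_mode :: "'c tape_symbol \<Rightarrow> nat" where
  "sym_mode (Work m) = m"
| "sym_mode _ = 0"

text \<open>The work symbols are the modes of transducers, of which division needs three. The
  alphabet is given as a list because \<open>emit\<close> branches over its members.\<close>

locale tuple_stacks =
  fixes C :: "'a set" and cs :: "'a smp_symbol tape_symbol list"
  assumes cs: "set cs = insert SEP (El ` C \<union> Work ` {0, 1, 2})"
begin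

abbreviation word :: "'a smp_symbol tape_symbol list \<Rightarrow> bool" where
  "word u \<equiv> set u \<subseteq> set cs"

lemma Blank_notin [simp]: "Blank \<notin> set cs"
  by (auto simp: cs)

lemma El_in [simp]: "El a \<in> set cs \<longleftrightarrow> a \<in> C"
  by (auto simp: cs)

lemma SEP_in [simp]: "SEP \<in> set cs"
  by (simp add: cs)

lemma word_tuple [simp]: "word (map El t) \<longleftrightarrow> set t \<subseteq> C"
  by (auto simp: subset_iff)

lemma word_enc [simp]: "set ts \<subseteq> tuples n C \<Longrightarrow> word (enc ts)"
  by (induction ts) (auto simp: tuples_def subset_iff)

text \<open>Moving reverses the order, so an order-preserving transfer consists of two
  moves.\<close>

definition move :: "('a smp_symbol tape_symbol \<Rightarrow> bool) \<Rightarrow> nat \<Rightarrow> nat \<Rightarrow> 'a smp_symbol prog" where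
  "move c a b = Loop (\<lambda>g. c (g a)) a (emit cs b (\<lambda>g. g a) \<Zsemi> Pop a)"

lemma yields_move:
  assumes "a \<noteq> b" "s a = u @ r" "word u" "\<forall>x \<in> set u. c x" "\<not> c (peek r)" "length (s a) \<le> B"
  shows "yields B (move c a b) s (s(a := r, b := rev u @ s b))"
  using assms(2-)
proof (induction u arbitrary: s)
  case Nil
  then show ?case unfolding move_def
    by (intro yields_eq[OF yields_LoopF]) auto
next
  case (Cons x u)
  let ?P = "emit cs b (\<lambda>g. g a) \<Zsemi> Pop a"
  let ?s = "s(b := x # s b, a := u @ r)"
  have "exec ?P s = ?s" using Cons.prems \<open>a \<noteq> b\<close> by auto
  then have 1: "yields B ?P s ?s" using yields_exec[of ?P B s] by simp
  have 2: "yields B (move c a b) ?s (?s(a := r, b := rev u @ ?s b))"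
    using Cons.prems by (intro Cons.IH) auto
  show ?case unfolding move_def
    by (rule yields_eq[OF yields_LoopT[OF _ _ 1 _ 2[unfolded move_def]]])
      (use Cons.prems \<open>a \<noteq> b\<close> in auto)
qed

definition shift :: "nat \<Rightarrow> nat \<Rightarrow> 'a smp_symbol prog" where
  "shift a b = move (\<lambda>x. x \<noteq> Blank) a b"

lemma yields_shift:
  assumes "a \<noteq> b" "word (s a)" "length (s a) \<le> B"
  shows "yields B (shift a b) s (s(a := [], b := rev (s a) @ s b))"
  unfolding shift_def by (rule yields_move) (use assms Blank_notin in auto)

text \<open>Stacks 11 to 14 are scratch space.\<close>

definition shift2 :: "nat \<Rightarrow> nat \<Rightarrow> 'a smp_symbol prog" where
  "shift2 a b = shift a 13 \<Zsemi> shift 13 b"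

lemma yields_shift2:
  assumes "a \<noteq> b" "a \<noteq> 13" "b \<noteq> 13" "s 13 = []" "word (s a)" "length (s a) \<le> B"
  shows "yields B (shift2 a b) s (s(a := [], b := s a @ s b))"
  unfolding shift2_def
  by (rule yields_eq[OF yields_Seq[OF yields_shift yields_shift]]) (use assms in auto)

definition copy :: "nat \<Rightarrow> nat \<Rightarrow> 'a smp_symbol prog" where
  "copy a b = shift a 13 \<Zsemi> repeat_while 13
     (emit cs a (\<lambda>g. g 13) \<Zsemi> emit cs b (\<lambda>g. g 13) \<Zsemi> Pop 13)"

lemma yields_copy:
  assumes "a \<noteq> b" "a \<noteq> 13" "b \<noteq> 13" "s 13 = []" "word (s a)" "length (s a) \<le> B"
  shows "yields B (copy a b) s (s(b := s a @ s b))"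
proof -
  let ?P = "emit cs a (\<lambda>g. g 13) \<Zsemi> emit cs b (\<lambda>g. g 13) \<Zsemi> Pop 13"
  have loop: "yields B (repeat_while 13 ?P) s (s(13 := [], a := rev (s 13) @ s a, b := rev (s 13) @ s b))"
    if "word (s 13)" "length (s 13) \<le> B" for s
    using that
  proof (induction "s 13" arbitrary: s)
    case Nil
    then show ?case unfolding repeat_while_def
      by (intro yields_eq[OF yields_LoopF]) auto
  next
    case (Cons x u)
    let ?s = "s(13 := u, a := x # s a, b := x # s b)"
    have x: "s 13 = x # u" using Cons.hyps(2) by simp
    have xc: "x \<in> set cs" using Cons.prems by (simp add: x)
    have "exec ?P s = ?s" using assms(1-3) x xc by auto
    then have 1: "yields B ?P s ?s" using yields_exec[of ?P B s] by simp
    have 2: "yields B (repeat_while 13 ?P) ?s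
        (?s(13 := [], a := rev (?s 13) @ ?s a, b := rev (?s 13) @ ?s b))"
      using Cons.prems x assms(2,3) by (intro Cons.hyps(1)) auto
    have "x \<noteq> Blank" using xc by auto
    then show ?case unfolding repeat_while_def
      by (intro yields_eq[OF yields_LoopT[OF _ _ 1 _ 2[unfolded repeat_while_def]]])
        (use Cons.prems x assms(1-3) in auto)
  qed
  show ?thesis unfolding copy_def
    by (rule yields_eq[OF yields_Seq[OF yields_shift loop]]) (use assms in auto)
qed

definition clear :: "nat \<Rightarrow> 'a smp_symbol prog" where
  "clear a = repeat_while a (Pop a)"

lemma yields_clear:
  assumes "word (s a)" "length (s a) \<le> B"
  shows "yields B (clear a) s (s(a := []))"
  using assms
proof (induction "s a" arbitrary: s)
  case Nil
  then show ?case unfolding repeat_while_def clear_def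
    by (intro yields_eq[OF yields_LoopF]) auto
next
  case (Cons x u)
  have x: "s a = x # u" using Cons.hyps(2) by simp
  then have "x \<noteq> Blank" using Cons.prems by auto
  moreover have 2: "yields B (clear a) (s(a := u)) ((s(a := u))(a := []))"
    using Cons.prems x by (intro Cons.hyps(1)) auto
  moreover have 1: "yields B (Pop a) s (s(a := u))" using yields_Pop[of B a s] x by simp
  ultimately show ?case unfolding clear_def repeat_while_def
    by (intro yields_eq[OF yields_LoopT[OF _ _ 1 _ 2[unfolded clear_def repeat_while_def]]])
      (use Cons.prems x in auto)
qed

definition pop_tuple :: "nat \<Rightarrow> nat \<Rightarrow> 'a smp_symbol prog" where
  "pop_tuple a b = move (\<lambda>x. x \<noteq> SEP) a 13 \<Zsemi> Pop a \<Zsemi> shift 13 b"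

lemma yields_pop_tuple:
  assumes "a \<noteq> b" "a \<noteq> 13" "b \<noteq> 13" "s 13 = []" "s a = map El t @ SEP # r" "set t \<subseteq> C"
    "length (s a) \<le> B"
  shows "yields B (pop_tuple a b) s (s(a := r, b := map El t @ s b))"
proof -
  have 1: "yields B (move (\<lambda>x. x \<noteq> SEP) a 13) s (s(a := SEP # r, 13 := rev (map El t) @ s 13))"
    by (rule yields_move) (use assms in auto)
  show ?thesis unfolding pop_tuple_def
    by (rule yields_eq[OF yields_Seq[OF 1 yields_Seq[OF yields_Pop yields_shift]]]) (use assms in auto)
qed

definition push_tuple :: "nat \<Rightarrow> nat \<Rightarrow> 'a smp_symbol prog" where
  "push_tuple a b = Push b SEP \<Zsemi> shift2 a b"

lemma yields_push_tuple:
  assumes "a \<noteq> b" "a \<noteq> 13" "b \<noteq> 13" "s 13 = []" "word (s a)" "length (s a) \<le> B"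
  shows "yields B (push_tuple a b) s (s(a := [], b := s a @ SEP # s b))"
  unfolding push_tuple_def
  by (rule yields_eq[OF yields_Seq[OF yields_Push yields_shift2]]) (use assms in auto)

text \<open>
  A transducer reads the first tuple of the list on stack \<open>a\<close> together with the tuple on stack
  \<open>v\<close>, and pushes its output on \<open>out\<close>. Its final mode is left on stack 11. With \<open>keep\<close>, the tuple
  on \<open>v\<close> is restored; otherwise \<open>out\<close> is \<open>v\<close> and the output replaces it.
\<close>

definition transducer_body ::
  "bool \<Rightarrow> (nat \<Rightarrow> 'a \<Rightarrow> 'a \<Rightarrow> nat) \<Rightarrow> (nat \<Rightarrow> 'a \<Rightarrow> 'a \<Rightarrow> 'a) \<Rightarrow> nat \<Rightarrow> nat \<Rightarrow> 'a smp_symbol prog" where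
  "transducer_body keep \<delta> f a v =
     emit cs 13 (\<lambda>g. El (f (sym_mode (g 11)) (sym_val (g a)) (sym_val (g v)))) \<Zsemi>
     emit cs 12 (\<lambda>g. Work (\<delta> (sym_mode (g 11)) (sym_val (g a)) (sym_val (g v)))) \<Zsemi>
     (if keep then emit cs 14 (\<lambda>g. g v) else Skip) \<Zsemi>
     Pop a \<Zsemi> Pop v \<Zsemi> Pop 11 \<Zsemi> emit cs 11 (\<lambda>g. g 12) \<Zsemi> Pop 12"

definition transducer ::
  "bool \<Rightarrow> (nat \<Rightarrow> 'a \<Rightarrow> 'a \<Rightarrow> nat) \<Rightarrow> (nat \<Rightarrow> 'a \<Rightarrow> 'a \<Rightarrow> 'a) \<Rightarrow> nat \<Rightarrow> nat \<Rightarrow> nat \<Rightarrow> 'a smp_symbol prog" where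
  "transducer keep \<delta> f a v out =
     Push 11 (Work 0) \<Zsemi> Loop (\<lambda>g. g a \<noteq> SEP) a (transducer_body keep \<delta> f a v) \<Zsemi>
     Pop a \<Zsemi> shift 13 out \<Zsemi> shift 14 v"

lemma yields_transducer_loop:
  assumes av: "a \<noteq> v" "a \<notin> {11, 12, 13, 14}" "v \<notin> {11, 12, 13, 14}"
    and \<delta>: "\<And>m x y. \<delta> m x y \<in> {0, 1, 2}"
    and "s a = map El t @ SEP # r" "s v = map El u" "s 11 = [Work m]" "s 12 = []"
    and "set t \<subseteq> C" "set u \<subseteq> C" "length t = length u" "length (s a) \<le> B"
    and "set (mealy_out \<delta> f m (zip t u)) \<subseteq> C"
  shows "yields B (Loop (\<lambda>g. g a \<noteq> SEP) a (transducer_body keep \<delta> f a v)) s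
    (s(a := SEP # r, v := [], 11 := [Work (mealy_mode \<delta> m (zip t u))],
       13 := rev (map El (mealy_out \<delta> f m (zip t u))) @ s 13,
       14 := (if keep then rev (map El u) @ s 14 else s 14)))"
  using assms(5-)
proof (induction t arbitrary: s u m)
  case Nil
  then show ?case by (intro yields_eq[OF yields_LoopF]) auto
next
  case (Cons x t)
  let ?P = "transducer_body keep \<delta> f a v"
  obtain y u' where u: "u = y # u'" using Cons.prems by (cases u) auto
  have xy: "x \<in> C" "y \<in> C" "f m x y \<in> C" "Work (\<delta> m x y) \<in> set cs"
    using Cons.prems u \<delta>[of m x y] by (auto simp: cs)
  let ?s = "s(a := map El t @ SEP # r, v := map El u', 11 := [Work (\<delta> m x y)],
    13 := El (f m x y) # s 13, 14 := (if keep then El y # s 14 else s 14))"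
  have "exec ?P s = ?s"
    using Cons.prems av xy unfolding u transducer_body_def by auto
  moreover have "loop_free ?P" by (simp add: transducer_body_def)
  ultimately have 1: "yields B ?P s ?s" using yields_exec[of ?P B s] by simp
  have 2: "yields B (Loop (\<lambda>g. g a \<noteq> SEP) a ?P) ?s
    (?s(a := SEP # r, v := [], 11 := [Work (mealy_mode \<delta> (\<delta> m x y) (zip t u'))],
       13 := rev (map El (mealy_out \<delta> f (\<delta> m x y) (zip t u'))) @ ?s 13,
       14 := (if keep then rev (map El u') @ ?s 14 else ?s 14)))"
    using Cons.prems av unfolding u by (intro Cons.IH) auto
  have "yields B (Loop (\<lambda>g. g a \<noteq> SEP) a ?P) s
    (?s(a := SEP # r, v := [], 11 := [Work (mealy_mode \<delta> (\<delta> m x y) (zip t u'))],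
       13 := rev (map El (mealy_out \<delta> f (\<delta> m x y) (zip t u'))) @ ?s 13,
       14 := (if keep then rev (map El u') @ ?s 14 else ?s 14)))"
    by (rule yields_LoopT[OF _ _ 1 _ 2]) (use Cons.prems av in auto)
  then show ?case
    by (rule yields_eq) (use av in \<open>auto simp: u\<close>)
qed

lemma yields_transducer:
  assumes av: "a \<noteq> v" "a \<notin> {11, 12, 13, 14}" "v \<notin> {11, 12, 13, 14}" "out \<notin> {11, 12, 13, 14}"
      "a \<noteq> out" "keep \<longleftrightarrow> out \<noteq> v"
    and \<delta>: "\<And>m x y. \<delta> m x y \<in> {0, 1, 2}"
    and s: "s a = map El t @ SEP # r" "s v = map El u" "s 11 = []" "s 12 = []" "s 13 = []" "s 14 = []"
    and tu: "set t \<subseteq> C" "set u \<subseteq> C" "length t = length u" "length (s a) \<le> B"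
    and out: "set (mealy_out \<delta> f 0 (zip t u)) \<subseteq> C"
  shows "yields B (transducer keep \<delta> f a v out) s
    (s(a := r, 11 := [Work (mealy_mode \<delta> 0 (zip t u))],
       out := map El (mealy_out \<delta> f 0 (zip t u)) @ (if keep then s out else [])))"
proof -
  let ?s0 = "s(11 := Work 0 # s 11)"
  let ?w = "map El (mealy_out \<delta> f 0 (zip t u))"
  let ?s1 = "?s0(a := SEP # r, v := [], 11 := [Work (mealy_mode \<delta> 0 (zip t u))],
       13 := rev ?w @ ?s0 13, 14 := (if keep then rev (map El u) @ ?s0 14 else ?s0 14))"
  have 1: "yields B (Loop (\<lambda>g. g a \<noteq> SEP) a (transducer_body keep \<delta> f a v)) ?s0 ?s1"
    by (rule yields_transducer_loop[OF av(1-3) \<delta>]) (use assms in auto)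
  have len: "length ?w \<le> B" "length u \<le> B" using s(1) tu(3,4) by simp_all
  let ?s2 = "?s1(a := r)"
  let ?s3 = "?s2(13 := [], out := ?w @ ?s2 out)"
  have 2: "yields B (shift 13 out) ?s2 ?s3"
    by (rule yields_eq[OF yields_shift]) (use av out len s in auto)
  have 3: "yields B (shift 14 v) ?s3 (s(a := r, 11 := [Work (mealy_mode \<delta> 0 (zip t u))],
      out := ?w @ (if keep then s out else [])))"
    by (rule yields_eq[OF yields_shift]) (use av tu len s in auto)
  have 4: "yields B (Pop a) ?s1 ?s2" by (rule yields_eq[OF yields_Pop]) (use av in auto)
  show ?thesis unfolding transducer_def
    by (rule yields_Seq[OF yields_Push yields_Seq[OF 1 yields_Seq[OF 4 yields_Seq[OF 2 3]]]])
qed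

end


section \<open>The membership program\<close>

locale smp_prog = nil_ext_clifford S I k d r + tuple_stacks "carrier S" cs
  for S :: "'a sgrp" (structure) and I k d r cs
begin

abbreviation C :: "'a set" where "C \<equiv> carrier S"

text \<open>
  Stack 0 holds the input, 1 the current list of tuples, 2 the tuple \<open>b\<close>, 3 to 5 copies of the
  list that are consumed by loops, 6 and 7 single tuples, 8 a list under construction, 9 and 10
  loop counters, 15 the marks for acceptance and 16 those for tuples of wrong length.
\<close>

definition scratch :: "'a smp_symbol stacks \<Rightarrow> bool" where
  "scratch s \<longleftrightarrow> s 11 = [] \<and> s 12 = [] \<and> s 13 = [] \<and> s 14 = []"

lemma scratch_upd [simp]: "v \<notin> {11, 12, 13, 14} \<Longrightarrow> scratch (s(v := xs)) \<longleftrightarrow> scratch s"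
  by (auto simp: scratch_def)

lemma scratch_13 [simp]: "scratch s \<Longrightarrow> s 13 = []"
  and scratch_11 [simp]: "scratch s \<Longrightarrow> s 11 = []"
  and scratch_12 [simp]: "scratch s \<Longrightarrow> s 12 = []"
  and scratch_14 [simp]: "scratch s \<Longrightarrow> s 14 = []"
  by (auto simp: scratch_def)

lemma tuplesD: "t \<in> tuples n A \<Longrightarrow> length t = n" "t \<in> tuples n A \<Longrightarrow> set t \<subseteq> A"
  by (auto simp: tuples_def)

lemma yields_stateless:
  assumes "a \<noteq> v" "a \<notin> {11, 12, 13, 14}" "v \<notin> {11, 12, 13, 14}" "out \<notin> {11, 12, 13, 14}"
      "a \<noteq> out" "out \<noteq> v" "scratch s"
    and "s a = map El t @ SEP # r'" "s v = map El u" "t \<in> tuples n C" "u \<in> tuples n C" "length (s a) \<le> B"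
    and "map2 f t u \<in> tuples n C"
  shows "yields B (transducer True (test_mode Q) (\<lambda>_. f) a v out) s
    (s(a := r', 11 := [Work (if list_all2 Q t u then 0 else 1)], out := map El (map2 f t u) @ s out))"
  by (rule yields_eq[OF yields_transducer[where t = t and u = u and r = r']])
    (use assms in \<open>auto simp: mealy_out_stateless mealy_mode_test test_mode_def tuples_def\<close>)

lemma yields_replace:
  assumes "a \<noteq> v" "a \<notin> {11, 12, 13, 14}" "v \<notin> {11, 12, 13, 14}" "scratch s"
    and \<delta>: "\<And>m x y. \<delta> m x y \<in> {0, 1, 2}"
    and "s a = map El t @ SEP # r'" "s v = map El u" "t \<in> tuples n C" "u \<in> tuples n C" "length (s a) \<le> B"
    and "mealy_out \<delta> f 0 (zip t u) \<in> tuples n C"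
  shows "yields B (transducer False \<delta> f a v v \<Zsemi> Pop 11) s
    (s(a := r', v := map El (mealy_out \<delta> f 0 (zip t u))))"
  by (rule yields_eq[OF yields_Seq[OF yields_transducer[where t = t and u = u and r = r'] yields_Pop]])
    (use assms in \<open>auto simp: tuples_def fun_eq_iff\<close>)

section \<open>Programs for block products, direct membership and relevant tuples\<close>

lemma mul_tuples: "t \<in> tuples n C \<Longrightarrow> u \<in> tuples n C \<Longrightarrow> map2 (\<cdot>) t u \<in> tuples n C"
  by (auto simp: tuples_iff S_closed)

definition test_true :: "'a \<Rightarrow> 'a \<Rightarrow> bool" where "test_true a c = True"

abbreviation mul_transducer :: "nat \<Rightarrow> nat \<Rightarrow> nat \<Rightarrow> 'a smp_symbol prog" where
  "mul_transducer \<equiv> transducer True (test_mode test_true) (\<lambda>_ a c. a \<cdot> c)"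

abbreviation test_transducer :: "('a \<Rightarrow> 'a \<Rightarrow> bool) \<Rightarrow> nat \<Rightarrow> nat \<Rightarrow> nat \<Rightarrow> 'a smp_symbol prog" where
  "test_transducer Q \<equiv> transducer True (test_mode Q) (\<lambda>_ a c. a)"

definition square_prog :: "'a smp_symbol prog" where
  "square_prog = copy 1 3 \<Zsemi>
     repeat_while 3 (pop_tuple 3 6 \<Zsemi> copy 1 4 \<Zsemi>
       repeat_while 4 (Push 8 SEP \<Zsemi> mul_transducer 4 6 8 \<Zsemi> Pop 11) \<Zsemi>
       clear 6) \<Zsemi>
     shift2 8 1"

lemma yields_square:
  assumes L: "set L \<subseteq> tuples n C" and B: "length (square_list S L) * (n + 1) \<le> B"
    and s: "s 1 = enc L" "s 3 = []" "s 4 = []" "s 6 = []" "s 8 = []" "scratch s"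
  shows "yields B square_prog s (s(1 := enc (square_list S L)))"
proof -
  let ?Q = "Push 8 SEP \<Zsemi> mul_transducer 4 6 8 \<Zsemi> Pop 11"
  let ?f = "\<lambda>u. fold (\<lambda>t A. map2 (\<cdot>) t u # A) L"
  have sqT: "set (square_list S L) \<subseteq> tuples n C"
    using L mul_tuples by (auto simp: square_list_facts subset_iff)
  have encsq: "length (enc (square_list S L)) \<le> B" using B length_enc[OF sqT] by simp
  then have encL: "length (enc L) \<le> B" by (simp add: square_list_def)
  have encF: "length (enc (fold ?f L [])) \<le> B" "set (fold ?f L []) \<subseteq> tuples n C"
    using encsq sqT by (simp_all add: square_list_def)
  have inner: "yields B (repeat_while 4 ?Q) (s(4 := enc L, 8 := enc A)) (s(4 := [], 8 := enc (?f u A)))"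
    if u: "u \<in> tuples n C" and s: "s 6 = map El u" "scratch s" for s u A
  proof -
    let ?st = "\<lambda>ts A. s(4 := enc ts, 8 := enc A)"
    let ?Inv = "\<lambda>ts A. set ts \<subseteq> tuples n C \<and> length (enc ts) \<le> B"
    have "yields B (repeat_while 4 ?Q)
        (?st L A) (?st [] (fold (\<lambda>t A. map2 (\<cdot>) t u # A) L A)) \<and>
        ?Inv [] (fold (\<lambda>t A. map2 (\<cdot>) t u # A) L A)"
    proof (rule yields_foreach[where Inv = ?Inv])
      fix t ts A assume inv: "?Inv (t # ts) A"
      then have t: "t \<in> tuples n C" by simp
      let ?s1 = "?st (t # ts) A"
      let ?s2 = "?s1(8 := SEP # ?s1 8)"
      have "yields B (Push 8 SEP) ?s1 ?s2" by (rule yields_Push)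
      moreover have "yields B (mul_transducer 4 6 8) ?s2
          (?s2(4 := enc ts, 11 := [Work (if list_all2 test_true t u then 0 else 1)],
            8 := map El (map2 (\<cdot>) t u) @ ?s2 8))"
        by (rule yields_stateless[where n = n]) (use t u s inv mul_tuples[OF t u] in auto)
      ultimately have "yields B ?Q ?s1 (?st ts (map2 (\<cdot>) t u # A))"
        by (intro yields_eq[OF yields_Seq[OF _ yields_Seq[OF _ yields_Pop]]]) (use s in auto)
      then show "yields B ?Q ?s1 (?st ts (map2 (\<cdot>) t u # A)) \<and>
          ?Inv ts (map2 (\<cdot>) t u # A)" using inv by simp
    qed (use L encL in auto)
    then show ?thesis by simp
  qed
  let ?P = "pop_tuple 3 6 \<Zsemi> copy 1 4 \<Zsemi>
       repeat_while 4 ?Q \<Zsemi>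
       clear 6"
  let ?st = "\<lambda>ts A. s(3 := enc ts, 8 := enc A)"
  let ?Inv = "\<lambda>ts A. set ts \<subseteq> tuples n C \<and> length (enc ts) \<le> B"
  have outer: "yields B (repeat_while 3 ?P) (?st L []) (?st [] (fold ?f L [])) \<and> ?Inv [] (fold ?f L [])"
  proof (rule yields_foreach[where Inv = ?Inv])
    fix u ts A assume inv: "?Inv (u # ts) A"
    then have u: "u \<in> tuples n C" and ul: "length u \<le> B" by simp_all
    let ?s1 = "s(3 := enc ts, 8 := enc A, 6 := map El u)"
    have 1: "yields B (pop_tuple 3 6) (?st (u # ts) A) ?s1"
      by (rule yields_eq[OF yields_pop_tuple[where t = u and r = "enc ts"]])
        (use inv s tuplesD[OF u] in auto)
    have 2: "yields B (copy 1 4) ?s1 (?s1(4 := enc L, 8 := enc A))"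
      by (rule yields_eq[OF yields_copy]) (use s encL L in auto)
    have 3: "yields B (repeat_while 4 ?Q)
        (?s1(4 := enc L, 8 := enc A)) (?s1(4 := [], 8 := enc (?f u A)))"
      by (rule inner[OF u]) (use s in auto)
    have 4: "yields B (clear 6) (?s1(4 := [], 8 := enc (?f u A))) (?st ts (?f u A))"
      by (rule yields_eq[OF yields_clear]) (use s ul tuplesD[OF u] in auto)
    show "yields B ?P (?st (u # ts) A) (?st ts (?f u A)) \<and> ?Inv ts (?f u A)"
      using yields_Seq[OF 1 yields_Seq[OF 2 yields_Seq[OF 3 4]]] inv by simp
  qed (use L encL in auto)
  have c: "yields B (copy 1 3) s (?st L [])"
    by (rule yields_eq[OF yields_copy]) (use s encL L in auto)
  have f: "yields B (shift2 8 1) (?st [] (fold ?f L [])) (s(1 := enc (square_list S L)))"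
    by (rule yields_eq[OF yields_shift2]) (use s encF in \<open>auto simp: square_list_def\<close>)
  show ?thesis unfolding square_prog_def
    using yields_Seq[OF c yields_Seq[OF conjunct1[OF outer] f]] .
qed

lemma yields_squares:
  assumes L: "set L \<subseteq> tuples n C" and B: "\<And>i. i \<le> j \<Longrightarrow> length ((square_list S ^^ i) L) * (n + 1) \<le> B"
    and s: "s 1 = enc L" "s 3 = []" "s 4 = []" "s 6 = []" "s 8 = []" "scratch s"
  shows "yields B (seqn j square_prog) s (s(1 := enc ((square_list S ^^ j) L))) \<and>
    set ((square_list S ^^ j) L) \<subseteq> tuples n C"
  using B
proof (induction j)
  case 0
  then show ?case using s L by (auto intro!: yields_eq[OF yields_Skip])
next
  case (Suc j)
  let ?L = "(square_list S ^^ j) L"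
  have "yields B (seqn j square_prog) s (s(1 := enc ?L)) \<and> set ?L \<subseteq> tuples n C"
    by (rule Suc.IH) (rule Suc.prems, simp)
  note IH = conjunct1[OF this] conjunct2[OF this]
  have "yields B square_prog (s(1 := enc ?L)) ((s(1 := enc ?L))(1 := enc (square_list S ?L)))"
    using Suc.prems[of "Suc j"] IH(2) s by (intro yields_square) auto
  then have "yields B (seqn (Suc j) square_prog) s (s(1 := enc ((square_list S ^^ Suc j) L)))"
    using yields_Seq[OF IH(1)] by simp
  moreover have "set ((square_list S ^^ Suc j) L) \<subseteq> tuples n C"
    using IH(2) mul_tuples by (auto simp: square_list_facts subset_iff)
  ultimately show ?case by (rule conjI)
qed

definition member_prog :: "'a smp_symbol prog" where
  "member_prog = copy 1 3 \<Zsemi>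
     repeat_while 3 (test_transducer (=) 3 2 7 \<Zsemi> clear 7 \<Zsemi>
       Cond (\<lambda>g. g 11 = Work 0) (Push 15 (Work 0)) Skip \<Zsemi> Pop 11)"

lemma map2_fst: "length t = length u \<Longrightarrow> map2 (\<lambda>a c. a) t u = t"
  by (induction t u rule: list_induct2) auto

lemma yields_member:
  assumes L: "set L \<subseteq> tuples n C" and b: "b \<in> tuples n C" and B: "length L * (n + 1) \<le> B"
    and s: "s 1 = enc L" "s 2 = map El b" "s 3 = []" "s 7 = []" "scratch s"
  shows "yields B member_prog s (s(15 := fold (\<lambda>t F. if t = b then Work 0 # F else F) L (s 15)))"
proof -
  let ?P = "test_transducer (=) 3 2 7 \<Zsemi> clear 7 \<Zsemi>
       Cond (\<lambda>g. g 11 = Work 0) (Push 15 (Work 0)) Skip \<Zsemi> Pop 11"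
  let ?f = "\<lambda>t F. if t = b then Work 0 # F else F"
  let ?st = "\<lambda>ts F. s(3 := enc ts, 15 := F)"
  let ?Inv = "\<lambda>ts F. set ts \<subseteq> tuples n C \<and> length (enc ts) \<le> B"
  have encL: "length (enc L) \<le> B" using B length_enc[OF L] by simp
  have loop: "yields B (repeat_while 3 ?P) (?st L (s 15)) (?st [] (fold ?f L (s 15))) \<and>
      ?Inv [] (fold ?f L (s 15))"
  proof (rule yields_foreach[where Inv = ?Inv])
    fix t ts F assume inv: "?Inv (t # ts) F"
    then have t: "t \<in> tuples n C" and tl: "length t \<le> B" by simp_all
    have tb: "length t = length b" using tuplesD t b by metis
    let ?s1 = "s(3 := enc ts, 15 := F, 11 := [Work (if t = b then 0 else 1)], 7 := map El t)"
    let ?s2 = "?s1(7 := [])"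
    let ?s3 = "?s2(15 := ?f t F)"
    have 1: "yields B (test_transducer (=) 3 2 7) (?st (t # ts) F) ?s1"
      by (rule yields_eq[OF yields_stateless[where t = t and u = b and r' = "enc ts" and n = n]])
        (use inv t b s tb in \<open>auto simp: map2_fst list.rel_eq\<close>)
    have 2: "yields B (clear 7) ?s1 ?s2"
      by (rule yields_clear) (use tl tuplesD[OF t] in auto)
    have 3: "yields B (Cond (\<lambda>g. g 11 = Work 0) (Push 15 (Work 0)) Skip) ?s2 ?s3"
      by (rule yields_eq[OF yields_exec]) auto
    have 4: "yields B (Pop 11) ?s3 (?st ts (?f t F))"
      by (rule yields_eq[OF yields_Pop]) (use s in auto)
    show "yields B ?P (?st (t # ts) F) (?st ts (?f t F)) \<and> ?Inv ts (?f t F)"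
      using yields_Seq[OF 1 yields_Seq[OF 2 yields_Seq[OF 3 4]]] inv by simp
  qed (use L encL in auto)
  have c: "yields B (copy 1 3) s (?st L (s 15))"
    by (rule yields_eq[OF yields_copy]) (use s encL L in auto)
  show ?thesis unfolding member_prog_def
    by (rule yields_eq[OF yields_Seq[OF c conjunct1[OF loop]]]) (use s in auto)
qed

text \<open>Marks are pushed and never removed, so a search over a list can be read off from whether
  the stack has changed.\<close>

lemma fold_marks: "fold (\<lambda>t F. if Q t then x # F else F) L F = F \<longleftrightarrow> (\<forall>t \<in> set L. \<not> Q t)"
proof -
  have "\<exists>m. fold (\<lambda>t F. if Q t then x # F else F) L F = replicate m x @ F \<and>
      (m = 0 \<longleftrightarrow> (\<forall>t \<in> set L. \<not> Q t))" for F
  proof (induction L rule: rev_induct)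
    case (snoc t L)
    then obtain m where "fold (\<lambda>t F. if Q t then x # F else F) L F = replicate m x @ F"
      "m = 0 \<longleftrightarrow> (\<forall>t \<in> set L. \<not> Q t)" by blast
    then show ?case by (intro exI[of _ "if Q t then Suc m else m"]) auto
  qed simp
  from this[of F] show ?thesis by auto
qed

definition relevant_prog :: "'a smp_symbol prog" where
  "relevant_prog = repeat_while 1
     (test_transducer (\<lambda>x y. x \<in> I \<and> y \<in> I \<and> idp y \<cdot> idp x = idp y) 1 2 7 \<Zsemi>
      Cond (\<lambda>g. g 11 = Work 0) (push_tuple 7 8) (clear 7) \<Zsemi> Pop 11)"

lemma yields_relevant:
  assumes L: "set L \<subseteq> tuples n C" and b: "b \<in> tuples n C" and B: "length L * (n + 1) \<le> B"
    and s: "s 1 = enc L" "s 2 = map El b" "s 7 = []" "s 8 = []" "scratch s"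
  shows "yields B relevant_prog s (s(1 := [], 8 := enc (relevant_list b L)))"
proof -
  let ?Q = "\<lambda>x y. x \<in> I \<and> y \<in> I \<and> idp y \<cdot> idp x = idp y"
  let ?P = "test_transducer ?Q 1 2 7 \<Zsemi>
      Cond (\<lambda>g. g 11 = Work 0) (push_tuple 7 8) (clear 7) \<Zsemi> Pop 11"
  let ?f = "\<lambda>c G. if relevant b c then c # G else G"
  let ?st = "\<lambda>ts G. s(1 := enc ts, 8 := enc G)"
  let ?Inv = "\<lambda>ts G. set ts \<subseteq> tuples n C \<and> length (enc ts) \<le> B"
  have encL: "length (enc L) \<le> B" using B length_enc[OF L] by simp
  have "yields B (repeat_while 1 ?P) (?st L []) (?st [] (fold ?f L [])) \<and> ?Inv [] (fold ?f L [])"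
  proof (rule yields_foreach[where Inv = ?Inv])
    fix t ts G assume inv: "?Inv (t # ts) G"
    then have t: "t \<in> tuples n C" and tl: "length t \<le> B" by simp_all
    have tb: "length t = length b" using tuplesD t b by metis
    let ?s1 = "s(1 := enc ts, 8 := enc G, 11 := [Work (if relevant b t then 0 else 1)], 7 := map El t)"
    let ?s2 = "s(1 := enc ts, 11 := [Work (if relevant b t then 0 else 1)], 8 := enc (?f t G))"
    have 1: "yields B (test_transducer ?Q 1 2 7) (?st (t # ts) G) ?s1"
      by (rule yields_eq[OF yields_stateless[where t = t and u = b and r' = "enc ts" and n = n]])
        (use inv t b s tb in \<open>auto simp: map2_fst relevant_def\<close>)
    have 2: "yields B (Cond (\<lambda>g. g 11 = Work 0) (push_tuple 7 8) (clear 7)) ?s1 ?s2"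
    proof (cases "relevant b t")
      case True
      then show ?thesis
        by (intro yields_CondT yields_eq[OF yields_push_tuple])
          (use tl tuplesD[OF t] s in auto)
    next
      case False
      then show ?thesis
        by (intro yields_CondF yields_eq[OF yields_clear])
          (use tl tuplesD[OF t] s in auto)
    qed
    have 3: "yields B (Pop 11) ?s2 (?st ts (?f t G))"
      by (rule yields_eq[OF yields_Pop]) (use s in auto)
    show "yields B ?P (?st (t # ts) G) (?st ts (?f t G)) \<and> ?Inv ts (?f t G)"
      using yields_Seq[OF 1 yields_Seq[OF 2 3]] inv by simp
  qed (use L encL in auto)
  moreover have "?st L [] = s" using s by auto
  ultimately show ?thesis by (simp add: relevant_prog_def relevant_list_def)
qed

end


section \<open>Sifting by stack programs\<close>

context smp_prog
begin

text \<open>The scan decides \<open>match\<close> while it already produces the output. In mode 0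
  all pairs so far were trivial, in mode 1 the leads agreed and the rest is divided, in mode 2 they
  differed and the rest is copied. If just one entry is trivial, the entries are unequal, so
  comparing them is enough.\<close>

definition red_mode :: "nat \<Rightarrow> 'a \<Rightarrow> 'a \<Rightarrow> nat" where
  "red_mode m a c =
     (if m = 0 then (if idp a = a \<and> idp c = c then 0 else if a = c then 1 else 2)
      else if m = 1 then 1 else 2)"

definition red_out :: "nat \<Rightarrow> 'a \<Rightarrow> 'a \<Rightarrow> 'a" where
  "red_out m a c = (if m = 1 \<or> (m = 0 \<and> a = c) then iv a \<cdot> c else c)"

lemma ld_Cons: "ld (a # t) = (if idp a = a then Suc (ld t) else 0)"
  by (simp add: ld_def)

lemma mealy_red:
  assumes "list_all2 (\<lambda>a c. a \<in> I \<and> c \<in> I \<and> idp a = idp c) t x"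
  shows "mealy_out red_mode red_out 0 (zip t x) = red t x"
proof -
  have 1: "mealy_out red_mode red_out (Suc 0) ps = map (\<lambda>(a, c). iv a \<cdot> c) ps" for ps
    by (induction ps) (auto simp: red_mode_def red_out_def)
  have 2: "mealy_out red_mode red_out 2 ps = map snd ps" for ps
    by (induction ps) (auto simp: red_mode_def red_out_def)
  show ?thesis using assms
  proof (induction rule: list_all2_induct)
    case Nil
    then show ?case by (simp add: red_def match_def)
  next
    case (Cons a t c x)
    have len: "length t = length x" using Cons.hyps(2) by (rule list_all2_lengthD)
    have ac: "a \<in> I" "c \<in> I" "idp a = idp c" using Cons.hyps(1) by auto
    show ?case
    proof (cases "idp a = a \<and> idp c = c")
      case True
      \<comment> \<open>Both entries are the identity of the same maximal subgroup.\<close>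
      then have eq: "c = a" using ac(3) by metis
      have "iv a \<cdot> a = a" using ac True by (simp add: iv_left)
      moreover have "match (a # t) (a # x) \<longleftrightarrow> match t x"
        using True by (auto simp: match_def ld_Cons)
      ultimately show ?thesis
        using True Cons.IH by (auto simp: red_mode_def[of 0] red_out_def[of 0] red_def eq)
    next
      case False
      show ?thesis
      proof (cases "a = c")
        case True
        then have "match (a # t) (c # x)" using False by (auto simp: match_def ld_Cons)
        then show ?thesis using False True 1 by (simp add: red_mode_def[of 0] red_out_def[of 0] red_def)
      next
        case neq: False
        then have "\<not> match (a # t) (c # x)"
          using False by (auto simp: match_def ld_Cons split: if_splits)
        then show ?thesis using False neq 2 len by (auto simp: red_mode_def[of 0] red_out_def[of 0] red_def)
      qed
    qed
  qed
qed

definition sift_prog :: "'a smp_symbol prog" where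
  "sift_prog = copy 2 10 \<Zsemi> repeat_while 10 (Pop 10 \<Zsemi> copy 1 5 \<Zsemi>
     repeat_while 5 (transducer False red_mode red_out 5 7 7 \<Zsemi> Pop 11))"

text \<open>A transducer takes its first argument from an encoded list, so the tuple passes through
  stack 5 and is output unchanged to stack 7; \<open>b\<close> only serves as a partner of equal
  length.\<close>

definition trivial_prog :: "'a smp_symbol prog" where
  "trivial_prog = push_tuple 7 5 \<Zsemi>
     test_transducer (\<lambda>a _. idp a = a) 5 2 7"

definition sift_add_prog :: "'a smp_symbol prog" where
  "sift_add_prog = sift_prog \<Zsemi> trivial_prog \<Zsemi>
     Cond (\<lambda>g. g 11 = Work 0) (clear 7) (push_tuple 7 1) \<Zsemi> Pop 11"

definition sift_row_prog :: "'a smp_symbol prog" where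
  "sift_row_prog = copy 1 4 \<Zsemi> repeat_while 4
     (mul_transducer 4 6 7 \<Zsemi> Pop 11 \<Zsemi> sift_add_prog)"

definition sift_round_prog :: "'a smp_symbol prog" where
  "sift_round_prog = copy 1 3 \<Zsemi> repeat_while 3 (pop_tuple 3 6 \<Zsemi> sift_row_prog \<Zsemi> clear 6)"

text \<open>One copy of \<open>b\<close> accounts for \<open>n\<close> rounds; the constant factor
  is unrolled.\<close>

definition sift_rounds_prog :: "'a smp_symbol prog" where
  "sift_rounds_prog = seqn (Suc (card I))
     (copy 2 9 \<Zsemi> repeat_while 9 (Pop 9 \<Zsemi> sift_round_prog))"

end

text \<open>By \<open>sift_inv_length\<close>, the height bound covers every list that can arise
  during sifting.\<close>

locale sift_stage = smp_prog S I k d r cs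
  for S :: "'a sgrp" (structure) and I k d r cs +
  fixes n :: nat and b :: "'a list" and L0 :: "'a list list" and B :: nat
  assumes bI: "b \<in> tuples n I" and L0: "set L0 \<subseteq> power_group.H S I k n (map idp b)" "map idp b \<in> set L0"
    and B: "(length L0 + n * card I) * (n + 1) \<le> B"
begin

sublocale G: power_group S I k n "map idp b"
  by (rule power_group_idp[OF bI])

lemma b_C: "b \<in> tuples n C"
  using bI I_sub by (auto simp: tuples_def)

lemma H_C: "x \<in> G.H \<Longrightarrow> x \<in> tuples n C"
  using I_sub by (auto simp: tuples_iff)

lemma Suc_n_B: "n + 1 \<le> B"
proof -
  have "1 * (n + 1) \<le> (length L0 + n * card I) * (n + 1)"
    using L0(2) by (intro mult_mono) (auto simp: Suc_le_eq)
  then show ?thesis using B by simp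
qed

lemma n_B: "n \<le> B"
  using Suc_n_B by simp

lemma H_len_B: "x \<in> G.H \<Longrightarrow> length x \<le> B"
  using n_B by simp

lemma H_set: "x \<in> G.H \<Longrightarrow> set x \<subseteq> C"
  using tuplesD(2)[OF H_C] .

abbreviation Inv :: "'a list list \<Rightarrow> bool" where
  "Inv L \<equiv> G.sift_inv L0 L"

lemma Inv_H: "Inv L \<Longrightarrow> set L \<subseteq> G.H"
  using G.sift_inv_H L0 by blast

lemma Inv_C: "Inv L \<Longrightarrow> set L \<subseteq> tuples n C"
  using Inv_H H_C by blast

lemma Inv_B: "Inv L \<Longrightarrow> length (enc L) \<le> B"
proof -
  assume L: "Inv L"
  have "length L * (n + 1) \<le> (length L0 + n * card I) * (n + 1)"
    using G.sift_inv_length[OF L0 L] by (rule mult_right_mono) simp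
  then show ?thesis using B length_enc[OF Inv_C[OF L]] by simp
qed

lemma yields_pass:
  assumes L: "Inv L" and x: "x \<in> G.H"
    and s: "s 1 = enc L" "s 7 = map El x" "s 5 = []" "scratch s"
  shows "yields B (copy 1 5 \<Zsemi> repeat_while 5 (transducer False red_mode red_out 5 7 7 \<Zsemi> Pop 11))
    s (s(7 := map El (pass L x)))"
proof -
  let ?st = "\<lambda>ts y. s(5 := enc ts, 7 := map El y)"
  let ?P = "transducer False red_mode red_out 5 7 7 \<Zsemi> Pop 11"
  let ?Inv = "\<lambda>ts y. set ts \<subseteq> G.H \<and> length (enc ts) \<le> B \<and> y \<in> G.H"
  have loop: "yields B (repeat_while 5 ?P) (?st L x) (?st [] (fold red L x)) \<and> ?Inv [] (fold red L x)"
  proof (rule yields_foreach[where Inv = ?Inv])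
    fix t ts y assume inv: "?Inv (t # ts) y"
    then have t: "t \<in> G.H" and y: "y \<in> G.H" by auto
    have "list_all2 (\<lambda>a c. a \<in> I \<and> c \<in> I \<and> idp a = idp c) t y"
      using t y G.H_idp[OF t] G.H_idp[OF y] by (auto simp: list_all2_conv_all_nth)
    then have out: "mealy_out red_mode red_out 0 (zip t y) = red t y" by (rule mealy_red)
    have "yields B ?P (?st (t # ts) y) ((?st (t # ts) y)(5 := enc ts,
        7 := map El (mealy_out red_mode red_out 0 (zip t y))))"
      by (rule yields_replace[where t = t and u = y and n = n])
        (use s inv H_C[OF t] H_C[OF y] H_C[OF G.red_H[OF t y]] in \<open>auto simp: red_mode_def out\<close>)
    then show "yields B ?P (?st (t # ts) y) (?st ts (red t y)) \<and> ?Inv ts (red t y)"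
      using inv G.red_H[OF t y] by (auto elim!: yields_eq simp: fun_eq_iff out)
  qed (use Inv_H[OF L] Inv_B[OF L] x in auto)
  have c: "yields B (copy 1 5) s (?st L x)"
    by (rule yields_eq[OF yields_copy])
      (use s Inv_B[OF L] word_enc[OF Inv_C[OF L]] in auto)
  show ?thesis
    by (rule yields_eq[OF yields_Seq[OF c conjunct1[OF loop]]])
      (use s in \<open>auto simp: pass_def\<close>)
qed

lemma yields_sift:
  assumes L: "Inv L" and x: "x \<in> G.H"
    and s: "s 1 = enc L" "s 2 = map El b" "s 7 = map El x" "s 5 = []" "s 10 = []" "scratch s"
  shows "yields B sift_prog s (s(7 := map El (sift n L x)))"
proof -
  let ?st = "\<lambda>xs y. s(10 := xs, 7 := map El y)"
  let ?P = "copy 1 5 \<Zsemi> repeat_while 5 (transducer False red_mode red_out 5 7 7 \<Zsemi> Pop 11)"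
  have len: "length b = n" using tuplesD(1)[OF bI] .
  have loop: "yields B (repeat_while 10 (Pop 10 \<Zsemi> ?P)) (?st (map El b) x)
      (?st [] ((pass L ^^ length (map El b)) x)) \<and> (pass L ^^ length (map El b)) x \<in> G.H"
  proof (rule yields_repeat)
    fix xs y assume y: "y \<in> G.H"
    have "yields B ?P (?st xs y) ((?st xs y)(7 := map El (pass L y)))"
      by (rule yields_pass[OF L y]) (use s in auto)
    then show "yields B ?P (?st xs y) (?st xs (pass L y)) \<and> pass L y \<in> G.H"
      using G.pass_progress[OF Inv_H[OF L] y] by simp
  qed (use x n_B len in auto)
  have c: "yields B (copy 2 10) s (?st (map El b) x)"
    by (rule yields_eq[OF yields_copy])
      (use s n_B len tuplesD(2)[OF b_C] in auto)
  show ?thesis unfolding sift_prog_def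
    by (rule yields_eq[OF yields_Seq[OF c conjunct1[OF loop]]])
      (use s len in \<open>auto simp: sift_def\<close>)
qed

lemma yields_trivial:
  assumes x: "x \<in> G.H" and s: "s 2 = map El b" "s 7 = map El x" "s 5 = []" "scratch s"
  shows "yields B trivial_prog s (s(11 := [Work (if list_all (\<lambda>a. idp a = a) x then 0 else 1)]))"
proof -
  let ?s1 = "s(7 := [], 5 := map El x @ SEP # [])"
  have 1: "yields B (push_tuple 7 5) s ?s1"
    by (rule yields_eq[OF yields_push_tuple])
      (use s H_set[OF x] H_len_B[OF x] in auto)
  have len: "length b = length x" using x tuplesD(1)[OF bI] by simp
  have l: "list_all2 (\<lambda>a c. idp a = a) x b \<longleftrightarrow> list_all (\<lambda>a. idp a = a) x"
    using len by (auto simp: list_all2_conv_all_nth list_all_length)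
  have 2: "yields B (test_transducer (\<lambda>a _. idp a = a) 5 2 7) ?s1
    (?s1(5 := [], 11 := [Work (if list_all2 (\<lambda>a _. idp a = a) x b then 0 else 1)],
      7 := map El (map2 (\<lambda>a c. a) x b) @ ?s1 7))"
    by (rule yields_stateless[where n = n])
      (use s Suc_n_B b_C H_C[OF x] len x in \<open>auto simp: map2_fst\<close>)
  show ?thesis unfolding trivial_prog_def
    by (rule yields_eq[OF yields_Seq[OF 1 2]])
      (use s len in \<open>auto simp: map2_fst l\<close>)
qed

lemma yields_sift_add:
  assumes L: "Inv L" and x: "x \<in> G.H"
    and s: "s 1 = enc L" "s 2 = map El b" "s 7 = map El x" "s 5 = []" "s 10 = []" "scratch s"
  shows "yields B sift_add_prog s (s(7 := [], 1 := enc (sift_add n x L)))"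
proof -
  let ?y = "sift n L x"
  have y: "?y \<in> G.H" using G.sift_H[OF Inv_H[OF L] x] .
  let ?s1 = "s(7 := map El ?y)"
  let ?s2 = "?s1(11 := [Work (if list_all (\<lambda>a. idp a = a) ?y then 0 else 1)])"
  let ?s3 = "?s2(7 := [], 1 := enc (sift_add n x L))"
  have 1: "yields B sift_prog s ?s1" by (rule yields_sift[OF L x s])
  have 2: "yields B trivial_prog ?s1 ?s2" by (rule yields_trivial[OF y]) (use s in auto)
  have 3: "yields B (Cond (\<lambda>g. g 11 = Work 0) (clear 7) (push_tuple 7 1)) ?s2 ?s3"
  proof (cases "list_all (\<lambda>a. idp a = a) ?y")
    case True
    then show ?thesis
      by (intro yields_CondT yields_eq[OF yields_clear])
        (use s H_set[OF y] H_len_B[OF y] in \<open>auto simp: sift_add_def\<close>)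
  next
    case False
    then show ?thesis
      by (intro yields_CondF yields_eq[OF yields_push_tuple])
        (use s H_set[OF y] H_len_B[OF y] in \<open>auto simp: sift_add_def\<close>)
  qed
  have 4: "yields B (Pop 11) ?s3 (s(7 := [], 1 := enc (sift_add n x L)))"
    by (rule yields_eq[OF yields_Pop]) (use s in auto)
  show ?thesis unfolding sift_add_prog_def
    by (rule yields_Seq[OF 1 yields_Seq[OF 2 yields_Seq[OF 3 4]]])
qed

lemma gen_H: "x \<in> G.gen (set L0) \<Longrightarrow> x \<in> G.H"
  using G.gen_H[OF L0(1)] by blast

lemma Inv_gen: "Inv L \<Longrightarrow> set L \<subseteq> G.gen (set L0)"
  by (simp add: G.sift_inv_def)

lemma yields_sift_row:
  assumes L: "Inv L" and u: "u \<in> G.gen (set L0)"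
    and s: "s 1 = enc L" "s 2 = map El b" "s 6 = map El u" "s 4 = []" "s 5 = []" "s 7 = []" "s 10 = []"
      "scratch s"
  shows "yields B sift_row_prog s (s(1 := enc (sift_row n u L)))"
proof -
  let ?st = "\<lambda>ts M. s(4 := enc ts, 1 := enc M)"
  let ?P = "mul_transducer 4 6 7 \<Zsemi> Pop 11 \<Zsemi> sift_add_prog"
  let ?f = "\<lambda>t. sift_add n (map2 (\<cdot>) t u)"
  let ?Inv = "\<lambda>ts M. set ts \<subseteq> G.gen (set L0) \<and> length (enc ts) \<le> B \<and> Inv M"
  have uC: "u \<in> tuples n C" using H_C gen_H u by blast
  have loop: "yields B (repeat_while 4 ?P) (?st L L) (?st [] (fold ?f L L)) \<and> ?Inv [] (fold ?f L L)"
  proof (rule yields_foreach[where Inv = ?Inv])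
    fix t ts M assume inv: "?Inv (t # ts) M"
    then have t: "t \<in> G.gen (set L0)" and M: "Inv M" by auto
    have tC: "t \<in> tuples n C" using H_C gen_H t by blast
    let ?x = "map2 (\<cdot>) t u"
    have xg: "?x \<in> G.gen (set L0)" using G.gen_mul t u by blast
    have xH: "?x \<in> G.H" using gen_H[OF xg] .
    let ?s1 = "(?st (t # ts) M)(4 := enc ts, 11 := [Work (if list_all2 test_true t u then 0 else 1)],
      7 := map El ?x @ (?st (t # ts) M) 7)"
    let ?s2 = "s(4 := enc ts, 1 := enc M, 7 := map El ?x)"
    have 1: "yields B (mul_transducer 4 6 7) (?st (t # ts) M) ?s1"
      by (rule yields_stateless[where n = n]) (use s inv tC uC mul_tuples[OF tC uC] in auto)
    have 2: "yields B (Pop 11) ?s1 ?s2"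
      by (rule yields_eq[OF yields_Pop]) (use s in auto)
    have 3: "yields B sift_add_prog ?s2 (?s2(7 := [], 1 := enc (sift_add n ?x M)))"
      by (rule yields_sift_add[OF M xH]) (use s in auto)
    have "Inv (sift_add n ?x M)" using G.sift_add_progress[OF L0 xg M] by blast
    moreover have "yields B ?P (?st (t # ts) M) (?st ts (?f t M))"
      by (rule yields_eq[OF yields_Seq[OF 1 yields_Seq[OF 2 3]]]) (use s in auto)
    ultimately show "yields B ?P (?st (t # ts) M) (?st ts (?f t M)) \<and> ?Inv ts (?f t M)"
      using inv by simp
  qed (use Inv_gen[OF L] Inv_B[OF L] L in auto)
  have c: "yields B (copy 1 4) s (?st L L)"
    by (rule yields_eq[OF yields_copy])
      (use s Inv_B[OF L] word_enc[OF Inv_C[OF L]] in auto)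
  show ?thesis unfolding sift_row_prog_def
    by (rule yields_eq[OF yields_Seq[OF c conjunct1[OF loop]]])
      (use s in \<open>auto simp: sift_row_def\<close>)
qed

lemma yields_sift_round:
  assumes L: "Inv L"
    and s: "s 1 = enc L" "s 2 = map El b" "s 3 = []" "s 6 = []" "s 4 = []" "s 5 = []" "s 7 = []" "s 10 = []"
      "scratch s"
  shows "yields B sift_round_prog s (s(1 := enc (sift_round n L)))"
proof -
  let ?st = "\<lambda>ts M. s(3 := enc ts, 1 := enc M)"
  let ?P = "pop_tuple 3 6 \<Zsemi> sift_row_prog \<Zsemi> clear 6"
  let ?Inv = "\<lambda>ts M. set ts \<subseteq> G.gen (set L0) \<and> length (enc ts) \<le> B \<and> Inv M"
  have loop: "yields B (repeat_while 3 ?P) (?st L L) (?st [] (fold (sift_row n) L L)) \<and>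
      ?Inv [] (fold (sift_row n) L L)"
  proof (rule yields_foreach[where Inv = ?Inv])
    fix u ts M assume inv: "?Inv (u # ts) M"
    then have u: "u \<in> G.gen (set L0)" and M: "Inv M" by auto
    have uH: "u \<in> G.H" using gen_H[OF u] .
    let ?s1 = "s(3 := enc ts, 1 := enc M, 6 := map El u)"
    let ?s2 = "?s1(1 := enc (sift_row n u M))"
    have 1: "yields B (pop_tuple 3 6) (?st (u # ts) M) ?s1"
      by (rule yields_eq[OF yields_pop_tuple[where t = u and r = "enc ts"]])
        (use s inv H_set[OF uH] in auto)
    have 2: "yields B sift_row_prog ?s1 ?s2"
      by (rule yields_sift_row[OF M u]) (use s in auto)
    have 3: "yields B (clear 6) ?s2 (?st ts (sift_row n u M))"
      by (rule yields_eq[OF yields_clear]) (use s H_set[OF uH] H_len_B[OF uH] in auto)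
    have "Inv (sift_row n u M)" using G.sift_row_progress[OF L0 u M] by blast
    then show "yields B ?P (?st (u # ts) M) (?st ts (sift_row n u M)) \<and> ?Inv ts (sift_row n u M)"
      using yields_Seq[OF 1 yields_Seq[OF 2 3]] inv by simp
  qed (use Inv_gen[OF L] Inv_B[OF L] L in auto)
  have c: "yields B (copy 1 3) s (?st L L)"
    by (rule yields_eq[OF yields_copy])
      (use s Inv_B[OF L] word_enc[OF Inv_C[OF L]] in auto)
  show ?thesis unfolding sift_round_prog_def
    by (rule yields_eq[OF yields_Seq[OF c conjunct1[OF loop]]])
      (use s in \<open>auto simp: sift_round_def\<close>)
qed

lemma yields_sift_rounds:
  assumes s: "s 1 = enc L0" "s 2 = map El b" "s 3 = []" "s 6 = []" "s 4 = []" "s 5 = []" "s 7 = []"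
      "s 9 = []" "s 10 = []" "scratch s"
  shows "yields B sift_rounds_prog s (s(1 := enc ((sift_round n ^^ (n * Suc (card I))) L0)))"
proof -
  let ?P = "copy 2 9 \<Zsemi> repeat_while 9 (Pop 9 \<Zsemi> sift_round_prog)"
  have len: "length b = n" using tuplesD(1)[OF bI] .
  have step: "yields B ?P (s(1 := enc L)) (s(1 := enc ((sift_round n ^^ n) L))) \<and>
      Inv ((sift_round n ^^ n) L)" if L: "Inv L" for L
  proof -
    let ?st = "\<lambda>xs M. s(9 := xs, 1 := enc M)"
    have loop: "yields B (repeat_while 9 (Pop 9 \<Zsemi> sift_round_prog)) (?st (map El b) L)
        (?st [] ((sift_round n ^^ length (map El b)) L)) \<and> Inv ((sift_round n ^^ length (map El b)) L)"
    proof (rule yields_repeat)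
      fix xs M assume M: "Inv M"
      have "yields B sift_round_prog (?st xs M) ((?st xs M)(1 := enc (sift_round n M)))"
        by (rule yields_sift_round[OF M]) (use s in auto)
      then show "yields B sift_round_prog (?st xs M) (?st xs (sift_round n M)) \<and> Inv (sift_round n M)"
        using G.sift_round_progress[OF L0 M] by simp
    qed (use L n_B len in auto)
    have c: "yields B (copy 2 9) (s(1 := enc L)) (?st (map El b) L)"
      by (rule yields_eq[OF yields_copy])
        (use s n_B len tuplesD(2)[OF b_C] in auto)
    have "yields B ?P (s(1 := enc L)) (s(1 := enc ((sift_round n ^^ n) L)))"
      by (rule yields_eq[OF yields_Seq[OF c conjunct1[OF loop]]])
        (use s len in auto)
    then show ?thesis using loop len by simp
  qed
  have "yields B (seqn (Suc (card I)) ?P) (s(1 := enc L0))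
      (s(1 := enc (((sift_round n ^^ n) ^^ Suc (card I)) L0)))"
    using yields_seqn[where Inv = Inv and st = "\<lambda>L. s(1 := enc L)" and f = "sift_round n ^^ n",
        OF step G.sift_inv_init[OF L0]] by blast
  moreover have "s(1 := enc L0) = s" using s by auto
  ultimately show ?thesis unfolding sift_rounds_prog_def by (simp only: funpow_mult)
qed

end


section \<open>The Clifford test, parsing and the whole program\<close>

context smp_prog
begin

text \<open>The accumulator is the second argument of the transducer, hence the exchanged
  factors.\<close>

definition product_prog :: "'a smp_symbol prog" where
  "product_prog = copy 8 3 \<Zsemi> pop_tuple 3 6 \<Zsemi>
     repeat_while 3 (transducer False (\<lambda>_ _ _. 0) (\<lambda>_ a c. c \<cdot> a) 3 6 6 \<Zsemi> Pop 11)"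

lemma map2_swap: "map2 (\<lambda>a c. f c a) t u = map2 f u t"
  by (simp add: zip_commute[of t u] case_prod_beta' comp_def)

lemma yields_product:
  assumes G: "set G \<subseteq> tuples n C" "G \<noteq> []" and B: "length (enc G) \<le> B"
    and s: "s 8 = enc G" "s 3 = []" "s 6 = []" "scratch s"
  shows "yields B product_prog s
      (s(6 := map El (fold (\<lambda>c E. map2 (\<cdot>) E c) (tl G) (hd G)))) \<and>
    fold (\<lambda>c E. map2 (\<cdot>) E c) (tl G) (hd G) \<in> tuples n C"
proof -
  obtain g G' where G': "G = g # G'" using G(2) by (cases G) auto
  have g: "g \<in> tuples n C" using G G' by simp
  let ?st = "\<lambda>ts E. s(3 := enc ts, 6 := map El E)"
  let ?P = "transducer False (\<lambda>_ _ _. 0) (\<lambda>_ a c. c \<cdot> a) 3 6 6 \<Zsemi> Pop 11"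
  let ?f = "\<lambda>c E. map2 (\<cdot>) E c"
  let ?Inv = "\<lambda>ts E. set ts \<subseteq> tuples n C \<and> length (enc ts) \<le> B \<and> E \<in> tuples n C"
  have loop: "yields B (repeat_while 3 ?P) (?st G' g) (?st [] (fold ?f G' g)) \<and> ?Inv [] (fold ?f G' g)"
  proof (rule yields_foreach[where Inv = ?Inv])
    fix t ts E assume inv: "?Inv (t # ts) E"
    then have t: "t \<in> tuples n C" and E: "E \<in> tuples n C" by auto
    have out: "mealy_out (\<lambda>_ _ _. 0) (\<lambda>_ a c. c \<cdot> a) 0 (zip t E) = map2 (\<cdot>) E t"
      using mealy_out_stateless[of "\<lambda>_ _ _. 0" "\<lambda>a c. c \<cdot> a" 0 t E] map2_swap[of "(\<cdot>)" t E] by simp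
    have "yields B ?P (?st (t # ts) E) ((?st (t # ts) E)(3 := enc ts,
        6 := map El (mealy_out (\<lambda>_ _ _. 0) (\<lambda>_ a c. c \<cdot> a) 0 (zip t E))))"
      by (rule yields_replace[where t = t and u = E and n = n])
        (use s inv t E mul_tuples[OF E t] in \<open>auto simp: out\<close>)
    then show "yields B ?P (?st (t # ts) E) (?st ts (?f t E)) \<and> ?Inv ts (?f t E)"
      using inv mul_tuples[OF E t] by (auto elim!: yields_eq simp: fun_eq_iff out)
  qed (use G g B G' in auto)
  have 1: "yields B (copy 8 3) s (s(3 := enc G))"
    by (rule yields_eq[OF yields_copy]) (use s B word_enc[OF G(1)] in auto)
  have 2: "yields B (pop_tuple 3 6) (s(3 := enc G)) (?st G' g)"
    by (rule yields_eq[OF yields_pop_tuple[where t = g and r = "enc G'"]])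
      (use s B G' tuplesD(2)[OF g] in auto)
  have "yields B product_prog s (s(6 := map El (fold ?f G' g)))" unfolding product_prog_def
    by (rule yields_eq[OF yields_Seq[OF 1 yields_Seq[OF 2 conjunct1[OF loop]]]])
      (use s in auto)
  then show ?thesis using loop by (simp add: G')
qed

definition compare_prog :: "'a smp_symbol prog" where
  "compare_prog = push_tuple 6 3 \<Zsemi>
     test_transducer (\<lambda>a c. idp a = idp c) 3 2 7 \<Zsemi> clear 7"

lemma yields_compare:
  assumes E: "E \<in> tuples n C" and b: "b \<in> tuples n C" and B: "n + 1 \<le> B"
    and s: "s 6 = map El E" "s 2 = map El b" "s 3 = []" "s 7 = []" "scratch s"
  shows "yields B compare_prog s (s(6 := [], 11 := [Work (if map idp E = map idp b then 0 else 1)]))"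
proof -
  have len: "length E = n" "length b = n" using tuplesD E b by auto
  have l: "list_all2 (\<lambda>a c. idp a = idp c) E b \<longleftrightarrow> map idp E = map idp b"
    using len by (auto simp: list_all2_conv_all_nth list_eq_iff_nth_eq)
  let ?s1 = "s(6 := [], 3 := map El E @ SEP # [])"
  let ?s2 = "?s1(3 := [], 11 := [Work (if list_all2 (\<lambda>a c. idp a = idp c) E b then 0 else 1)],
    7 := map El (map2 (\<lambda>a c. a) E b) @ ?s1 7)"
  have 1: "yields B (push_tuple 6 3) s ?s1"
    by (rule yields_eq[OF yields_push_tuple]) (use s len B tuplesD(2)[OF E] in auto)
  have 2: "yields B (test_transducer (\<lambda>a c. idp a = idp c) 3 2 7) ?s1 ?s2"
    by (rule yields_stateless[where n = n]) (use s len B E b in \<open>auto simp: map2_fst\<close>)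
  have 3: "yields B (clear 7) ?s2 (s(6 := [], 11 := [Work (if map idp E = map idp b then 0 else 1)]))"
    by (rule yields_eq[OF yields_clear])
      (use s len B tuplesD(2)[OF E] in \<open>auto simp: map2_fst l\<close>)
  show ?thesis unfolding compare_prog_def by (rule yields_Seq[OF 1 yields_Seq[OF 2 3]])
qed

definition project_prog :: "'a smp_symbol prog" where
  "project_prog =
     repeat_while 8 (Push 1 SEP \<Zsemi>
       transducer True (test_mode test_true) (\<lambda>_ a c. idp c \<cdot> a) 8 2 1 \<Zsemi> Pop 11) \<Zsemi>
     Push 3 SEP \<Zsemi> copy 2 3 \<Zsemi> Push 1 SEP \<Zsemi>
     transducer True (test_mode test_true) (\<lambda>_ a c. idp a) 3 2 1 \<Zsemi> Pop 11"

lemma yields_project: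
  assumes G: "set G \<subseteq> tuples n C" and b: "b \<in> tuples n I" and B: "length (enc G) \<le> B" "n + 1 \<le> B"
    and s: "s 8 = enc G" "s 2 = map El b" "s 1 = []" "s 3 = []" "scratch s"
  shows "yields B project_prog s (s(8 := [], 1 := enc (project_list b G)))"
proof -
  have bC: "b \<in> tuples n C" using b I_sub by (auto simp: tuples_def)
  have eC: "map idp b \<in> tuples n C" using b I_sub by (auto simp: tuples_iff)
  have len: "length b = n" using tuplesD b by auto
  let ?f = "\<lambda>c L. map2 (\<cdot>) (map idp b) c # L"
  let ?st = "\<lambda>ts L. s(8 := enc ts, 1 := enc L)"
  let ?P = "Push 1 SEP \<Zsemi> transducer True (test_mode test_true) (\<lambda>_ a c. idp c \<cdot> a) 8 2 1 \<Zsemi> Pop 11"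
  let ?Inv = "\<lambda>ts L. set ts \<subseteq> tuples n C \<and> length (enc ts) \<le> B"
  have loop: "yields B (repeat_while 8 ?P) (?st G []) (?st [] (fold ?f G [])) \<and> ?Inv [] (fold ?f G [])"
  proof (rule yields_foreach[where Inv = ?Inv])
    fix t ts L assume inv: "?Inv (t # ts) L"
    then have t: "t \<in> tuples n C" by auto
    have m: "map2 (\<lambda>a c. idp c \<cdot> a) t b = map2 (\<cdot>) (map idp b) t"
      using map2_swap[of "\<lambda>c a. idp c \<cdot> a" t b] by (simp add: zip_map1 case_prod_beta' comp_def)
    let ?s1 = "?st (t # ts) L"
    let ?s2 = "?s1(1 := SEP # ?s1 1)"
    let ?s3 = "?s2(8 := enc ts, 11 := [Work (if list_all2 test_true t b then 0 else 1)],
      1 := map El (map2 (\<lambda>a c. idp c \<cdot> a) t b) @ ?s2 1)"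
    have 1: "yields B (Push 1 SEP) ?s1 ?s2" by (rule yields_Push)
    have 2: "yields B (transducer True (test_mode test_true) (\<lambda>_ a c. idp c \<cdot> a) 8 2 1) ?s2 ?s3"
      by (rule yields_stateless[where n = n])
        (use s inv t bC mul_tuples[OF eC t] in \<open>auto simp: m\<close>)
    have 3: "yields B (Pop 11) ?s3 (?st ts (?f t L))"
      by (rule yields_eq[OF yields_Pop]) (use s m in auto)
    show "yields B ?P (?st (t # ts) L) (?st ts (?f t L)) \<and> ?Inv ts (?f t L)"
      using yields_Seq[OF 1 yields_Seq[OF 2 3]] inv by simp
  qed (use G B in auto)
  let ?L = "fold ?f G []"
  have m: "map2 (\<lambda>a c. idp a) b b = map idp b"
    by (rule nth_equalityI) auto
  let ?s1 = "s(8 := [], 1 := enc ?L)"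
  let ?s2 = "?s1(3 := SEP # ?s1 3)"
  let ?s3 = "?s2(3 := map El b @ SEP # [])"
  let ?s4 = "?s3(1 := SEP # ?s3 1)"
  let ?s5 = "?s4(3 := [], 11 := [Work (if list_all2 test_true b b then 0 else 1)],
    1 := map El (map2 (\<lambda>a c. idp a) b b) @ ?s4 1)"
  have 0: "yields B (repeat_while 8 ?P) s ?s1"
  proof -
    have "?st G [] = s" using s by auto
    then show ?thesis using loop by simp
  qed
  have 1: "yields B (Push 3 SEP) ?s1 ?s2" by (rule yields_Push)
  have 2: "yields B (copy 2 3) ?s2 ?s3"
    by (rule yields_eq[OF yields_copy]) (use s len B tuplesD(2)[OF bC] in auto)
  have 3: "yields B (Push 1 SEP) ?s3 ?s4" by (rule yields_Push)
  have 4: "yields B (transducer True (test_mode test_true) (\<lambda>_ a c. idp a) 3 2 1) ?s4 ?s5"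
    by (rule yields_stateless[where n = n]) (use s len B bC eC in \<open>auto simp: m\<close>)
  have 5: "yields B (Pop 11) ?s5 (s(8 := [], 1 := enc (project_list b G)))"
    by (rule yields_eq[OF yields_Pop]) (use s m in \<open>auto simp: project_list_def\<close>)
  show ?thesis unfolding project_prog_def
    by (rule yields_Seq[OF 0 yields_Seq[OF 1 yields_Seq[OF 2 yields_Seq[OF 3 yields_Seq[OF 4 5]]]]])
qed

definition group_prog :: "'a smp_symbol prog" where
  "group_prog = Pop 11 \<Zsemi> project_prog \<Zsemi> sift_rounds_prog \<Zsemi> copy 2 7 \<Zsemi> sift_prog \<Zsemi> trivial_prog \<Zsemi>
     Cond (\<lambda>g. g 11 = Work 0) (Push 15 (Work 0)) Skip"

definition clifford_prog :: "'a smp_symbol prog" where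
  "clifford_prog = Cond (\<lambda>g. g 8 \<noteq> Blank)
     (product_prog \<Zsemi> compare_prog \<Zsemi> Cond (\<lambda>g. g 11 = Work 0) group_prog Skip) Skip"

text \<open>Only stack 15 is described, because the run ends here and acceptance is read off from
  it.\<close>

lemma yields_clifford:
  assumes G: "set G \<subseteq> tuples n C" "\<And>c. c \<in> set G \<Longrightarrow> relevant b c" and b: "b \<in> tuples n C"
    and B: "(Suc (length G) + n * card I) * (n + 1) \<le> B"
    and s: "s 8 = enc G" "s 2 = map El b" "s 1 = []" "s 3 = []" "s 4 = []" "s 5 = []" "s 6 = []"
      "s 7 = []" "s 9 = []" "s 10 = []" "scratch s"
  shows "\<exists>s'. yields B clifford_prog s s' \<and>
    s' 15 = (if clifford_test n b G then Work 0 # s 15 else s 15)"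
proof (cases "G = []")
  case True
  then have "yields B clifford_prog s s" unfolding clifford_prog_def
    by (intro yields_CondF yields_Skip) (simp add: s)
  then show ?thesis using True by (auto simp: clifford_test_def)
next
  case False
  let ?E = "fold (\<lambda>c E. map2 (\<cdot>) E c) (tl G) (hd G)"
  have bI: "b \<in> tuples n I" and GI: "c \<in> tuples n I \<and> relevant b c" if "c \<in> set G" for c
    using G that b by (auto simp: relevant_def list_all2_conv_all_nth tuples_iff subset_iff)
  have bI: "b \<in> tuples n I" using bI[of "hd G"] False by simp
  have "length G * (n + 1) \<le> (Suc (length G) + n * card I) * (n + 1)"
    "1 * (n + 1) \<le> (Suc (length G) + n * card I) * (n + 1)" by (rule mult_right_mono; simp)+
  then have BG: "length (enc G) \<le> B" and Bn: "n + 1 \<le> B"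
    using B length_enc[OF G(1)] by auto
  have E: "yields B product_prog s (s(6 := map El ?E))" "?E \<in> tuples n C"
    using yields_product[OF G(1) False BG s(1,4,7,11)] by auto
  let ?s1 = "(s(6 := map El ?E))(6 := [], 11 := [Work (if map idp ?E = map idp b then 0 else 1)])"
  have 2: "yields B compare_prog (s(6 := map El ?E)) ?s1"
    by (rule yields_compare[OF E(2) b Bn]) (use s in auto)
  have top: "peek (s 8) \<noteq> Blank" using False by (simp add: s)
  show ?thesis
  proof (cases "map idp ?E = map idp b")
    case neq: False
    have 3: "yields B (Cond (\<lambda>g. g 11 = Work 0) group_prog Skip) ?s1 ?s1"
      by (rule yields_CondF) (use neq in \<open>auto intro: yields_Skip\<close>)
    have "yields B clifford_prog s ?s1" unfolding clifford_prog_def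
      by (rule yields_CondT[OF _ yields_Seq[OF E(1) yields_Seq[OF 2 3]]]) (use top in simp)
    then show ?thesis using neq by (intro exI[of _ ?s1]) (auto simp: clifford_test_def)
  next
    case eq: True
    let ?LL = "project_list b G"
    interpret st: sift_stage S I k d r cs n b ?LL B
    proof unfold_locales
      show "(length ?LL + n * card I) * (n + 1) \<le> B" using B by (simp add: project_list_facts)
    qed (use bI project_list_H[OF GI bI] in auto)
    have bH: "b \<in> st.G.H" by (rule power_group_idp[OF bI])
    let ?L = "(sift_round n ^^ (n * Suc (card I))) ?LL"
    have L: "st.Inv ?L" by (rule st.G.sift_rounds_inv[OF st.L0])
    let ?y = "sift n ?L b"
    have yH: "?y \<in> st.G.H" using st.G.sift_H[OF st.Inv_H[OF L] bH] .
    let ?s3 = "s(8 := [], 1 := enc ?LL)"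
    let ?s4 = "?s3(1 := enc ?L)"
    let ?s5 = "?s4(7 := map El b)"
    let ?s6 = "?s5(7 := map El ?y)"
    let ?s7 = "?s6(11 := [Work (if list_all (\<lambda>a. idp a = a) ?y then 0 else 1)])"
    let ?s8 = "?s7(15 := (if list_all (\<lambda>a. idp a = a) ?y then Work 0 # s 15 else s 15))"
    have a: "yields B (Pop 11) ?s1 s"
      by (rule yields_eq[OF yields_Pop]) (use s in auto)
    have b': "yields B project_prog s ?s3"
      by (rule yields_project[OF G(1) bI BG Bn]) (use s in auto)
    have c: "yields B sift_rounds_prog ?s3 ?s4"
      by (rule st.yields_sift_rounds) (use s in auto)
    have d': "yields B (copy 2 7) ?s4 ?s5"
      by (rule yields_eq[OF yields_copy])
        (use s tuplesD[OF b] Bn in auto)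
    have e: "yields B sift_prog ?s5 ?s6"
      by (rule st.yields_sift[OF L bH]) (use s in auto)
    have f: "yields B trivial_prog ?s6 ?s7"
      by (rule st.yields_trivial[OF yH]) (use s in auto)
    have g: "yields B (Cond (\<lambda>g. g 11 = Work 0) (Push 15 (Work 0)) Skip) ?s7 ?s8"
      by (rule yields_eq[OF yields_exec]) auto
    have "yields B group_prog ?s1 ?s8" unfolding group_prog_def
      by (rule yields_Seq[OF a yields_Seq[OF b' yields_Seq[OF c yields_Seq[OF d'
          yields_Seq[OF e yields_Seq[OF f g]]]]]])
    then have 3: "yields B (Cond (\<lambda>g. g 11 = Work 0) group_prog Skip) ?s1 ?s8"
      by (intro yields_CondT) (use eq in auto)
    have "yields B clifford_prog s ?s8" unfolding clifford_prog_def
      by (rule yields_CondT[OF _ yields_Seq[OF E(1) yields_Seq[OF 2 3]]]) (use top in simp)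
    then show ?thesis using eq False by (intro exI[of _ ?s8]) (auto simp: clifford_test_def)
  qed
qed

text \<open>Transducers presuppose tuples of equal length, so this is checked before they are used.
  Each tuple and \<open>b\<close> are popped in parallel, and they must end together; the consumed
  part of \<open>b\<close> is kept on stack 14 and put back.\<close>

definition length_prog :: "'a smp_symbol prog" where
  "length_prog = copy 1 3 \<Zsemi> repeat_while 3
     (Loop (\<lambda>g. g 3 \<noteq> SEP \<and> g 2 \<noteq> Blank) 3 (emit cs 14 (\<lambda>g. g 2) \<Zsemi> Pop 2 \<Zsemi> Pop 3) \<Zsemi>
      Cond (\<lambda>g. g 3 = SEP \<and> g 2 = Blank) Skip (Push 16 (Work 0)) \<Zsemi>
      pop_tuple 3 7 \<Zsemi> clear 7 \<Zsemi> shift 14 2)"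

lemma yields_length_loop:
  assumes "s 3 = map El t @ SEP # q" "s 2 = map El u" "set t \<subseteq> C" "set u \<subseteq> C" "length (s 3) \<le> B"
  shows "yields B (Loop (\<lambda>g. g 3 \<noteq> SEP \<and> g 2 \<noteq> Blank) 3 (emit cs 14 (\<lambda>g. g 2) \<Zsemi> Pop 2 \<Zsemi> Pop 3)) s
    (s(3 := map El (drop (length u) t) @ SEP # q, 2 := map El (drop (length t) u),
       14 := rev (map El (take (length t) u)) @ s 14))"
  using assms
proof (induction t arbitrary: s u)
  case Nil
  then show ?case by (intro yields_eq[OF yields_LoopF]) auto
next
  case (Cons x t)
  show ?case
  proof (cases u)
    case Nil
    then show ?thesis using Cons.prems
      by (intro yields_eq[OF yields_LoopF]) auto
  next
    case u: (Cons y u')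
    let ?P = "emit cs 14 (\<lambda>g. g 2) \<Zsemi> Pop 2 \<Zsemi> Pop 3"
    let ?s = "s(3 := map El t @ SEP # q, 2 := map El u', 14 := El y # s 14)"
    have "exec ?P s = ?s" using Cons.prems u by auto
    then have 1: "yields B ?P s ?s" using yields_exec[of ?P B s] by simp
    have 2: "yields B (Loop (\<lambda>g. g 3 \<noteq> SEP \<and> g 2 \<noteq> Blank) 3 ?P) ?s
      (?s(3 := map El (drop (length u') t) @ SEP # q, 2 := map El (drop (length t) u'),
         14 := rev (map El (take (length t) u')) @ ?s 14))"
      using Cons.prems u by (intro Cons.IH) auto
    show ?thesis
      by (rule yields_eq[OF yields_LoopT[OF _ _ 1 _ 2]]) (use Cons.prems u in auto)
  qed
qed

lemma word_enc': "(\<And>t. t \<in> set ts \<Longrightarrow> set t \<subseteq> C) \<Longrightarrow> word (enc ts)"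
proof (induction ts)
  case (Cons t ts)
  then have "set t \<subseteq> C" "word (enc ts)" by auto
  then show ?case by auto
qed simp

lemma yields_length:
  assumes L: "\<And>t. t \<in> set L \<Longrightarrow> set t \<subseteq> C" and b: "set b \<subseteq> C" and B: "length (enc L) \<le> B" "length b \<le> B"
    and s: "s 1 = enc L" "s 2 = map El b" "s 3 = []" "s 7 = []" "s 16 = []" "scratch s"
  shows "yields B length_prog s
    (s(16 := fold (\<lambda>t F. if length t \<noteq> length b then Work 0 # F else F) L []))"
proof -
  let ?Q = "Loop (\<lambda>g. g 3 \<noteq> SEP \<and> g 2 \<noteq> Blank) 3 (emit cs 14 (\<lambda>g. g 2) \<Zsemi> Pop 2 \<Zsemi> Pop 3)"
  let ?P = "?Q \<Zsemi> Cond (\<lambda>g. g 3 = SEP \<and> g 2 = Blank) Skip (Push 16 (Work 0)) \<Zsemi>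
      pop_tuple 3 7 \<Zsemi> clear 7 \<Zsemi> shift 14 2"
  let ?f = "\<lambda>t F. if length t \<noteq> length b then Work 0 # F else F"
  let ?st = "\<lambda>ts F. s(3 := enc ts, 16 := F)"
  let ?Inv = "\<lambda>ts F. (\<forall>t \<in> set ts. set t \<subseteq> C) \<and> length (enc ts) \<le> B"
  have loop: "yields B (repeat_while 3 ?P) (?st L []) (?st [] (fold ?f L [])) \<and> ?Inv [] (fold ?f L [])"
  proof (rule yields_foreach[where Inv = ?Inv])
    fix t ts F assume inv: "?Inv (t # ts) F"
    then have t: "set t \<subseteq> C" "length t \<le> B" by auto
    let ?d = "drop (length b) t"
    have dC: "set ?d \<subseteq> C" "set (take (length t) b) \<subseteq> C" using t b set_drop_subset set_take_subset by fast+
    let ?s1 = "s(3 := map El ?d @ SEP # enc ts, 16 := F, 2 := map El (drop (length t) b),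
       14 := rev (map El (take (length t) b)))"
    let ?s2 = "?s1(16 := ?f t F)"
    let ?s3 = "?s2(3 := enc ts, 7 := map El ?d)"
    let ?s4 = "?s3(7 := [])"
    have 1: "yields B ?Q (?st (t # ts) F) ?s1"
      by (rule yields_eq[OF yields_length_loop[where t = t and u = b and q = "enc ts"]])
        (use s inv b in auto)
    have dt: "peek (map El ?d @ SEP # enc ts) = SEP \<longleftrightarrow> length t \<le> length b"
      by (cases ?d) auto
    have db: "peek (map El (drop (length t) b)) = Blank \<longleftrightarrow> length b \<le> length t"
      by (cases "drop (length t) b") auto
    have 2: "yields B (Cond (\<lambda>g. g 3 = SEP \<and> g 2 = Blank) Skip (Push 16 (Work 0))) ?s1 ?s2"
      by (rule yields_eq[OF yields_exec]) (use dt db in auto)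
    have 3: "yields B (pop_tuple 3 7) ?s2 ?s3"
      by (rule yields_eq[OF yields_pop_tuple[where t = ?d and r = "enc ts"]])
        (use s inv dC in auto)
    have 4: "yields B (clear 7) ?s3 ?s4"
      by (rule yields_clear) (use t dC in auto)
    have app: "map El (take (length t) b) @ map El (drop (length t) b) = map El b"
      by (simp flip: map_append)
    have 5: "yields B (shift 14 2) ?s4 (?st ts (?f t F))"
      by (rule yields_eq[OF yields_shift])
        (use s B dC app in \<open>auto simp: rev_map[symmetric]\<close>)
    show "yields B ?P (?st (t # ts) F) (?st ts (?f t F)) \<and> ?Inv ts (?f t F)"
      using yields_Seq[OF 1 yields_Seq[OF 2 yields_Seq[OF 3 yields_Seq[OF 4 5]]]] inv by simp
  qed (use L B in auto)
  have c: "yields B (copy 1 3) s (?st L [])"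
    by (rule yields_eq[OF yields_copy]) (use s B word_enc'[OF L] in auto)
  show ?thesis unfolding length_prog_def
    by (rule yields_eq[OF yields_Seq[OF c conjunct1[OF loop]]]) (use s in auto)
qed

text \<open>Reversing the input brings \<open>b\<close>, the part behind the last separator, to the
  top, where it ends at the first symbol that is not an element.\<close>

definition parse_prog :: "'a smp_symbol prog" where
  "parse_prog = shift 0 13 \<Zsemi> move (\<lambda>x. x \<in> El ` C) 13 2 \<Zsemi> shift 13 1"

lemma smp_encode_enc: "map Input (smp_encode L b) = enc L @ map El b"
  by (induction L) (auto simp: smp_encode_def)

lemma yields_parse:
  assumes L: "\<And>t. t \<in> set L \<Longrightarrow> set t \<subseteq> C" and b: "set b \<subseteq> C" and B: "length (smp_encode L b) \<le> B"
  shows "yields B parse_prog (init_stacks (smp_encode L b)) ((\<lambda>_ :: nat. [])(1 := enc L, 2 := map El b))"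
proof -
  let ?s = "init_stacks (smp_encode L b)"
  have s0: "?s 0 = enc L @ map El b" by (simp add: init_stacks_def smp_encode_enc)
  have len: "length (enc L) + length b \<le> B"
    using B arg_cong[OF smp_encode_enc[of L b], of length] by simp
  let ?s1 = "(\<lambda>_ :: nat. [])(13 := rev (map El b) @ rev (enc L))"
  let ?s2 = "(\<lambda>_ :: nat. [])(13 := rev (enc L), 2 := map El b)"
  have 1: "yields B (shift 0 13) ?s ?s1"
    by (rule yields_eq[OF yields_shift])
      (use s0 len word_enc'[OF L] b in \<open>auto simp: init_stacks_def\<close>)
  have top: "peek (rev (enc L)) \<notin> El ` C"
    by (cases L rule: rev_cases) auto
  have 2: "yields B (move (\<lambda>x. x \<in> El ` C) 13 2) ?s1 ?s2"
    by (rule yields_eq[OF yields_move[where u = "rev (map El b)" and r = "rev (enc L)"]])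
      (use top b len in auto)
  have 3: "yields B (shift 13 1) ?s2 ((\<lambda>_ :: nat. [])(1 := enc L, 2 := map El b))"
    by (rule yields_eq[OF yields_shift]) (use len word_enc'[OF L] in auto)
  show ?thesis unfolding parse_prog_def by (rule yields_Seq[OF 1 yields_Seq[OF 2 3]])
qed

definition decide_prog :: "'a smp_symbol prog" where
  "decide_prog = seqn r square_prog \<Zsemi> member_prog \<Zsemi> relevant_prog \<Zsemi> clifford_prog"

definition main_prog :: "'a smp_symbol prog" where
  "main_prog = parse_prog \<Zsemi> length_prog \<Zsemi> Cond (\<lambda>g. g 16 = Blank)
     decide_prog Skip"

text \<open>The first factor bounds the number of tuples in a list, with (N + 1)^(2^r) for the block
  products and N |I| for the members added by sifting. The last factor bounds the length of an
  encoded tuple with its separator.\<close>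

definition bound_poly :: "nat poly" where
  "bound_poly = ([:1, 1:] ^ (2 ^ r) + [:1, card I:]) * [:1, 1:]"

lemma bound_poly: "poly bound_poly N = ((N + 1) ^ (2 ^ r) + N * card I + 1) * (N + 1)"
  by (simp add: bound_poly_def algebra_simps)

lemma smp_encode_SMP:
  assumes L: "\<And>t. t \<in> set L \<Longrightarrow> set t \<subseteq> C" and b: "set b \<subseteq> C"
  shows "smp_encode L b \<in> SMP S \<longleftrightarrow>
    (\<forall>t \<in> set L. length t = length b) \<and> b \<in> sgrp_gen (sgrp_power S (length b)) (set L)"
  using assms by (auto simp: SMP_def smp_encode_inject sgrp_power_def subset_iff)

lemma yields_main:
  assumes L: "\<And>t. t \<in> set L \<Longrightarrow> set t \<subseteq> C" and b: "set b \<subseteq> C"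
    and B: "B = poly bound_poly (length (smp_encode L b))"
  shows "\<exists>s'. yields B main_prog (init_stacks (smp_encode L b)) s' \<and>
    (peek (s' 15) \<noteq> Blank \<longleftrightarrow> smp_encode L b \<in> SMP S)"
proof -
  let ?N = "length (smp_encode L b)" and ?n = "length b"
  have N: "?N = length (enc L) + ?n"
    using arg_cong[OF smp_encode_enc[of L b], of length] by simp
  have LN: "length L \<le> ?N"
  proof -
    have "length L \<le> length (enc L)" by (induction L) auto
    then show ?thesis using N by simp
  qed
  have nN: "?n \<le> ?N" using N by simp
  have "1 * (?N + 1) \<le> ((?N + 1) ^ (2 ^ r) + ?N * card I + 1) * (?N + 1)"
    by (rule mult_right_mono) auto
  then have NB: "?N \<le> B" unfolding B bound_poly by simp
  let ?s1 = "(\<lambda>_ :: nat. [])(1 := enc L, 2 := map El b)"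
  let ?F = "fold (\<lambda>t F. if length t \<noteq> ?n then Work 0 # F else F) L [] :: 'a smp_symbol tape_symbol list"
  let ?s2 = "?s1(16 := ?F)"
  have 1: "yields B parse_prog (init_stacks (smp_encode L b)) ?s1"
    by (rule yields_parse[OF L b NB])
  have 2: "yields B length_prog ?s1 ?s2"
    by (rule yields_length[OF L b]) (use NB N in \<open>auto simp: scratch_def\<close>)
  have F: "?F = [] \<longleftrightarrow> (\<forall>t \<in> set L. length t = ?n)"
    using fold_marks[of "\<lambda>t. length t \<noteq> ?n" "Work 0" L "[]"] by simp
  have marks: "peek F = Blank \<longleftrightarrow> F = []" if "set F \<subseteq> {Work 0}" for F :: "'a smp_symbol tape_symbol list"
    using that by (cases F) auto
  have set_marks: "set (fold (\<lambda>t F. if Q t then Work 0 # F else F) M A) \<subseteq> insert (Work 0) (set A)"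
    for Q :: "'a list \<Rightarrow> bool" and M and A :: "'a smp_symbol tape_symbol list"
  proof (induction M arbitrary: A)
    case (Cons a M)
    show ?case using Cons.IH[of "if Q a then Work 0 # A else A"] by (auto split: if_splits)
  qed auto
  have pF: "peek ?F = Blank \<longleftrightarrow> ?F = []"
    by (rule marks) (use set_marks[of "\<lambda>t. length t \<noteq> ?n" L "[]"] in simp)
  show ?thesis
  proof (cases "\<forall>t \<in> set L. length t = ?n")
    case False
    have "yields B (Cond (\<lambda>g. g 16 = Blank)
        decide_prog Skip) ?s2 ?s2"
      by (rule yields_CondF) (use False F pF in \<open>auto intro: yields_Skip\<close>)
    then have "yields B main_prog (init_stacks (smp_encode L b)) ?s2"
      unfolding main_prog_def by (intro yields_Seq[OF 1 yields_Seq[OF 2]])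
    moreover have "smp_encode L b \<notin> SMP S" using False smp_encode_SMP[OF L b] by blast
    ultimately show ?thesis by (intro exI[of _ ?s2]) auto
  next
    case True
    have LT: "set L \<subseteq> tuples ?n C" using True L by (auto simp: tuples_def)
    have bT: "b \<in> tuples ?n C" using b by (simp add: tuples_def)
    let ?M = "(square_list S ^^ r) L" and ?G = "relevant_list b ((square_list S ^^ r) L)"
    have Mj: "length ((square_list S ^^ j) L) + 1 \<le> (?N + 1) ^ (2 ^ r)" if "j \<le> r" for j
    proof -
      have "length ((square_list S ^^ j) L) + 1 \<le> (length L + 1) ^ (2 ^ j)"
        by (rule length_square_list_iter)
      also have "\<dots> \<le> (?N + 1) ^ (2 ^ j)" using LN by (intro power_mono) auto
      also have "\<dots> \<le> (?N + 1) ^ (2 ^ r)" using that by (intro power_increasing) auto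
      finally show ?thesis .
    qed
    have Bj: "length ((square_list S ^^ j) L) * (?n + 1) \<le> B" if "j \<le> r" for j
    proof -
      have "length ((square_list S ^^ j) L) * (?n + 1) \<le>
          ((?N + 1) ^ (2 ^ r) + ?N * card I + 1) * (?N + 1)"
        using Mj[OF that] nN by (intro mult_mono) auto
      then show ?thesis by (simp only: B bound_poly)
    qed
    have BG: "(Suc (length ?G) + ?n * card I) * (?n + 1) \<le> B"
    proof -
      have "Suc (length ?G) \<le> (?N + 1) ^ (2 ^ r)"
        using Mj[OF order_refl] relevant_list_facts(2)[of b ?M] by linarith
      moreover have "?n * card I \<le> ?N * card I" using nN by (rule mult_right_mono) simp
      ultimately have "Suc (length ?G) + ?n * card I \<le> (?N + 1) ^ (2 ^ r) + ?N * card I + 1"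
        by linarith
      then have "(Suc (length ?G) + ?n * card I) * (?n + 1) \<le>
          ((?N + 1) ^ (2 ^ r) + ?N * card I + 1) * (?N + 1)"
        by (rule mult_mono) (use nN in simp_all)
      then show ?thesis by (simp only: B bound_poly)
    qed
    let ?F' = "fold (\<lambda>t F. if t = b then Work 0 # F else F) ?M [] :: 'a smp_symbol tape_symbol list"
    let ?s3 = "?s1(1 := enc ?M)"
    let ?s4 = "?s3(15 := ?F')"
    let ?s5 = "?s4(1 := [], 8 := enc ?G)"
    have F0: "?F = []" using F True by blast
    have s2: "?s2 = ?s1" using F0 by auto
    have 3: "yields B (seqn r square_prog) ?s1 ?s3" and MT: "set ?M \<subseteq> tuples ?n C"
      using yields_squares[OF LT Bj, of r ?s1] by (auto simp: scratch_def)
    have 4: "yields B member_prog ?s3 ?s4"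
      by (rule yields_eq[OF yields_member[OF MT bT Bj[OF order_refl]]])
        (auto simp: scratch_def fun_eq_iff)
    have 5: "yields B relevant_prog ?s4 ?s5"
      by (rule yields_relevant[OF MT bT Bj[OF order_refl]]) (auto simp: scratch_def)
    have GT: "set ?G \<subseteq> tuples ?n C" "\<And>c. c \<in> set ?G \<Longrightarrow> relevant b c"
      using MT by (auto simp: relevant_list_facts)
    obtain s' where 6: "yields B clifford_prog ?s5 s'"
      and s': "s' 15 = (if clifford_test ?n b ?G then Work 0 # ?s5 15 else ?s5 15)"
      using yields_clifford[OF GT bT BG, of ?s5] by (auto simp: scratch_def)
    have "yields B (Cond (\<lambda>g. g 16 = Blank)
        decide_prog Skip) ?s2 s'"
      unfolding s2 decide_prog_def
      by (rule yields_CondT[OF _ yields_Seq[OF 3 yields_Seq[OF 4 yields_Seq[OF 5 6]]]]) simp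
    then have y: "yields B main_prog (init_stacks (smp_encode L b)) s'"
      unfolding main_prog_def by (intro yields_Seq[OF 1 yields_Seq[OF 2]])
    have "?F' = [] \<longleftrightarrow> b \<notin> set ?M"
      using fold_marks[of "\<lambda>t. t = b" "Work 0" ?M "[]"] by auto
    moreover have "peek ?F' = Blank \<longleftrightarrow> ?F' = []"
      by (rule marks) (use set_marks[of "\<lambda>t. t = b" ?M "[]"] in simp)
    ultimately have "peek (s' 15) \<noteq> Blank \<longleftrightarrow> b \<in> set ?M \<or> clifford_test ?n b ?G"
      by (auto simp: s')
    then show ?thesis
      using y mem_gen_iff_test[OF LT bT] smp_encode_SMP[OF L b] True by blast
  qed
qed

section \<open>Well-formedness of the program and the conclusion\<close>

lemma prog_wf_macros [simp]:
  "a < K \<Longrightarrow> c < K \<Longrightarrow> prog_wf K (move p a c)"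
  "a < K \<Longrightarrow> c < K \<Longrightarrow> prog_wf K (shift a c)"
  "14 < K \<Longrightarrow> a < K \<Longrightarrow> c < K \<Longrightarrow> prog_wf K (shift2 a c)"
  "14 < K \<Longrightarrow> a < K \<Longrightarrow> c < K \<Longrightarrow> prog_wf K (copy a c)"
  "a < K \<Longrightarrow> prog_wf K (clear a)"
  "14 < K \<Longrightarrow> a < K \<Longrightarrow> c < K \<Longrightarrow> prog_wf K (pop_tuple a c)"
  "14 < K \<Longrightarrow> a < K \<Longrightarrow> c < K \<Longrightarrow> prog_wf K (push_tuple a c)"
  "14 < K \<Longrightarrow> a < K \<Longrightarrow> c < K \<Longrightarrow> e < K \<Longrightarrow> prog_wf K (transducer keep \<delta> f a c e)"
  by (simp_all add: move_def shift_def shift2_def copy_def clear_def pop_tuple_def push_tuple_def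
      transducer_def transducer_body_def repeat_while_def)

lemma prog_wf_main: "prog_wf 17 main_prog"
  by (simp add: main_prog_def decide_prog_def parse_prog_def length_prog_def square_prog_def member_prog_def
      relevant_prog_def clifford_prog_def product_prog_def compare_prog_def group_prog_def
      project_prog_def sift_rounds_prog_def sift_round_prog_def sift_row_prog_def sift_add_prog_def
      sift_prog_def trivial_prog_def repeat_while_def)

text \<open>Cutting a word at its separators yields tuples of possibly different lengths, so parsing
  cannot fail and unequal lengths are the only defect to be checked.\<close>

lemma word_smp_encode:
  assumes "w \<in> lists (smp_alphabet S)"
  obtains L b where "w = smp_encode L b" "\<And>t. t \<in> set L \<Longrightarrow> set t \<subseteq> C" "set b \<subseteq> C"
proof -
  have "\<exists>L b. w = smp_encode L b \<and> (\<forall>t \<in> set L. set t \<subseteq> C) \<and> set b \<subseteq> C"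
    using assms
  proof (induction w)
    case Nil
    then show ?case by (intro exI[of _ "[]"]) (simp add: smp_encode_def)
  next
    case (Cons x w)
    then obtain L b where w: "w = smp_encode L b" "\<forall>t \<in> set L. set t \<subseteq> C" "set b \<subseteq> C" by auto
    show ?case
    proof (cases x)
      case Sep
      then show ?thesis using w by (intro exI[of _ "[] # L"] exI[of _ b]) (simp add: smp_encode_def)
    next
      case (Elem a)
      then have a: "a \<in> C" using Cons.hyps by (auto simp: smp_alphabet_def)
      show ?thesis
      proof (cases L)
        case Nil
        then show ?thesis using w a Elem
          by (intro exI[of _ "[]"] exI[of _ "a # b"]) (simp add: smp_encode_def)
      next
        case (Cons t L')
        then show ?thesis using w a Elem
          by (intro exI[of _ "(a # t) # L'"] exI[of _ b]) (simp add: smp_encode_def)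
      qed
    qed
  qed
  then show thesis using that by blast
qed

theorem SMP_in_P: "SMP S \<in> class_P (smp_alphabet S)"
proof (rule prog_decides_in_P[where P = main_prog and K = 17 and out = 15 and b = bound_poly])
  show "finite (smp_alphabet S)" using fin by (simp add: smp_alphabet_def)
  show "SMP S \<subseteq> lists (smp_alphabet S)"
    by (auto simp: SMP_def smp_encode_def sgrp_power_def smp_alphabet_def subset_iff split: if_splits)
  show "\<exists>s' t. runs (poly bound_poly (length w)) main_prog (init_stacks w) s' t \<and>
      (peek (s' 15) \<noteq> Blank \<longleftrightarrow> w \<in> SMP S)" if w: "w \<in> lists (smp_alphabet S)" for w
  proof -
    obtain L b where wb: "w = smp_encode L b" and L: "\<And>t. t \<in> set L \<Longrightarrow> set t \<subseteq> C" and b: "set b \<subseteq> C"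
      using word_smp_encode[OF w] by metis
    show ?thesis using yields_main[OF L b refl] unfolding wb yields_def by blast
  qed
qed (simp_all add: prog_wf_main)

end

text \<open>Powers depend on the multiplication only, so the exponent found for the semigroup with
  carrier \<open>I\<close> can be used in \<open>S\<close>.\<close>

lemma spow_carrier_update [simp]: "spow (S\<lparr>carrier := A\<rparr>) x j = spow S x j"
  by (induction j) auto

theorem corollary4p10:
  fixes S :: "'a sgrp" and I :: "'a set" and Q :: "'b sgrp"
  assumes "sgrp S" and "finite (carrier S)"
    and "ideal_extension S I Q"
    and "clifford (S\<lparr>carrier := I\<rparr>)"
    and "nilpotent_sgrp Q"
  shows "SMP S \<in> class_P (smp_alphabet S)"
proof -
  have ideal: "sgrp_ideal I S" using assms(3) by (simp add: ideal_extension_def)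
  then have I: "I \<subseteq> carrier S" by (simp add: sgrp_ideal_def)
  then have finI: "finite I" using assms(2) finite_subset by blast
  obtain k where "clifford_exp (S\<lparr>carrier := I\<rparr>) (carrier (S\<lparr>carrier := I\<rparr>)) k"
    using clifford_exp_exists[OF _ assms(4)] finI by auto
  then have k: "clifford_exp S I k" by (simp add: clifford_exp_def)
  obtain d where d: "d \<ge> 1" "\<And>xs. set xs \<subseteq> carrier S \<Longrightarrow> length xs = d \<Longrightarrow> sprod S xs \<in> I"
    using nilpotent_extension_products[OF assms(3,5)] by blast
  have "finite (insert SEP (El ` carrier S \<union> Work ` {0, 1, 2}))" using assms(2) by simp
  then obtain cs :: "'a smp_symbol tape_symbol list"
    where cs: "set cs = insert SEP (El ` carrier S \<union> Work ` {0, 1, 2})"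
    using finite_list by blast
  \<comment> \<open>Any number r of squarings with 2 d at most 2^r will do; 2 d itself is such a
    number.\<close>
  interpret smp_prog S I k d "2 * d" cs
  proof (intro smp_prog.intro nil_ext_clifford.intro k nil_ext_clifford_axioms.intro tuple_stacks.intro)
    show "2 * d \<le> 2 ^ (2 * d)" using less_exp[of "2 * d"] by simp
    show "s \<cdot>\<^bsub>S\<^esub> i \<in> I" if "s \<in> carrier S" "i \<in> I" for s i
      using ideal that by (simp add: sgrp_ideal_def)
  qed (use assms(1,2) I d cs in \<open>auto intro: sgrp.mult_closed sgrp.mult_assoc\<close>)
  show ?thesis by (rule SMP_in_P)
qed

end
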